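(* Let $\mathcal{I}\subseteq\mathbf{CG}$ be the vector subspace spanned by the monomials $C_\lambda F^p$ with $p>0$. Then $\mathcal{I}$ is a Hopf ideal of $\mathbf{CG}$, and the map $f:\Lambda\to\mathbf{CG}/\mathcal{I}$ defined by sending $h_\lambda$ to the image of $C_\lambda$ modulo $\mathcal{I}$ is an isomorphism of Hopf algebras.
   Context: $\mathbf{CG}$ is the Hopf algebra of lattices of order ideals of chain gangs (disjoint unions of chains) with phantoms, obtained via the Fock functor from the Hopf monoid of grounded set families (product = join, coproduct via restriction $\mathcal{F}|_S=\{F\cap S\}$ and contraction $\mathcal{F}/_S=\{F:F\cap S=\emptyset\}$). Concretely, over a field $\Bbbk$, as a graded algebra $\mathbf{CG}=\Bbbk[F,C_1,C_2,\dots]$ is the free polynomial algebra on $F$ (degree 1; the class of the trivial family $\{\emptyset\}$ on a one-element ground set, a phantom) and $C_n$ (degree $n$; the class of the chain of order ideals of an $n$-element chain), with $C_0=1$; for a partition $\lambda=(\lambda_1,\dots,\lambda_\ell)$ write $C_\lambda=C_{\lambda_1}\cdots C_{\lambda_\ell}$, and the monomials $C_\lambda F^p$ form a basis. The coproduct is the algebra morphism determined by $\Delta(F)=1\otimes F+F\otimes1$ and $\Delta(C_n)=1\otimes C_n+\sum_{m=1}^n\sum_{j=0}^{n-m}\binom{n-m}{j}C_{j+1}\otimes C_{m-1}F^{n-m-j}$. $\Lambda$ is the Hopf algebra of symmetric functions over $\Bbbk$, with complete homogeneous symmetric functions $h_n$, $h_\lambda=h_{\lambda_1}\cdots h_{\lambda_\ell}$,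 and $\Delta(h_n)=\sum_{i+j=n}h_i\otimes h_j$. A Hopf ideal is a subspace that is an ideal, a coideal ($\Delta(\mathcal{I})\subseteq\mathcal{I}\otimes\mathbf{CG}+\mathbf{CG}\otimes\mathcal{I}$), and closed under the antipode. *)

theory Defs
  imports "HOL-Algebra.Algebraic_Closure_Type" "HOL-Library.Poly_Mapping"
begin

text \<open>
  The ground field is a type \<open>'k\<close> of class \<^class>\<open>field\<close>; as a structure it is
  \<^const>\<open>ring_of_type_algebra\<close>.  Vector spaces and (commutative) algebras over it are
  \<^locale>\<open>module\<close>s and \<^locale>\<open>algebra\<close>s in the sense of \<^theory>\<open>HOL-Algebra.Module\<close>.
\<close>

abbreviation base_field :: "'k::field ring" where
  "base_field \<equiv> ring_of_type_algebra"

section \<open>Linear maps, algebra maps, quotients\<close>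

definition linear_maps ::
  "('k::field, 'a, 'm) module_scheme \<Rightarrow> ('k, 'b, 'n) module_scheme \<Rightarrow> ('a \<Rightarrow> 'b) set" where
  "linear_maps V W = {f \<in> carrier V \<rightarrow> carrier W.
     (\<forall>x\<in>carrier V. \<forall>y\<in>carrier V. f (x \<oplus>\<^bsub>V\<^esub> y) = f x \<oplus>\<^bsub>W\<^esub> f y) \<and>
     (\<forall>c. \<forall>x\<in>carrier V. f (c \<odot>\<^bsub>V\<^esub> x) = c \<odot>\<^bsub>W\<^esub> f x)}"

definition algebra_maps ::
  "('k::field, 'a, 'm) module_scheme \<Rightarrow> ('k, 'b, 'n) module_scheme \<Rightarrow> ('a \<Rightarrow> 'b) set" where
  "algebra_maps A B = linear_maps A B \<inter> ring_hom A B"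

definition quot_algebra ::
  "('k::field, 'a, 'm) module_scheme \<Rightarrow> 'a set \<Rightarrow> ('k, 'a set) module" where
  "quot_algebra A I =
     ring.extend (A Quot I) (module.fields (\<lambda>c T. \<Union>x\<in>T. I +>\<^bsub>A\<^esub> (c \<odot>\<^bsub>A\<^esub> x)))"

section \<open>Tensor products\<close>

definition vscale :: "'k::field \<Rightarrow> ('x \<Rightarrow>\<^sub>0 'k) \<Rightarrow> ('x \<Rightarrow>\<^sub>0 'k)" where
  "vscale c p = Poly_Mapping.map ((*) c) p"

text \<open>
  The vector space with basis the pairs \<open>(x, y) \<in> V \<times> W\<close>, with multiplication the bilinear
  extension of the componentwise one.
\<close>

definition free_pairs ::
  "('k::field, 'a, 'm) module_scheme \<Rightarrow> ('k, 'b, 'n) module_scheme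
     \<Rightarrow> ('k, 'a \<times> 'b \<Rightarrow>\<^sub>0 'k) module" where
  "free_pairs V W =
     \<lparr>carrier = {p. Poly_Mapping.keys p \<subseteq> carrier V \<times> carrier W},
      monoid.mult = (\<lambda>p q. \<Sum>s\<in>Poly_Mapping.keys p. \<Sum>t\<in>Poly_Mapping.keys q.
        Poly_Mapping.single (fst s \<otimes>\<^bsub>V\<^esub> fst t, snd s \<otimes>\<^bsub>W\<^esub> snd t)
          (Poly_Mapping.lookup p s * Poly_Mapping.lookup q t)),
      one = Poly_Mapping.single (\<one>\<^bsub>V\<^esub>, \<one>\<^bsub>W\<^esub>) 1,
      ring.zero = 0,
      add = (+),
      module.smult = vscale\<rparr>"

definition tensor_relations ::
  "('k::field, 'a, 'm) module_scheme \<Rightarrow> ('k, 'b, 'n) module_scheme \<Rightarrow> ('a \<times> 'b \<Rightarrow>\<^sub>0 'k) set" where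
  "tensor_relations V W =
     (let e = (\<lambda>x y. Poly_Mapping.single (x, y) 1) in
       {e (x \<oplus>\<^bsub>V\<^esub> x') y - e x y - e x' y | x x' y. x \<in> carrier V \<and> x' \<in> carrier V \<and> y \<in> carrier W}
     \<union> {e x (y \<oplus>\<^bsub>W\<^esub> y') - e x y - e x y' | x y y'. x \<in> carrier V \<and> y \<in> carrier W \<and> y' \<in> carrier W}
     \<union> {e (c \<odot>\<^bsub>V\<^esub> x) y - vscale c (e x y) | c x y. x \<in> carrier V \<and> y \<in> carrier W}
     \<union> {e x (c \<odot>\<^bsub>W\<^esub> y) - vscale c (e x y) | c x y. x \<in> carrier V \<and> y \<in> carrier W})"

definition tensor_null ::
  "('k::field, 'a, 'm) module_scheme \<Rightarrow> ('k, 'b, 'n) module_scheme \<Rightarrow> ('a \<times> 'b \<Rightarrow>\<^sub>0 'k) set" where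
  "tensor_null V W = module.span vscale (tensor_relations V W)"

definition tensor ::
  "('k::field, 'a, 'm) module_scheme \<Rightarrow> ('k, 'b, 'n) module_scheme
     \<Rightarrow> ('k, ('a \<times> 'b \<Rightarrow>\<^sub>0 'k) set) module" where
  "tensor V W = quot_algebra (free_pairs V W) (tensor_null V W)"

definition pure_tensor ::
  "('k::field, 'a, 'm) module_scheme \<Rightarrow> ('k, 'b, 'n) module_scheme
     \<Rightarrow> 'a \<Rightarrow> 'b \<Rightarrow> ('a \<times> 'b \<Rightarrow>\<^sub>0 'k) set" where
  "pure_tensor V W x y = tensor_null V W +>\<^bsub>free_pairs V W\<^esub> Poly_Mapping.single (x, y) 1"

text \<open>
  The linear map \<open>V \<otimes> W \<rightarrow> U\<close> induced by a bilinear \<open>\<beta> : V \<times> W \<rightarrow> U\<close>, computed on an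
  arbitrary representative of the coset; meaningful only if \<open>\<beta>\<close> is bilinear.
\<close>

definition tensor_lift ::
  "('k::field, 'c, 'm) module_scheme \<Rightarrow> ('a \<Rightarrow> 'b \<Rightarrow> 'c) \<Rightarrow> ('a \<times> 'b \<Rightarrow>\<^sub>0 'k) set \<Rightarrow> 'c" where
  "tensor_lift U \<beta> T = the_elem
     ((\<lambda>p. \<Oplus>\<^bsub>U\<^esub>s\<in>Poly_Mapping.keys p. Poly_Mapping.lookup p s \<odot>\<^bsub>U\<^esub> \<beta> (fst s) (snd s)) ` T)"

text \<open>\<open>f \<otimes> g\<close>, where \<open>V\<close> and \<open>W\<close> are the codomains of \<open>f\<close> and \<open>g\<close>.\<close>

definition tensor_map ::
  "('k::field, 'c, 'm) module_scheme \<Rightarrow> ('k, 'd, 'n) module_scheme \<Rightarrow> ('a \<Rightarrow> 'c) \<Rightarrow> ('b \<Rightarrow> 'd)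
     \<Rightarrow> ('a \<times> 'b \<Rightarrow>\<^sub>0 'k) set \<Rightarrow> ('c \<times> 'd \<Rightarrow>\<^sub>0 'k) set" where
  "tensor_map V W f g = tensor_lift (tensor V W) (\<lambda>x y. pure_tensor V W (f x) (g y))"

text \<open>The canonical map \<open>(A \<otimes> A) \<otimes> A \<rightarrow> A \<otimes> (A \<otimes> A)\<close>.\<close>

definition tensor_assoc ::
  "('k::field, 'a, 'm) module_scheme
     \<Rightarrow> (('a \<times> 'a \<Rightarrow>\<^sub>0 'k) set \<times> 'a \<Rightarrow>\<^sub>0 'k) set \<Rightarrow> ('a \<times> ('a \<times> 'a \<Rightarrow>\<^sub>0 'k) set \<Rightarrow>\<^sub>0 'k) set" where
  "tensor_assoc A = tensor_lift (tensor A (tensor A A))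
     (\<lambda>T z. tensor_lift (tensor A (tensor A A))
        (\<lambda>x y. pure_tensor A (tensor A A) x (pure_tensor A A y z)) T)"

text \<open>The image of \<open>P \<otimes> Q\<close> in \<open>V \<otimes> W\<close>, for subspaces \<open>P\<close> of \<open>V\<close> and \<open>Q\<close> of \<open>W\<close>.\<close>

definition tensor_subspace ::
  "('k::field, 'a, 'm) module_scheme \<Rightarrow> ('k, 'b, 'n) module_scheme
     \<Rightarrow> 'a set \<Rightarrow> 'b set \<Rightarrow> ('a \<times> 'b \<Rightarrow>\<^sub>0 'k) set set" where
  "tensor_subspace V W P Q =
     (\<lambda>p. tensor_null V W +>\<^bsub>free_pairs V W\<^esub> p) ` {p. Poly_Mapping.keys p \<subseteq> P \<times> Q}"

section \<open>Hopf algebras\<close>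

text \<open>
  \<^locale>\<open>algebra\<close> requires commutativity, so these are commutative bialgebras and Hopf algebras.
\<close>

record (overloaded) ('k::zero, 'a) hopf = "('k, 'a) module" +
  comult :: "'a \<Rightarrow> ('a \<times> 'a \<Rightarrow>\<^sub>0 'k) set"
  counit :: "'a \<Rightarrow> 'k"

locale bialgebra = algebra "base_field :: 'k::field ring" H
  for H :: "('k::field, 'a, 'm) hopf_scheme" (structure) +
  assumes comult_hom: "comult H \<in> algebra_maps H (tensor H H)"
    and counit_hom: "counit H \<in> ring_hom H base_field"
    and counit_smult: "x \<in> carrier H \<Longrightarrow> counit H (c \<odot> x) = c * counit H x"
    and coassoc: "x \<in> carrier H \<Longrightarrow>
      tensor_assoc H (tensor_map (tensor H H) H (comult H) id (comult H x)) =
      tensor_map H (tensor H H) id (comult H) (comult H x)"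
    and counit_left: "x \<in> carrier H \<Longrightarrow>
      tensor_lift H (\<lambda>y z. counit H y \<odot> z) (comult H x) = x"
    and counit_right: "x \<in> carrier H \<Longrightarrow>
      tensor_lift H (\<lambda>y z. counit H z \<odot> y) (comult H x) = x"

definition is_antipode :: "('k::field, 'a, 'm) hopf_scheme \<Rightarrow> ('a \<Rightarrow> 'a) \<Rightarrow> bool" where
  "is_antipode H S \<longleftrightarrow> S \<in> linear_maps H H \<and>
     (\<forall>x\<in>carrier H.
        tensor_lift H (\<lambda>y z. S y \<otimes>\<^bsub>H\<^esub> z) (comult H x) = counit H x \<odot>\<^bsub>H\<^esub> \<one>\<^bsub>H\<^esub> \<and>
        tensor_lift H (\<lambda>y z. y \<otimes>\<^bsub>H\<^esub> S z) (comult H x) = counit H x \<odot>\<^bsub>H\<^esub> \<one>\<^bsub>H\<^esub>)"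

locale hopf_algebra = bialgebra +
  assumes antipode_exists: "\<exists>S. is_antipode H S"

text \<open>The antipode is unique as a function on the carrier.\<close>

definition antipode :: "('k::field, 'a, 'm) hopf_scheme \<Rightarrow> 'a \<Rightarrow> 'a" where
  "antipode H = (THE S. S \<in> extensional (carrier H) \<and> is_antipode H S)"

locale hopf_ideal = hopf_algebra + ideal I H for I +
  assumes subspace: "submodule I base_field H"
    and comult_ideal: "comult H ` I \<subseteq>
      tensor_subspace H H I (carrier H) <+>\<^bsub>tensor H H\<^esub> tensor_subspace H H (carrier H) I"
    and counit_ideal: "counit H ` I \<subseteq> {0}"
    and antipode_ideal: "antipode H ` I \<subseteq> I"

text \<open>
  The structure maps of the quotient by a Hopf ideal \<open>I\<close>, computed on an arbitrary
  representative of the coset; meaningful only if \<open>I\<close> is a Hopf ideal.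
\<close>

definition quot_hopf ::
  "('k::field, 'a, 'm) hopf_scheme \<Rightarrow> 'a set \<Rightarrow> ('k, 'a set) hopf" where
  "quot_hopf H I = module.extend (quot_algebra H I)
     (hopf.fields
       (\<lambda>T. the_elem ((\<lambda>x. tensor_map (quot_algebra H I) (quot_algebra H I)
          (\<lambda>y. I +>\<^bsub>H\<^esub> y) (\<lambda>y. I +>\<^bsub>H\<^esub> y) (comult H x)) ` T))
       (\<lambda>T. the_elem (counit H ` T)))"

definition hopf_hom ::
  "('k::field, 'a, 'm) hopf_scheme \<Rightarrow> ('k, 'b, 'n) hopf_scheme \<Rightarrow> ('a \<Rightarrow> 'b) \<Rightarrow> bool" where
  "hopf_hom H G f \<longleftrightarrow> hopf_algebra H \<and> hopf_algebra G \<and> f \<in> algebra_maps H G \<and>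
     (\<forall>x\<in>carrier H. tensor_map G G f f (comult H x) = comult G (f x)) \<and>
     (\<forall>x\<in>carrier H. counit G (f x) = counit H x) \<and>
     (\<forall>x\<in>carrier H. f (antipode H x) = antipode G (f x))"

definition hopf_iso ::
  "('k::field, 'a, 'm) hopf_scheme \<Rightarrow> ('k, 'b, 'n) hopf_scheme \<Rightarrow> ('a \<Rightarrow> 'b) \<Rightarrow> bool" where
  "hopf_iso H G f \<longleftrightarrow> hopf_hom H G f \<and> bij_betw f (carrier H) (carrier G)"

text \<open>Partitions are weakly decreasing lists of positive integers.\<close>

definition is_partition :: "nat list \<Rightarrow> bool" where
  "is_partition ns \<longleftrightarrow> sorted_wrt (\<ge>) ns \<and> 0 \<notin> set ns"

section \<open>The Hopf algebra of chain gangs with phantoms\<close>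

text \<open>
  Polynomials in variables indexed by \<^typ>\<open>nat\<close>: variable \<open>0\<close> is the phantom \<open>F\<close> and
  variable \<open>n \<ge> 1\<close> is \<open>C\<^sub>n\<close>.
\<close>

type_synonym 'k cg = "(nat \<Rightarrow>\<^sub>0 nat) \<Rightarrow>\<^sub>0 'k"

definition cg_var :: "nat \<Rightarrow> 'k::field cg" where
  "cg_var i = Poly_Mapping.single (Poly_Mapping.single i 1) 1"

definition phantom :: "'k::field cg" where
  "phantom = cg_var 0"

definition chain :: "nat \<Rightarrow> 'k::field cg" where
  "chain n = (if n = 0 then 1 else cg_var n)"

definition chains :: "nat list \<Rightarrow> 'k::field cg" where
  "chains ns = prod_list (map chain ns)"

definition CG_algebra :: "('k::field, 'k cg) module" where
  "CG_algebra = \<lparr>carrier = UNIV, monoid.mult = (*), one = 1, ring.zero = 0, add = (+), module.smult = vscale\<rparr>"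

definition comult_phantom :: "('k::field cg \<times> 'k cg \<Rightarrow>\<^sub>0 'k) set" where
  "comult_phantom = pure_tensor CG_algebra CG_algebra 1 phantom
     \<oplus>\<^bsub>tensor CG_algebra CG_algebra\<^esub> pure_tensor CG_algebra CG_algebra phantom 1"

definition comult_chain :: "nat \<Rightarrow> ('k::field cg \<times> 'k cg \<Rightarrow>\<^sub>0 'k) set" where
  "comult_chain n = pure_tensor CG_algebra CG_algebra 1 (chain n)
     \<oplus>\<^bsub>tensor CG_algebra CG_algebra\<^esub>
     (\<Oplus>\<^bsub>tensor CG_algebra CG_algebra\<^esub>m\<in>{1..n}. \<Oplus>\<^bsub>tensor CG_algebra CG_algebra\<^esub>j\<in>{0..n-m}.
        of_nat ((n - m) choose j) \<odot>\<^bsub>tensor CG_algebra CG_algebra\<^esub>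
          pure_tensor CG_algebra CG_algebra
            (chain (j + 1)) (chain (m - 1) * phantom ^ (n - m - j)))"

text \<open>The algebra map sending \<open>F\<close> and the \<open>C\<^sub>n\<close> to the elements above.\<close>

definition comult_CG :: "'k::field cg \<Rightarrow> ('k cg \<times> 'k cg \<Rightarrow>\<^sub>0 'k) set" where
  "comult_CG p = (\<Oplus>\<^bsub>tensor CG_algebra CG_algebra\<^esub>u\<in>Poly_Mapping.keys p.
     Poly_Mapping.lookup p u \<odot>\<^bsub>tensor CG_algebra CG_algebra\<^esub>
       (\<Otimes>\<^bsub>tensor CG_algebra CG_algebra\<^esub>i\<in>Poly_Mapping.keys u.
          (if i = 0 then comult_phantom else comult_chain i)
            [^]\<^bsub>tensor CG_algebra CG_algebra\<^esub> Poly_Mapping.lookup u i))"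

text \<open>The counit is the projection to degree zero.\<close>

definition CG :: "('k::field, 'k cg) hopf" where
  "CG = module.extend CG_algebra (hopf.fields comult_CG (\<lambda>p. Poly_Mapping.lookup p 0))"

definition phantom_ideal :: "'k::field cg set" where
  "phantom_ideal =
     module.span vscale {chains ns * phantom ^ p | ns p. is_partition ns \<and> p > 0}"

section \<open>The Hopf algebra of symmetric functions\<close>

text \<open>
  Formal power series in countably many variables, given by their coefficients; symmetric
  functions are the symmetric ones of bounded degree.  \<^term>\<open>Poly_Mapping.map_key \<sigma> u\<close> is the
  monomial \<open>u\<close> with variables permuted by \<open>\<sigma>\<close>.
\<close>

type_synonym 'k mpseries = "(nat \<Rightarrow>\<^sub>0 nat) \<Rightarrow> 'k"

definition mon_degree :: "(nat \<Rightarrow>\<^sub>0 nat) \<Rightarrow> nat" where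
  "mon_degree u = (\<Sum>i\<in>Poly_Mapping.keys u. Poly_Mapping.lookup u i)"

definition Sym_algebra :: "('k::field, 'k mpseries) module" where
  "Sym_algebra =
     \<lparr>carrier = {f. (\<forall>\<sigma> u. bij \<sigma> \<longrightarrow> f (Poly_Mapping.map_key \<sigma> u) = f u) \<and>
                    (\<exists>d. \<forall>u. f u \<noteq> 0 \<longrightarrow> mon_degree u \<le> d)},
      monoid.mult = (\<lambda>f g u. \<Sum>(v, w)\<in>{(v, w). v + w = u}. f v * g w),
      one = (\<lambda>u. if u = 0 then 1 else 0),
      ring.zero = (\<lambda>u. 0),
      add = (\<lambda>f g u. f u + g u),
      module.smult = (\<lambda>c f u. c * f u)\<rparr>"

definition complete_homogeneous :: "nat \<Rightarrow> 'k::field mpseries" where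
  "complete_homogeneous n = (\<lambda>u. if mon_degree u = n then 1 else 0)"

definition complete_homogeneous_part :: "nat list \<Rightarrow> 'k::field mpseries" where
  "complete_homogeneous_part ns =
     foldr (\<lambda>n f. complete_homogeneous n \<otimes>\<^bsub>Sym_algebra\<^esub> f) ns \<one>\<^bsub>Sym_algebra\<^esub>"

text \<open>The unique algebra map with \<open>h\<^sub>n \<mapsto> \<Sum>i+j=n. h\<^sub>i \<otimes> h\<^sub>j\<close>.\<close>

definition comult_Sym :: "'k::field mpseries \<Rightarrow> ('k mpseries \<times> 'k mpseries \<Rightarrow>\<^sub>0 'k) set" where
  "comult_Sym = (THE D. D \<in> extensional (carrier Sym_algebra) \<and>
     D \<in> algebra_maps Sym_algebra (tensor Sym_algebra Sym_algebra) \<and>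
     (\<forall>n. D (complete_homogeneous n) =
        (\<Oplus>\<^bsub>tensor Sym_algebra Sym_algebra\<^esub>i\<in>{0..n}. pure_tensor Sym_algebra Sym_algebra
           (complete_homogeneous i) (complete_homogeneous (n - i)))))"

text \<open>The counit is the constant term.\<close>

definition Sym :: "('k::field, 'k mpseries) hopf" where
  "Sym = module.extend Sym_algebra (hopf.fields comult_Sym (\<lambda>f. f 0))"

section \<open>The comparison map\<close>

definition h_to_chains :: "('k::field mpseries \<Rightarrow> 'k cg set) \<Rightarrow> bool" where
  "h_to_chains f \<longleftrightarrow> f \<in> extensional (carrier Sym) \<and>
     f \<in> linear_maps Sym (quot_hopf CG phantom_ideal) \<and>
     (\<forall>ns. is_partition ns \<longrightarrow>
        f (complete_homogeneous_part ns) = phantom_ideal +>\<^bsub>CG\<^esub> chains ns)"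

end

theory Submission
  imports Defs "HOL-Computational_Algebra.Formal_Power_Series" "HOL-Combinatorics.Permutations"
begin

text \<open>
  With \<open>C(x) = \<Sum>n. C\<^sub>n x\<^sup>n\<close>, the coproduct of \<open>CG\<close> reads
  \<open>\<Delta> C(x) = C(x / (1 - x F'')) \<otimes> C(x)\<close>, where \<open>F'' = 1 \<otimes> F\<close>.  So \<open>CG\<close> represents the semidirect
  product of the additive group, acting by \<open>x \<mapsto> x / (1 - f x)\<close>, with the multiplicative group of
  power series with constant term 1.  Coassociativity and the antipode are read off from this, being
  identities in a universal polynomial ring that are transported to any algebra by evaluation.

  The phantom ideal is generated by the primitive element \<open>F\<close>, and modulo \<open>F\<close> the coproduct becomes
  \<open>\<Delta> C(x) = C(x) \<otimes> C(x)\<close>.  The evaluation \<open>F \<mapsto> 0\<close>, \<open>C\<^sub>n \<mapsto> h\<^sub>n\<close> is surjective onto the symmetric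
  functions with kernel the phantom ideal: leading monomials show this for the elementary \<open>e\<^sub>n\<close> in
  place of the \<open>h\<^sub>n\<close>, and the involution \<open>C(x) \<mapsto> 1 / C(- x)\<close> exchanges the two.  Finally \<open>Sym\<close> and
  the quotient are Hopf algebras because both are images of \<open>CG\<close> under compatible surjections with the
  same kernel, which therefore induce an isomorphism.
\<close>

text \<open>The type \<open>cg\<close>, a polynomial ring in countably many variables, therefore has
  two roles: it carries \<open>CG\<close>, and it is the domain in which universal identities are
  proved before evaluation.

  Leading monomials do not separate products of the h_n: in lexicographic order all those of degree
  d share the leading monomial x_0^d. Products of the e_n have pairwise distinct leading monomials,
  exactly the decreasing exponent sequences, whence both independence and generation.

  The coproduct of \<open>Sym\<close> is a definite description, so its existence is itself a claim.
  It rests on the kernel computation: if q sends F to 0 and C_n to h_n, then the coproduct of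
  \<open>CG\<close> followed by q on both factors kills F and hence factors through
  \<open>Sym\<close>.

  Tensors are cosets of formal sums of pairs; identities between maps on them are reduced to pure
  tensors.\<close>

abbreviation "lookup \<equiv> Poly_Mapping.lookup"
abbreviation "keys \<equiv> Poly_Mapping.keys"
abbreviation "single \<equiv> Poly_Mapping.single"
abbreviation "map_key \<equiv> Poly_Mapping.map_key"

section \<open>Algebras over a field type\<close>

lemma base_field_sel [simp]:
  "carrier (base_field :: 'k::field ring) = UNIV"
  "x \<otimes>\<^bsub>(base_field :: 'k ring)\<^esub> y = x * y"
  "x \<oplus>\<^bsub>(base_field :: 'k ring)\<^esub> y = x + y"
  "\<one>\<^bsub>(base_field :: 'k ring)\<^esub> = 1"
  "\<zero>\<^bsub>(base_field :: 'k ring)\<^esub> = 0"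
  by (simp_all add: ring_of_type_algebra_def)

text \<open>Both \<open>tensor_null\<close> and \<open>phantom_ideal\<close> are spans with respect
  to \<open>vscale\<close>; the interpretation below supplies the theory of spans for them.\<close>

lemma vscale_vector_space: "vector_space (vscale :: 'k::field \<Rightarrow> ('x \<Rightarrow>\<^sub>0 'k)
  \<Rightarrow> _)"
proof -
  have l: "lookup (vscale c p) u = c * lookup p u"
    for c :: 'k and p :: "'x \<Rightarrow>\<^sub>0 'k" and u
    by (simp add: vscale_def map.rep_eq when_def)
  show ?thesis
    by unfold_locales (rule poly_mapping_eqI; simp add: l lookup_add algebra_simps)+
qed

interpretation vs: vector_space "vscale :: 'k::field \<Rightarrow> ('x \<Rightarrow>\<^sub>0 'k) \<Rightarrow> _"
  by (rule vscale_vector_space)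

lemma lookup_vscale [simp]: "lookup (vscale c p) u = c * lookup p u"
  by (simp add: vscale_def map.rep_eq when_def)

lemma vscale_single [simp]: "vscale c (single x d) = single x (c * d)"
  by (simp add: vscale_def)

lemma keys_vscale: "keys (vscale c p) \<subseteq> keys p"
  by (auto simp: in_keys_iff)

lemma vscale_mult_left: "vscale c p * q = vscale c (p * q)"
  for p q :: "'a::comm_monoid_add \<Rightarrow>\<^sub>0 'k::field"
  by (simp add: vscale_def mult_map_scale_conv_mult mult.assoc)

text \<open>Keeping the support inside \<open>D\<close> throughout the induction preserves carrier
  conditions; \<open>D\<close> is typically a product of two carriers.\<close>

lemma poly_mapping_induct_on [consumes 1, case_names zero single add]:
  fixes p :: "'x \<Rightarrow>\<^sub>0 'k::comm_monoid_add"
  assumes "keys p \<subseteq> D"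
    and "P 0" and "\<And>x c. x \<in> D \<Longrightarrow> P (single x c)"
    and "\<And>p q. keys p \<subseteq> D \<Longrightarrow> keys q \<subseteq> D \<Longrightarrow> P p
      \<Longrightarrow> P q \<Longrightarrow> P (p + q)"
  shows "P p"
  using assms(1)
proof (induction p rule: update_induct)
  case const
  then show ?case using assms(2) by simp
next
  case (update f a b)
  have eq: "Poly_Mapping.update a b f = f + single a b"
    using update(1) by (auto intro!: poly_mapping_eqI
        simp: lookup_update lookup_add lookup_single when_def in_keys_iff)
  have k: "keys (Poly_Mapping.update a b f) = insert a (keys f)"
    using update(2) by (simp add: keys_update)
  show ?case unfolding eq using update k assms(3)[of a b] by (intro assms(4)) auto
qed

text \<open>The laws of \<open>algebra\<close> ask each scalar to lie in the carrier of the base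
  ring. For a field type this always holds, and the locale restates the laws as rewrite rules
  without that premise.\<close>

locale kalgebra = algebra "base_field :: 'k::field ring" A
  for A :: "('k::field, 'a, 'm) module_scheme" (structure)
begin

lemma sm_closed [simp, intro]: "x \<in> carrier A \<Longrightarrow> c \<odot> x \<in> carrier A"
  and sm_add_l: "x \<in> carrier A \<Longrightarrow> (c + d) \<odot> x = c \<odot> x \<oplus> d \<odot> x"
  and sm_add_r: "x \<in> carrier A \<Longrightarrow> y \<in> carrier A \<Longrightarrow> c \<odot> (x \<oplus>
    y) = c \<odot> x \<oplus> c \<odot> y"
  and sm_sm: "x \<in> carrier A \<Longrightarrow> c \<odot> (d \<odot> x) = (c * d) \<odot> x"
  and sm_1 [simp]: "x \<in> carrier A \<Longrightarrow> 1 \<odot> x = x"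
  and sm_0 [simp]: "x \<in> carrier A \<Longrightarrow> 0 \<odot> x = \<zero>"
  and sm_zero [simp]: "c \<odot> \<zero> = \<zero>"
  and sm_mult_l: "x \<in> carrier A \<Longrightarrow> y \<in> carrier A \<Longrightarrow> (c \<odot> x)
    \<otimes> y = c \<odot> (x \<otimes> y)"
  using smult_closed[of c x] smult_l_distr[of c d x] smult_r_distr[of c x y] smult_assoc1[of c d x]
    smult_one[of x] smult_assoc2[of c x y] smult_l_null[of x] smult_r_null[of c]
  by simp_all

lemma sm_mult_r: "x \<in> carrier A \<Longrightarrow> y \<in> carrier A \<Longrightarrow> x \<otimes> (c
  \<odot> y) = c \<odot> (x \<otimes> y)"
  by (metis sm_mult_l m_comm sm_closed)

lemma sm_one_mult: "x \<in> carrier A \<Longrightarrow> (c \<odot> \<one>) \<otimes> x = c \<odot> x"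
  by (simp add: sm_mult_l)

lemma sm_minus: "x \<in> carrier A \<Longrightarrow> (- 1) \<odot> x = \<ominus> x"
  by (metis M.minus_equality sm_add_l sm_0 sm_1 sm_closed add.left_inverse)

lemma finsum_sm: "f \<in> S \<rightarrow> carrier A \<Longrightarrow> c \<odot> finsum A f S =
  (\<Oplus>s\<in>S. c \<odot> f s)"
  by (cases "finite S") (auto simp: finsum_smult_ldistr M.add.finprod_infinite)

end

lemma kalgebraI:
  fixes A (structure)
  assumes "cring A"
    and "\<And>c x. x \<in> carrier A \<Longrightarrow> c \<odot> x \<in> carrier A"
    and "\<And>c d x. x \<in> carrier A \<Longrightarrow> (c + d) \<odot> x = c \<odot> x \<oplus> d \<odot> x"
    and "\<And>c x y. x \<in> carrier A \<Longrightarrow> y \<in> carrier A \<Longrightarrow> c \<odot> (x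
      \<oplus> y) = c \<odot> x \<oplus> c \<odot> y"
    and "\<And>c d x. x \<in> carrier A \<Longrightarrow> (c * d) \<odot> x = c \<odot> (d \<odot> x)"
    and "\<And>x. x \<in> carrier A \<Longrightarrow> 1 \<odot> x = x"
    and "\<And>c x y. x \<in> carrier A \<Longrightarrow> y \<in> carrier A \<Longrightarrow> (c \<odot> x)
      \<otimes> y = c \<odot> (x \<otimes> y)"
  shows "kalgebra A"
  unfolding kalgebra_def
  by (rule algebraI) (use assms cring_from_type_algebra in auto)

section \<open>Linear maps and linear extension\<close>

lemma linear_mapsI:
  assumes "\<And>x. x \<in> carrier V \<Longrightarrow> f x \<in> carrier W"
    and "\<And>x y. x \<in> carrier V \<Longrightarrow> y \<in> carrier V \<Longrightarrow> f (x
      \<oplus>\<^bsub>V\<^esub> y) = f x \<oplus>\<^bsub>W\<^esub> f y"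
    and "\<And>c x. x \<in> carrier V \<Longrightarrow> f (c \<odot>\<^bsub>V\<^esub> x) = c
      \<odot>\<^bsub>W\<^esub> f x"
  shows "f \<in> linear_maps V W"
  using assms by (auto simp: linear_maps_def)

lemma linear_mapsD:
  assumes "f \<in> linear_maps V W"
  shows "x \<in> carrier V \<Longrightarrow> f x \<in> carrier W"
    and "x \<in> carrier V \<Longrightarrow> y \<in> carrier V \<Longrightarrow> f (x \<oplus>\<^bsub>V\<^esub>
      y) = f x \<oplus>\<^bsub>W\<^esub> f y"
    and "x \<in> carrier V \<Longrightarrow> f (c \<odot>\<^bsub>V\<^esub> x) = c \<odot>\<^bsub>W\<^esub> f x"
  using assms by (auto simp: linear_maps_def)

lemma algebra_mapsI:
  assumes "f \<in> linear_maps A B"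
    and "\<And>x y. x \<in> carrier A \<Longrightarrow> y \<in> carrier A \<Longrightarrow> f (x
      \<otimes>\<^bsub>A\<^esub> y) = f x \<otimes>\<^bsub>B\<^esub> f y"
    and "f \<one>\<^bsub>A\<^esub> = \<one>\<^bsub>B\<^esub>"
  shows "f \<in> algebra_maps A B"
  using assms by (auto simp: algebra_maps_def linear_maps_def ring_hom_def)

lemma algebra_mapsD:
  assumes "f \<in> algebra_maps A B"
  shows "f \<in> linear_maps A B"
    and "x \<in> carrier A \<Longrightarrow> f x \<in> carrier B"
    and "x \<in> carrier A \<Longrightarrow> y \<in> carrier A \<Longrightarrow> f (x \<oplus>\<^bsub>A\<^esub>
      y) = f x \<oplus>\<^bsub>B\<^esub> f y"
    and "x \<in> carrier A \<Longrightarrow> f (c \<odot>\<^bsub>A\<^esub> x) = c \<odot>\<^bsub>B\<^esub> f x"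
    and "x \<in> carrier A \<Longrightarrow> y \<in> carrier A \<Longrightarrow> f (x
      \<otimes>\<^bsub>A\<^esub> y) = f x \<otimes>\<^bsub>B\<^esub> f y"
    and "f \<one>\<^bsub>A\<^esub> = \<one>\<^bsub>B\<^esub>"
  using assms by (auto simp: algebra_maps_def linear_maps_def ring_hom_def)

lemma linear_maps_comp:
  "f \<in> linear_maps U V \<Longrightarrow> g \<in> linear_maps V W \<Longrightarrow> (\<lambda>x. g (f x))
    \<in> linear_maps U W"
  by (auto simp: linear_maps_def Pi_iff)

lemma algebra_maps_comp:
  "f \<in> algebra_maps A B \<Longrightarrow> g \<in> algebra_maps B C \<Longrightarrow> (\<lambda>x. g (f x))
    \<in> algebra_maps A C"
  by (auto simp: algebra_maps_def linear_maps_def ring_hom_def Pi_iff)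

lemma linear_maps_id: "(\<lambda>x. x) \<in> linear_maps A A"
  by (auto simp: linear_maps_def)

lemma algebra_maps_id: "(\<lambda>x. x) \<in> algebra_maps A A"
  by (auto simp: algebra_maps_def linear_maps_def ring_hom_def)

lemma linear_maps_zero:
  assumes "kalgebra V" "kalgebra W" "f \<in> linear_maps V W"
  shows "f \<zero>\<^bsub>V\<^esub> = \<zero>\<^bsub>W\<^esub>"
proof -
  interpret V: kalgebra V by fact
  interpret W: kalgebra W by fact
  have "f (0 \<odot>\<^bsub>V\<^esub> \<zero>\<^bsub>V\<^esub>) = 0 \<odot>\<^bsub>W\<^esub> f \<zero>\<^bsub>V\<^esub>"
    using linear_mapsD[OF assms(3)] by blast
  then show ?thesis using linear_mapsD[OF assms(3)] by simp
qed

lemma linear_maps_finsum: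
  assumes "kalgebra V" "kalgebra W" "f \<in> linear_maps V W" "g \<in> S \<rightarrow> carrier V"
  shows "f (finsum V g S) = (\<Oplus>\<^bsub>W\<^esub>s\<in>S. f (g s))"
proof -
  interpret V: kalgebra V by fact
  interpret W: kalgebra W by fact
  show ?thesis
  proof (cases "finite S")
    case True
    then show ?thesis using assms(4)
      by (induction S) (auto simp: linear_maps_zero[OF assms(1-3)] linear_mapsD[OF assms(3)] Pi_iff
          V.M.finsum_closed)
  next
    case False
    then show ?thesis
      by (simp add: V.M.add.finprod_infinite W.M.add.finprod_infinite linear_maps_zero[OF assms(1-3)])
  qed
qed

lemma algebra_maps_pow:
  assumes "kalgebra A" "kalgebra B" "f \<in> algebra_maps A B" "x \<in> carrier A"
  shows "f (x [^]\<^bsub>A\<^esub> (n::nat)) = f x [^]\<^bsub>B\<^esub> n"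
proof -
  interpret A: kalgebra A by fact
  interpret B: kalgebra B by fact
  show ?thesis
    by (induction n) (use assms(4) in \<open>auto simp: algebra_mapsD[OF assms(3)]\<close>)
qed

text \<open>A single notion of linear extension serves \<open>tensor_lift\<close>, where the basis
  consists of pairs, and evaluation of polynomials, where it consists of monomials.\<close>

definition lext :: "('k::field, 'a, 'm) module_scheme \<Rightarrow> ('x \<Rightarrow> 'a) \<Rightarrow> ('x
  \<Rightarrow>\<^sub>0 'k) \<Rightarrow> 'a" where
  "lext U b p = (\<Oplus>\<^bsub>U\<^esub>s\<in>keys p. lookup p s \<odot>\<^bsub>U\<^esub> b s)"

context kalgebra
begin

lemma lext_superset:
  assumes "finite S" "keys p \<subseteq> S" "b \<in> S \<rightarrow> carrier A"
  shows "lext A b p = (\<Oplus>s\<in>S. lookup p s \<odot> b s)"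
  unfolding lext_def
  by (rule M.add.finprod_mono_neutral_cong_left)
    (use assms in \<open>auto simp: in_keys_iff Pi_iff\<close>)

lemma lext_closed:
  "keys p \<subseteq> D \<Longrightarrow> b \<in> D \<rightarrow> carrier A \<Longrightarrow> lext A b p \<in>
    carrier A"
  unfolding lext_def by (rule M.finsum_closed) auto

lemma lext_add:
  assumes "keys p \<subseteq> D" "keys q \<subseteq> D" "b \<in> D \<rightarrow> carrier A"
  shows "lext A b (p + q) = lext A b p \<oplus> lext A b q"
proof -
  let ?S = "keys p \<union> keys q"
  have b: "b \<in> ?S \<rightarrow> carrier A" using assms by auto
  have "lext A b (p + q) = (\<Oplus>s\<in>?S. lookup (p + q) s \<odot> b s)"
    by (rule lext_superset) (use b keys_add[of p q] in auto)
  also have "\<dots> = (\<Oplus>s\<in>?S. lookup p s \<odot> b s \<oplus> lookup q s \<odot> b s)"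
    by (rule M.finsum_cong') (use b in \<open>auto simp: lookup_add sm_add_l Pi_iff\<close>)
  also have "\<dots> = (\<Oplus>s\<in>?S. lookup p s \<odot> b s) \<oplus> (\<Oplus>s\<in>?S. lookup q s \<odot> b s)"
    by (rule M.finsum_addf) (use b in auto)
  finally show ?thesis
    using lext_superset[of ?S p b] lext_superset[of ?S q b] b by simp
qed

lemma lext_vscale:
  assumes "keys p \<subseteq> D" "b \<in> D \<rightarrow> carrier A"
  shows "lext A b (vscale c p) = c \<odot> lext A b p"
proof -
  let ?S = "keys p"
  have b: "b \<in> ?S \<rightarrow> carrier A" using assms by auto
  have "lext A b (vscale c p) = (\<Oplus>s\<in>?S. lookup (vscale c p) s \<odot> b s)"
    by (rule lext_superset) (use b keys_vscale[of c p] in auto)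
  also have "\<dots> = (\<Oplus>s\<in>?S. c \<odot> (lookup p s \<odot> b s))"
    by (rule M.finsum_cong') (use b in \<open>auto simp: sm_sm Pi_iff\<close>)
  also have "\<dots> = c \<odot> lext A b p"
    unfolding lext_def by (rule finsum_sm[symmetric]) (use b in auto)
  finally show ?thesis .
qed

lemma lext_zero [simp]: "lext A b 0 = \<zero>"
  by (simp add: lext_def)

lemma lext_single [simp]: "b x \<in> carrier A \<Longrightarrow> lext A b (single x c) = c \<odot> b x"
  by (cases "c = 0") (simp_all add: lext_def)

end

section \<open>Quotient algebras\<close>

locale kalgebra_ideal = kalgebra A + ideal I A for A (structure) and I
begin

lemma carrier_quot: "carrier (quot_algebra A I) = (\<lambda>x. I +> x) ` carrier A"
  by (auto simp: quot_algebra_def ring.extend_def FactRing_def A_RCOSETS_def RCOSETS_def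
      a_r_coset_def)

lemma quot_add: "x \<in> carrier A \<Longrightarrow> y \<in> carrier A \<Longrightarrow>
    (I +> x) \<oplus>\<^bsub>quot_algebra A I\<^esub> (I +> y) = I +> (x \<oplus> y)"
  by (simp add: quot_algebra_def ring.extend_def FactRing_def a_rcos_sum)

lemma quot_mult: "x \<in> carrier A \<Longrightarrow> y \<in> carrier A \<Longrightarrow>
    (I +> x) \<otimes>\<^bsub>quot_algebra A I\<^esub> (I +> y) = I +> (x \<otimes> y)"
  by (simp add: quot_algebra_def ring.extend_def FactRing_def rcoset_mult_add)

lemma quot_one: "\<one>\<^bsub>quot_algebra A I\<^esub> = I +> \<one>"
  by (simp add: quot_algebra_def ring.extend_def FactRing_def)

lemma quot_zero: "\<zero>\<^bsub>quot_algebra A I\<^esub> = I"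
  by (simp add: quot_algebra_def ring.extend_def FactRing_def)

lemma coset_eq_iff: "x \<in> carrier A \<Longrightarrow> y \<in> carrier A \<Longrightarrow> I +> x = I +> y
  \<longleftrightarrow> x \<ominus> y \<in> I"
  using quotient_eq_iff_same_a_r_cos[OF ideal_axioms, of x y] by blast

lemma coset_eq_self: "y \<in> I +> x \<Longrightarrow> x \<in> carrier A \<Longrightarrow> I +> y = I +> x"
  by (metis a_repr_independence' a_elemrcos_carrier)

lemma coset_eq_zero_iff: "x \<in> carrier A \<Longrightarrow> I +> x = I \<longleftrightarrow> x \<in> I"
  by (metis a_coset_join2 a_rcos_const a_subgroup a_rcos_self)

text \<open>Scaling by \<open>c\<close> is multiplication by \<open>c \<odot> \<one>\<close>, which
  an ideal absorbs.\<close>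

lemma ideal_smult: "x \<in> I \<Longrightarrow> c \<odot> x \<in> I"
  using I_l_closed[of x "c \<odot> \<one>"] Icarr[of x] by (simp add: sm_one_mult)

lemma quot_smult:
  assumes "x \<in> carrier A"
  shows "c \<odot>\<^bsub>quot_algebra A I\<^esub> (I +> x) = I +> (c \<odot> x)"
proof -
  \<comment> \<open>Every representative yields the same coset, so the union in
    \<open>quot_algebra\<close> collapses to it.\<close>
  have eq: "I +> (c \<odot> y) = I +> (c \<odot> x)" if y: "y \<in> I +> x" for y
  proof -
    obtain i where i: "i \<in> I" "y = i \<oplus> x" using y unfolding a_r_coset_def'[of A I x] by auto
    have "c \<odot> y = c \<odot> i \<oplus> c \<odot> x" using i assms Icarr by (simp add: sm_add_r)
    then have "c \<odot> y \<in> I +> (c \<odot> x)" using ideal_smult[OF i(1)] unfolding a_r_coset_def'[of A I] by auto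
    then show ?thesis using assms by (simp add: coset_eq_self)
  qed
  have ne: "I +> x \<noteq> {}" using a_rcos_self[OF assms] by blast
  have "(\<Union>y\<in>I +> x. I +> (c \<odot> y)) = (\<Union>y\<in>I +> x. I +> (c \<odot> x))"
    by (intro SUP_cong refl eq)
  also have "\<dots> = I +> (c \<odot> x)" using ne by (rule SUP_const)
  finally have "(\<Union>y\<in>I +> x. I +> (c \<odot> y)) = I +> (c \<odot> x)" .
  then show ?thesis
    by (simp add: quot_algebra_def ring.extend_def module.defs)
qed

text \<open>The operations are those of \<open>A Quot I\<close> in a larger record, so the ring
  axioms are copied over.\<close>

lemma quot_cring: "cring (quot_algebra A I)"
proof -
  have "cring (A Quot I)" by (rule quotient_is_cring) (rule M_cring)
  then interpret Q: cring "A Quot I" .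
  let ?Q = "quot_algebra A I"
  have sel: "carrier ?Q = carrier (A Quot I)" "add ?Q = add (A Quot I)" "monoid.mult ?Q = monoid.mult (A Quot I)"
    "monoid.one ?Q = monoid.one (A Quot I)" "ring.zero ?Q = ring.zero (A Quot I)"
    by (auto simp: quot_algebra_def ring.extend_def)
  show ?thesis
  proof (intro cringI abelian_groupI comm_monoidI)
    fix x assume "x \<in> carrier ?Q"
    then show "\<exists>y\<in>carrier ?Q. y \<oplus>\<^bsub>?Q\<^esub> x = \<zero>\<^bsub>?Q\<^esub>"
      unfolding sel using Q.l_neg[of x] by blast
  qed (simp_all add: sel Q.a_assoc Q.m_assoc Q.l_distr, simp_all add: Q.a_comm Q.m_comm)
qed

lemma quot_kalgebra: "kalgebra (quot_algebra A I)"
  by (rule kalgebraI[OF quot_cring])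
    (auto simp: carrier_quot quot_add quot_mult quot_smult sm_add_l sm_add_r sm_sm sm_mult_l)

lemma quot_proj: "(\<lambda>x. I +> x) \<in> algebra_maps A (quot_algebra A I)"
  by (intro algebra_mapsI linear_mapsI)
    (auto simp: carrier_quot quot_add quot_mult quot_smult quot_one)

end

section \<open>Tensor products of algebras\<close>

lemma keys_addD: "x \<in> keys (p + q) \<Longrightarrow> x \<in> keys p \<or> x \<in> keys q"
  for p q :: "'x \<Rightarrow>\<^sub>0 'k::field"
  using keys_add[of p q] by blast

lemma keys_diffD: "x \<in> keys (p - q) \<Longrightarrow> x \<in> keys p \<or> x \<in> keys q"
  for p q :: "'x \<Rightarrow>\<^sub>0 'k::field"
  by (auto simp: in_keys_iff lookup_minus)

lemma keys_diff_subset: "keys p \<subseteq> D \<Longrightarrow> keys q \<subseteq> D \<Longrightarrow> keys (p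
  - q) \<subseteq> D"
  for p q :: "'x \<Rightarrow>\<^sub>0 'k::field"
  by (auto dest: keys_diffD)

lemma keys_add_subset: "keys p \<subseteq> D \<Longrightarrow> keys q \<subseteq> D \<Longrightarrow> keys (p +
  q) \<subseteq> D"
  for p q :: "'x \<Rightarrow>\<^sub>0 'k::field"
  by (auto dest: keys_addD)

section \<open>The algebra of formal sums of pairs\<close>

lemma free_pairs_sel [simp]:
  "carrier (free_pairs V W) = {p. keys p \<subseteq> carrier V \<times> carrier W}"
  "\<one>\<^bsub>free_pairs V W\<^esub> = single (\<one>\<^bsub>V\<^esub>, \<one>\<^bsub>W\<^esub>) 1"
  "\<zero>\<^bsub>free_pairs V W\<^esub> = 0"
  "p \<oplus>\<^bsub>free_pairs V W\<^esub> q = p + q"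
  "c \<odot>\<^bsub>free_pairs V W\<^esub> p = vscale c p"
  by (simp_all add: free_pairs_def)

text \<open>Over common finite index sets the product is a double sum with fixed ranges, which makes
  bilinearity a termwise identity.\<close>

lemma free_pairs_mult_superset:
  assumes "finite S" "keys p \<subseteq> S" "finite T" "keys q \<subseteq> T"
  shows "p \<otimes>\<^bsub>free_pairs V W\<^esub> q =
    (\<Sum>s\<in>S. \<Sum>t\<in>T. single (fst s \<otimes>\<^bsub>V\<^esub> fst t, snd s
      \<otimes>\<^bsub>W\<^esub> snd t)
      (lookup p s * lookup q t))"
proof -
  have "p \<otimes>\<^bsub>free_pairs V W\<^esub> q =
    (\<Sum>s\<in>keys p. \<Sum>t\<in>keys q.
      single (fst s \<otimes>\<^bsub>V\<^esub> fst t, snd s \<otimes>\<^bsub>W\<^esub> snd t)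
      (lookup p s * lookup q t))"
    by (simp add: free_pairs_def)
  also have "\<dots> = (\<Sum>s\<in>S. \<Sum>t\<in>T. single (fst s \<otimes>\<^bsub>V\<^esub> fst t, snd s
    \<otimes>\<^bsub>W\<^esub> snd t)
      (lookup p s * lookup q t))"
    by (intro sum.mono_neutral_cong_left assms ballI sum.neutral) (auto simp: in_keys_iff)
  finally show ?thesis .
qed

lemma free_pairs_mult_single:
  "single s a \<otimes>\<^bsub>free_pairs V W\<^esub> single t b =
    single (fst s \<otimes>\<^bsub>V\<^esub> fst t, snd s \<otimes>\<^bsub>W\<^esub> snd t) (a * b)"
  by (subst free_pairs_mult_superset[of "{s}" _ "{t}"]) auto

lemma free_pairs_mult_add_left:
  "(p + p') \<otimes>\<^bsub>free_pairs V W\<^esub> q = p \<otimes>\<^bsub>free_pairs V W\<^esub> q + p'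
    \<otimes>\<^bsub>free_pairs V W\<^esub> q"
proof -
  let ?S = "keys p \<union> keys p'" and ?T = "keys q"
  note * = free_pairs_mult_superset[of ?S _ ?T]
  show ?thesis
    using keys_add[of p p'] by (subst (1 2 3) *)
      (auto simp: lookup_add distrib_right single_add sum.distrib)
qed

lemma free_pairs_mult_add_right:
  "q \<otimes>\<^bsub>free_pairs V W\<^esub> (p + p') = q \<otimes>\<^bsub>free_pairs V W\<^esub> p + q
    \<otimes>\<^bsub>free_pairs V W\<^esub> p'"
proof -
  let ?S = "keys p \<union> keys p'" and ?T = "keys q"
  note * = free_pairs_mult_superset[of ?T _ ?S]
  show ?thesis
    using keys_add[of p p'] by (subst (1 2 3) *)
      (auto simp: lookup_add distrib_left single_add sum.distrib)
qed

lemma free_pairs_mult_vscale_right: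
  "q \<otimes>\<^bsub>free_pairs V W\<^esub> vscale c p = vscale c (q \<otimes>\<^bsub>free_pairs V W\<^esub> p)"
proof -
  note * = free_pairs_mult_superset[of "keys q" _ "keys p"]
  show ?thesis
    using keys_vscale[of c p] by (subst (1 2) *)
      (auto simp: vs.scale_sum_right ac_simps)
qed

lemma free_pairs_mult_vscale_left:
  "vscale c p \<otimes>\<^bsub>free_pairs V W\<^esub> q = vscale c (p \<otimes>\<^bsub>free_pairs V W\<^esub> q)"
proof -
  note * = free_pairs_mult_superset[of "keys p" _ "keys q"]
  show ?thesis
    using keys_vscale[of c p] by (subst (1 2) *)
      (auto simp: vs.scale_sum_right ac_simps)
qed

lemma free_pairs_mult_diff_right:
  "q \<otimes>\<^bsub>free_pairs V W\<^esub> (p - p') = q \<otimes>\<^bsub>free_pairs V W\<^esub> p - q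
    \<otimes>\<^bsub>free_pairs V W\<^esub> p'"
  by (metis free_pairs_mult_add_right add_diff_cancel_right' diff_add_cancel)

lemma free_pairs_mult_zero [simp]:
  "0 \<otimes>\<^bsub>free_pairs V W\<^esub> q = 0" "q \<otimes>\<^bsub>free_pairs V W\<^esub> 0 = 0"
  by (simp_all add: free_pairs_def)

definition bilinear_map ::
  "('k::field, 'a, 'm) module_scheme \<Rightarrow> ('k, 'b, 'n) module_scheme \<Rightarrow> ('k, 'c, 'l) module_scheme
    \<Rightarrow> ('a \<Rightarrow> 'b \<Rightarrow> 'c) \<Rightarrow> bool" where
  "bilinear_map V W U \<beta> \<longleftrightarrow>
    (\<forall>x\<in>carrier V. (\<lambda>y. \<beta> x y) \<in> linear_maps W U) \<and>
    (\<forall>y\<in>carrier W. (\<lambda>x. \<beta> x y) \<in> linear_maps V U)"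

locale kalgebra_pair = A: kalgebra A + B: kalgebra B
  for A :: "('k::field, 'a, 'm) module_scheme" and B :: "('k, 'b, 'n) module_scheme"
begin

abbreviation "F \<equiv> free_pairs A B"
abbreviation "N \<equiv> tensor_null A B"
abbreviation pt where "pt \<equiv> pure_tensor A B"
abbreviation "T \<equiv> tensor A B"

lemma F_mult_closed:
  "keys p \<subseteq> carrier A \<times> carrier B \<Longrightarrow> keys q \<subseteq> carrier A \<times>
    carrier B \<Longrightarrow>
    keys (p \<otimes>\<^bsub>F\<^esub> q) \<subseteq> carrier A \<times> carrier B"
  unfolding free_pairs_def
  by (force dest!: subsetD[OF keys_sum] split: if_splits)

lemma F_mult_comm:
  assumes "keys p \<subseteq> carrier A \<times> carrier B" "keys q \<subseteq> carrier A \<times> carrier B"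
  shows "p \<otimes>\<^bsub>F\<^esub> q = q \<otimes>\<^bsub>F\<^esub> p"
  using assms(1)
proof (induction p rule: poly_mapping_induct_on)
  case (single x c)
  from assms(2) show ?case
  proof (induction q rule: poly_mapping_induct_on)
    case (single y d)
    then show ?case using \<open>x \<in> _\<close>
      by (auto simp: free_pairs_mult_single A.m_comm B.m_comm mult.commute)
  qed (simp_all add: free_pairs_mult_add_left free_pairs_mult_add_right)
qed (simp_all add: free_pairs_mult_add_left free_pairs_mult_add_right)

lemma F_mult_assoc:
  assumes "keys p \<subseteq> carrier A \<times> carrier B" "keys q \<subseteq> carrier A \<times> carrier B"
    "keys r \<subseteq> carrier A \<times> carrier B"
  shows "p \<otimes>\<^bsub>F\<^esub> q \<otimes>\<^bsub>F\<^esub> r = p \<otimes>\<^bsub>F\<^esub> (q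
    \<otimes>\<^bsub>F\<^esub> r)"
  using assms(1)
proof (induction p rule: poly_mapping_induct_on)
  case (single x c)
  from assms(2) show ?case
  proof (induction q rule: poly_mapping_induct_on)
    case (single y d)
    from assms(3) show ?case
    proof (induction r rule: poly_mapping_induct_on)
      case (single z e)
      then show ?case using \<open>x \<in> _\<close> \<open>y \<in> _\<close>
        by (auto simp: free_pairs_mult_single A.m_assoc B.m_assoc mult.assoc)
    qed (simp_all add: free_pairs_mult_add_left free_pairs_mult_add_right)
  qed (simp_all add: free_pairs_mult_add_left free_pairs_mult_add_right)
qed (simp_all add: free_pairs_mult_add_left free_pairs_mult_add_right)

lemma F_mult_one:
  assumes "keys p \<subseteq> carrier A \<times> carrier B"
  shows "single (\<one>\<^bsub>A\<^esub>, \<one>\<^bsub>B\<^esub>) 1 \<otimes>\<^bsub>F\<^esub> p = p"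
  using assms
  by (induction p rule: poly_mapping_induct_on)
    (auto simp: free_pairs_mult_single free_pairs_mult_add_right)

lemma F_cring: "cring F"
proof (intro cringI abelian_groupI comm_monoidI)
  fix p assume "p \<in> carrier F"
  then show "\<exists>q\<in>carrier F. q \<oplus>\<^bsub>F\<^esub> p = \<zero>\<^bsub>F\<^esub>"
    by (intro bexI[of _ "- p"]) auto
qed (simp_all add: F_mult_closed F_mult_assoc F_mult_one keys_add_subset add.assoc add.commute add.left_commute
    free_pairs_mult_add_left, rule F_mult_comm)

lemma F_kalgebra: "kalgebra F"
  by (rule kalgebraI[OF F_cring])
    (auto simp: vs.scale_left_distrib vs.scale_right_distrib free_pairs_mult_vscale_left
      dest: subsetD[OF keys_vscale])

sublocale F: kalgebra F
  by (rule F_kalgebra)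

lemma carrier_F_subspace: "vs.subspace (carrier F)"
  by (rule vs.subspaceI) (auto dest!: keys_addD dest: subsetD[OF keys_vscale])

lemma relations_carrier: "tensor_relations A B \<subseteq> carrier F"
  unfolding tensor_relations_def Let_def
  by (auto dest!: keys_diffD split: if_splits)

lemma null_carrier: "N \<subseteq> carrier F"
  unfolding tensor_null_def by (rule vs.span_minimal[OF relations_carrier carrier_F_subspace])

text \<open>Multiplication by the basis element of \<open>(a, b)\<close> turns a relation for
  \<open>x\<close>, \<open>y\<close> into the relation of the same kind for \<open>a x\<close>,
  \<open>b y\<close>. Hence the span of the relations will be an ideal, and the quotient an
  algebra.\<close>

lemma relations_mult:
  assumes s: "s \<in> carrier A \<times> carrier B" and r: "r \<in> tensor_relations A B"
  shows "single s 1 \<otimes>\<^bsub>F\<^esub> r \<in> tensor_relations A B"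
proof -
  obtain a b where ab: "s = (a, b)" "a \<in> carrier A" "b \<in> carrier B" using s by auto
  let ?e = "\<lambda>x y. single (x, y) (1::'k)"
  have mem: "?e (x \<oplus>\<^bsub>A\<^esub> x') y - ?e x y - ?e x' y \<in> tensor_relations A B"
      "?e x (y \<oplus>\<^bsub>B\<^esub> y') - ?e x y - ?e x y' \<in> tensor_relations A B"
      "?e (c \<odot>\<^bsub>A\<^esub> x) y - vscale c (?e x y) \<in> tensor_relations A B"
      "?e x (c \<odot>\<^bsub>B\<^esub> y) - vscale c (?e x y) \<in> tensor_relations A B"
    if "x \<in> carrier A" "x' \<in> carrier A" "y \<in> carrier B" "y' \<in> carrier B" for x x' y y' c
    unfolding tensor_relations_def Let_def using that by blast+
  \<comment> \<open>Each relation involves only some of the four variables of \<open>mem\<close>;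
    zero fills the others.\<close>
  note mem' = mem(1)[OF _ _ _ B.M.zero_closed] mem(2)[OF _ A.M.zero_closed]
    mem(3,4)[OF _ A.M.zero_closed _ B.M.zero_closed, simplified vscale_single mult_1_right]
  from r[unfolded tensor_relations_def Let_def] show ?thesis
    by (elim UnE CollectE exE conjE)
      (simp_all add: ab mem' free_pairs_mult_diff_right free_pairs_mult_single A.r_distr B.r_distr
        A.sm_mult_r B.sm_mult_r)
qed

text \<open>The case of a basis element times a relation spreads by linearity, first over the span
  of the relations and then over \<open>p\<close>.\<close>

lemma null_mult:
  assumes p: "p \<in> carrier F" and r: "r \<in> N"
  shows "p \<otimes>\<^bsub>F\<^esub> r \<in> N"
proof -
  have 1: "single s 1 \<otimes>\<^bsub>F\<^esub> r \<in> N" if s: "s \<in> carrier A \<times> carrier B" for s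
  proof -
    have "vs.subspace {r. single s 1 \<otimes>\<^bsub>F\<^esub> r \<in> N}"
      unfolding tensor_null_def
      by (rule vs.subspaceI) (auto simp: free_pairs_mult_add_right free_pairs_mult_vscale_right
          vs.span_zero intro: vs.span_add vs.span_scale)
    moreover have "tensor_relations A B \<subseteq> {r. single s 1 \<otimes>\<^bsub>F\<^esub> r \<in> N}"
      unfolding tensor_null_def using relations_mult[OF s] by (auto intro: vs.span_base)
    ultimately have "N \<subseteq> {r. single s 1 \<otimes>\<^bsub>F\<^esub> r \<in> N}"
      unfolding tensor_null_def[of A B] by (intro vs.span_minimal) (auto simp: tensor_null_def)
    then show ?thesis using r by auto
  qed
  have "keys p \<subseteq> carrier A \<times> carrier B" using p by simp
  then show ?thesis
  proof (induction p rule: poly_mapping_induct_on)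
    case (single s c)
    have "single s c = vscale c (single s 1)" by simp
    then have "single s c \<otimes>\<^bsub>F\<^esub> r = vscale c (single s 1 \<otimes>\<^bsub>F\<^esub> r)"
      by (metis free_pairs_mult_vscale_left)
    then show ?case using 1[OF single] by (simp add: tensor_null_def vs.span_scale)
  qed (auto simp: free_pairs_mult_add_left tensor_null_def vs.span_zero vs.span_add)
qed

lemma F_minus: "p \<in> carrier F \<Longrightarrow> \<ominus>\<^bsub>F\<^esub> p = - p"
  by (rule F.M.minus_equality) auto

lemma null_ideal: "ideal N F"
proof (rule idealI)
  show "ring F" by (rule cring.axioms(1)[OF F_cring])
  show "subgroup N (add_monoid F)"
  proof (rule F.M.add.subgroupI)
    show "N \<subseteq> carrier F" by (rule null_carrier)
    show "N \<noteq> {}" unfolding tensor_null_def using vs.span_zero by blast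
    fix p assume "p \<in> N"
    then show "\<ominus>\<^bsub>F\<^esub> p \<in> N" using null_carrier F_minus[of p]
      by (simp add: tensor_null_def vs.span_neg subset_iff)
  next
    fix p q assume "p \<in> N" "q \<in> N"
    then show "p \<oplus>\<^bsub>F\<^esub> q \<in> N" by (simp add: tensor_null_def vs.span_add)
  qed
  fix r p assume "r \<in> N" "p \<in> carrier F"
  then show "p \<otimes>\<^bsub>F\<^esub> r \<in> N" "r \<otimes>\<^bsub>F\<^esub> p \<in> N"
    using null_mult[of p r] F.m_comm[of p r] null_carrier by auto
qed

sublocale FN: kalgebra_ideal F N
  by (intro kalgebra_ideal.intro F_kalgebra null_ideal)

section \<open>The tensor product as a commutative algebra\<close>

lemma T_kalgebra: "kalgebra T"
  unfolding tensor_def by (rule FN.quot_kalgebra)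

sublocale T: kalgebra T
  by (rule T_kalgebra)

lemma carrier_T: "carrier T = (\<lambda>p. N +>\<^bsub>F\<^esub> p) ` carrier F"
  unfolding tensor_def by (rule FN.carrier_quot)

lemma pt_closed [simp, intro]: "x \<in> carrier A \<Longrightarrow> y \<in> carrier B \<Longrightarrow> pt x y
  \<in> carrier T"
  by (auto simp: pure_tensor_def carrier_T)

lemma coset_eqI: "p \<in> carrier F \<Longrightarrow> q \<in> carrier F \<Longrightarrow> p - q \<in> N
  \<Longrightarrow> N +>\<^bsub>F\<^esub> p = N +>\<^bsub>F\<^esub> q"
  using FN.coset_eq_iff[of p q] by (simp add: a_minus_def F_minus del: free_pairs_sel(1))

lemma coset_add: "p \<in> carrier F \<Longrightarrow> q \<in> carrier F \<Longrightarrow>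
    (N +>\<^bsub>F\<^esub> p) \<oplus>\<^bsub>T\<^esub> (N +>\<^bsub>F\<^esub> q) = N +>\<^bsub>F\<^esub> (p + q)"
  unfolding tensor_def using FN.quot_add[of p q] by simp

lemma coset_smult: "p \<in> carrier F \<Longrightarrow> c \<odot>\<^bsub>T\<^esub> (N +>\<^bsub>F\<^esub> p) =
  N +>\<^bsub>F\<^esub> (vscale c p)"
  unfolding tensor_def using FN.quot_smult[of p c] by simp

lemma coset_mult: "p \<in> carrier F \<Longrightarrow> q \<in> carrier F \<Longrightarrow>
    (N +>\<^bsub>F\<^esub> p) \<otimes>\<^bsub>T\<^esub> (N +>\<^bsub>F\<^esub> q) = N +>\<^bsub>F\<^esub> (p
      \<otimes>\<^bsub>F\<^esub> q)"
  unfolding tensor_def using FN.quot_mult[of p q] by simp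

lemma pt_add_left:
  assumes "x \<in> carrier A" "x' \<in> carrier A" "y \<in> carrier B"
  shows "pt (x \<oplus>\<^bsub>A\<^esub> x') y = pt x y \<oplus>\<^bsub>T\<^esub> pt x' y"
proof -
  let ?e = "\<lambda>x. single (x, y) (1::'k)"
  have "?e (x \<oplus>\<^bsub>A\<^esub> x') - ?e x - ?e x' \<in> N"
    unfolding tensor_null_def using assms
    by (intro vs.span_base) (unfold tensor_relations_def Let_def, blast)
  then have "?e (x \<oplus>\<^bsub>A\<^esub> x') - (?e x + ?e x') \<in> N" by (simp add: diff_diff_add)
  then have "pt (x \<oplus>\<^bsub>A\<^esub> x') y = N +>\<^bsub>F\<^esub> (?e x + ?e x')"
    unfolding pure_tensor_def using assms
    by (intro coset_eqI) (auto dest!: keys_addD split: if_splits)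
  then show ?thesis using assms by (simp add: pure_tensor_def coset_add)
qed

lemma pt_add_right:
  assumes "x \<in> carrier A" "y \<in> carrier B" "y' \<in> carrier B"
  shows "pt x (y \<oplus>\<^bsub>B\<^esub> y') = pt x y \<oplus>\<^bsub>T\<^esub> pt x y'"
proof -
  let ?e = "\<lambda>y. single (x, y) (1::'k)"
  have "?e (y \<oplus>\<^bsub>B\<^esub> y') - ?e y - ?e y' \<in> N"
    unfolding tensor_null_def using assms
    by (intro vs.span_base) (unfold tensor_relations_def Let_def, blast)
  then have "?e (y \<oplus>\<^bsub>B\<^esub> y') - (?e y + ?e y') \<in> N" by (simp add: diff_diff_add)
  then have "pt x (y \<oplus>\<^bsub>B\<^esub> y') = N +>\<^bsub>F\<^esub> (?e y + ?e y')"
    unfolding pure_tensor_def using assms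
    by (intro coset_eqI) (auto dest!: keys_addD split: if_splits)
  then show ?thesis using assms by (simp add: pure_tensor_def coset_add)
qed

lemma pt_smult_left:
  assumes "x \<in> carrier A" "y \<in> carrier B"
  shows "pt (c \<odot>\<^bsub>A\<^esub> x) y = c \<odot>\<^bsub>T\<^esub> pt x y"
proof -
  let ?e = "\<lambda>x. single (x, y) (1::'k)"
  have "?e (c \<odot>\<^bsub>A\<^esub> x) - vscale c (?e x) \<in> N"
    unfolding tensor_null_def using assms
    by (intro vs.span_base) (unfold tensor_relations_def Let_def, blast)
  then have "pt (c \<odot>\<^bsub>A\<^esub> x) y = N +>\<^bsub>F\<^esub> vscale c (?e x)"
    unfolding pure_tensor_def using assms by (intro coset_eqI) auto
  then show ?thesis using assms by (simp add: pure_tensor_def coset_smult)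
qed

lemma pt_smult_right:
  assumes "x \<in> carrier A" "y \<in> carrier B"
  shows "pt x (c \<odot>\<^bsub>B\<^esub> y) = c \<odot>\<^bsub>T\<^esub> pt x y"
proof -
  let ?e = "\<lambda>y. single (x, y) (1::'k)"
  have "?e (c \<odot>\<^bsub>B\<^esub> y) - vscale c (?e y) \<in> N"
    unfolding tensor_null_def using assms
    by (intro vs.span_base) (unfold tensor_relations_def Let_def, blast)
  then have "pt x (c \<odot>\<^bsub>B\<^esub> y) = N +>\<^bsub>F\<^esub> vscale c (?e y)"
    unfolding pure_tensor_def using assms by (intro coset_eqI) auto
  then show ?thesis using assms by (simp add: pure_tensor_def coset_smult)
qed

lemma pt_bilinear: "bilinear_map A B T pt"
  by (auto simp: bilinear_map_def pt_add_left pt_add_right pt_smult_left pt_smult_right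
      intro!: linear_mapsI)

lemma pt_mult:
  assumes "x \<in> carrier A" "x' \<in> carrier A" "y \<in> carrier B" "y' \<in> carrier B"
  shows "pt x y \<otimes>\<^bsub>T\<^esub> pt x' y' = pt (x \<otimes>\<^bsub>A\<^esub> x') (y
    \<otimes>\<^bsub>B\<^esub> y')"
  using assms by (simp add: pure_tensor_def coset_mult free_pairs_mult_single)

lemma T_one: "\<one>\<^bsub>T\<^esub> = pt \<one>\<^bsub>A\<^esub> \<one>\<^bsub>B\<^esub>"
  using FN.quot_one by (simp add: tensor_def pure_tensor_def)

text \<open>A scalar can be moved into the left factor of a pure tensor, so sums of pure tensors
  exhaust the tensor product and no case for scaling arises.\<close>

lemma T_induct [consumes 1, case_names pure add]:
  assumes t: "t \<in> carrier T"
    and pure: "\<And>x y. x \<in> carrier A \<Longrightarrow> y \<in> carrier B \<Longrightarrow> P (pt x y)"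
    and add: "\<And>t u. t \<in> carrier T \<Longrightarrow> u \<in> carrier T \<Longrightarrow> P t
      \<Longrightarrow> P u \<Longrightarrow> P (t \<oplus>\<^bsub>T\<^esub> u)"
  shows "P t"
proof -
  obtain p where p: "t = N +>\<^bsub>F\<^esub> p" "keys p \<subseteq> carrier A \<times> carrier B"
    using t by (auto simp: carrier_T)
  have s: "P (N +>\<^bsub>F\<^esub> single (x, y) c)" if "x \<in> carrier A" "y \<in> carrier B" for x y c
  proof -
    have "N +>\<^bsub>F\<^esub> single (x, y) c = c \<odot>\<^bsub>T\<^esub> pt x y"
      using that by (simp add: pure_tensor_def coset_smult)
    also have "\<dots> = pt (c \<odot>\<^bsub>A\<^esub> x) y" using that by (simp add: pt_smult_left)
    finally show ?thesis using that pure by simp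
  qed
  from p(2) have "P (N +>\<^bsub>F\<^esub> p)"
  proof (induction p rule: poly_mapping_induct_on)
    case zero
    then show ?case using s[OF A.M.zero_closed B.M.zero_closed, of 0] by simp
  next
    case (single x c)
    then show ?case using s by (cases x) auto
  next
    case (add p q)
    then have "P ((N +>\<^bsub>F\<^esub> p) \<oplus>\<^bsub>T\<^esub> (N +>\<^bsub>F\<^esub> q))"
      by (intro assms(3)) (auto simp: carrier_T)
    then show ?case using add by (simp add: coset_add)
  qed
  then show ?thesis using p by simp
qed

text \<open>This is the main device for comparing maps on tensors: coproducts are not pure, but both
  sides are linear.\<close>

lemma T_linear_eqI:
  assumes "f \<in> linear_maps T U" "g \<in> linear_maps T U"
    and "\<And>x y. x \<in> carrier A \<Longrightarrow> y \<in> carrier B \<Longrightarrow> f (pt x y) = g (pt x y)"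
    and "t \<in> carrier T"
  shows "f t = g t"
  using assms(4) by (induction t rule: T_induct)
    (auto simp: assms(3) linear_mapsD[OF assms(1)] linear_mapsD[OF assms(2)])

section \<open>The universal property of the tensor product\<close>

context
  fixes U :: "('k, 'c, 'l) module_scheme" and \<beta>
  assumes U: "kalgebra U" and \<beta>: "bilinear_map A B U \<beta>"
begin

interpretation U: kalgebra U by (rule U)

private abbreviation "b \<equiv> \<lambda>s. \<beta> (fst s) (snd s)"

private lemma \<beta>D:
  "x \<in> carrier A \<Longrightarrow> y \<in> carrier B \<Longrightarrow> \<beta> x y \<in> carrier U"
  "x \<in> carrier A \<Longrightarrow> x' \<in> carrier A \<Longrightarrow> y \<in> carrier B \<Longrightarrow>
    \<beta> (x \<oplus>\<^bsub>A\<^esub> x') y = \<beta> x y \<oplus>\<^bsub>U\<^esub> \<beta> x' y"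
  "x \<in> carrier A \<Longrightarrow> y \<in> carrier B \<Longrightarrow> y' \<in> carrier B \<Longrightarrow>
    \<beta> x (y \<oplus>\<^bsub>B\<^esub> y') = \<beta> x y \<oplus>\<^bsub>U\<^esub> \<beta> x y'"
  "x \<in> carrier A \<Longrightarrow> y \<in> carrier B \<Longrightarrow> \<beta> (c \<odot>\<^bsub>A\<^esub>
    x) y = c \<odot>\<^bsub>U\<^esub> \<beta> x y"
  "x \<in> carrier A \<Longrightarrow> y \<in> carrier B \<Longrightarrow> \<beta> x (c
    \<odot>\<^bsub>B\<^esub> y) = c \<odot>\<^bsub>U\<^esub> \<beta> x y"
  using \<beta> by (auto simp: bilinear_map_def linear_maps_def)

private lemma b_closed: "b \<in> carrier A \<times> carrier B \<rightarrow> carrier U"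
  by (auto simp: \<beta>D)

private lemma lin: "lext U b \<in> linear_maps F U"
  by (rule linear_mapsI)
    (use b_closed in \<open>auto intro: U.lext_closed simp: U.lext_add U.lext_vscale\<close>)

private lemma ker_subspace: "vs.subspace {p \<in> carrier F. lext U b p = \<zero>\<^bsub>U\<^esub>}"
proof (rule vs.subspaceI)
  fix p q c assume *: "p \<in> {p \<in> carrier F. lext U b p = \<zero>\<^bsub>U\<^esub>}"
  then have p: "p \<in> carrier F" "lext U b p = \<zero>\<^bsub>U\<^esub>" by blast+
  show "vscale c p \<in> {p \<in> carrier F. lext U b p = \<zero>\<^bsub>U\<^esub>}"
    using p linear_mapsD(3)[OF lin p(1)] F.sm_closed[OF p(1)] by simp
  assume "q \<in> {p \<in> carrier F. lext U b p = \<zero>\<^bsub>U\<^esub>}"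
  then have q: "q \<in> carrier F" "lext U b q = \<zero>\<^bsub>U\<^esub>" by blast+
  show "p + q \<in> {p \<in> carrier F. lext U b p = \<zero>\<^bsub>U\<^esub>}"
    using p q linear_mapsD(2)[OF lin p(1) q(1)] F.a_closed[OF p(1) q(1)] by simp
qed simp

private lemma lext_diff:
  assumes "p \<in> carrier F" "q \<in> carrier F"
  shows "lext U b (p - q) = lext U b p \<ominus>\<^bsub>U\<^esub> lext U b q"
proof -
  have 1: "vscale (-1) q \<in> carrier F" using F.sm_closed[OF assms(2), of "-1"] by simp
  have "p - q = p + vscale (-1) q" by (simp add: vs.scale_minus_left)
  also have "lext U b (p + vscale (-1) q) = lext U b p \<oplus>\<^bsub>U\<^esub> (-1) \<odot>\<^bsub>U\<^esub>
    lext U b q"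
    using linear_mapsD(2)[OF lin assms(1) 1] linear_mapsD(3)[OF lin assms(2), of "-1"] by simp
  finally show ?thesis
    using linear_mapsD(1)[OF lin assms(2)] by (simp add: U.sm_minus a_minus_def)
qed

text \<open>Bilinearity of \<beta> says precisely that the linear extension vanishes on the four
  kinds of relations, and its kernel is a subspace.\<close>

private lemma kill_null:
  assumes "p \<in> N"
  shows "lext U b p = \<zero>\<^bsub>U\<^esub>"
proof -
  have "tensor_relations A B \<subseteq> {p \<in> carrier F. lext U b p = \<zero>\<^bsub>U\<^esub>}"
  proof
    fix r assume r: "r \<in> tensor_relations A B"
    have cancel: "(u \<oplus>\<^bsub>U\<^esub> v) \<ominus>\<^bsub>U\<^esub> u \<ominus>\<^bsub>U\<^esub> v =
      \<zero>\<^bsub>U\<^esub>" if "u \<in> carrier U" "v \<in> carrier U" for u v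
      using that by (simp add: a_minus_def U.a_assoc U.minus_add[symmetric])
        (simp add: U.a_assoc[symmetric] U.r_neg)
    note kd = keys_diff_subset[where D = "carrier A \<times> carrier B"]
    have "lext U b r = \<zero>\<^bsub>U\<^esub>"
      using r unfolding tensor_relations_def Let_def
      by (auto simp: lext_diff kd \<beta>D cancel U.r_neg[folded a_minus_def])
    then show "r \<in> {p \<in> carrier F. lext U b p = \<zero>\<^bsub>U\<^esub>}" using r relations_carrier by blast
  qed
  from vs.span_minimal[OF this ker_subspace] show ?thesis
    using assms unfolding tensor_null_def by blast
qed

text \<open>Elements of one coset differ by null elements, so the image in
  \<open>tensor_lift\<close> is a singleton and \<open>the_elem\<close> returns its value.\<close>

lemma tensor_lift_coset:
  assumes "p \<in> carrier F"
  shows "tensor_lift U \<beta> (N +>\<^bsub>F\<^esub> p) = lext U b p"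
proof -
  have "lext U b q = lext U b p" if q: "q \<in> N +>\<^bsub>F\<^esub> p" for q
  proof -
    obtain r where r: "r \<in> N" "q = r + p"
      using q unfolding a_r_coset_def'[of F N p] by auto
    have "r \<in> carrier F" using r null_carrier by blast
    then show ?thesis
      using r linear_mapsD(2)[OF lin _ assms, of r] kill_null[OF r(1)]
        linear_mapsD(1)[OF lin assms] by simp
  qed
  moreover have "p \<in> N +>\<^bsub>F\<^esub> p" by (rule FN.a_rcos_self[OF assms])
  ultimately have "lext U b ` (N +>\<^bsub>F\<^esub> p) = {lext U b p}" by blast
  then show ?thesis by (simp add: tensor_lift_def lext_def[abs_def])
qed

lemma tensor_lift_linear: "tensor_lift U \<beta> \<in> linear_maps T U"
proof (rule linear_mapsI)
  fix t assume "t \<in> carrier T"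
  then obtain p where p: "t = N +>\<^bsub>F\<^esub> p" "p \<in> carrier F" unfolding carrier_T by blast
  show "tensor_lift U \<beta> t \<in> carrier U"
    using p linear_mapsD(1)[OF lin p(2)] by (simp add: tensor_lift_coset del: free_pairs_sel(1))
  show "tensor_lift U \<beta> (c \<odot>\<^bsub>T\<^esub> t) = c \<odot>\<^bsub>U\<^esub> tensor_lift U \<beta> t" for c
    using F.sm_closed[OF p(2), of c] linear_mapsD(3)[OF lin p(2)] p
    by (simp add: tensor_lift_coset coset_smult del: free_pairs_sel(1))
  fix u assume "u \<in> carrier T"
  then obtain q where q: "u = N +>\<^bsub>F\<^esub> q" "q \<in> carrier F" unfolding carrier_T by blast
  show "tensor_lift U \<beta> (t \<oplus>\<^bsub>T\<^esub> u) = tensor_lift U \<beta> t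
    \<oplus>\<^bsub>U\<^esub> tensor_lift U \<beta> u"
    using F.a_closed[OF p(2) q(2)] linear_mapsD(2)[OF lin p(2) q(2)] p q
    by (simp add: tensor_lift_coset coset_add del: free_pairs_sel(1))
qed

lemma tensor_lift_pure:
  assumes "x \<in> carrier A" "y \<in> carrier B"
  shows "tensor_lift U \<beta> (pt x y) = \<beta> x y"
  using assms by (simp add: pure_tensor_def tensor_lift_coset \<beta>D)

text \<open>Both sides of multiplicativity are additive in each argument, so two nested inductions
  reduce it to pure tensors.\<close>

lemma tensor_lift_algebra:
  assumes mult: "\<And>x x' y y'. x \<in> carrier A \<Longrightarrow> x' \<in> carrier A \<Longrightarrow> y
    \<in> carrier B \<Longrightarrow> y' \<in> carrier B \<Longrightarrow>
      \<beta> (x \<otimes>\<^bsub>A\<^esub> x') (y \<otimes>\<^bsub>B\<^esub> y') = \<beta> x y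
        \<otimes>\<^bsub>U\<^esub> \<beta> x' y'"
    and one: "\<beta> \<one>\<^bsub>A\<^esub> \<one>\<^bsub>B\<^esub> = \<one>\<^bsub>U\<^esub>"
  shows "tensor_lift U \<beta> \<in> algebra_maps T U"
proof (rule algebra_mapsI)
  note lin = tensor_lift_linear
  show "tensor_lift U \<beta> \<in> linear_maps T U" by (rule lin)
  show "tensor_lift U \<beta> \<one>\<^bsub>T\<^esub> = \<one>\<^bsub>U\<^esub>" by (simp add: T_one
    tensor_lift_pure one)
  fix t u assume "t \<in> carrier T" and u: "u \<in> carrier T"
  then show "tensor_lift U \<beta> (t \<otimes>\<^bsub>T\<^esub> u) = tensor_lift U \<beta> t
    \<otimes>\<^bsub>U\<^esub> tensor_lift U \<beta> u"
  proof (induction t rule: T_induct)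
    case (pure x y)
    from u show ?case
      by (induction u rule: T_induct)
        (use pure in \<open>simp_all add: T.r_distr U.r_distr linear_mapsD[OF lin] pt_mult tensor_lift_pure
          mult \<beta>D\<close>)
  next
    case (add t u')
    then show ?case using u by (simp add: T.l_distr U.l_distr linear_mapsD[OF lin])
  qed
qed

end

end

lemma kalgebra_pairI: "kalgebra A \<Longrightarrow> kalgebra B \<Longrightarrow> kalgebra_pair A B"
  by (simp add: kalgebra_pair_def)

text \<open>The coproducts are stated over \<open>CG_algebra\<close>, \<open>Sym_algebra\<close> and
  \<open>quot_algebra\<close>, the Hopf axioms over the extended records. The tensor product sees
  only the algebra operations, which agree.\<close>

lemma tensor_scheme_cong:
  fixes V :: "('k::field, 'a, 'm) module_scheme" and V' :: "('k, 'a, 'm1) module_scheme"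
  assumes "carrier V = carrier V'" "monoid.mult V = monoid.mult V'" "\<one>\<^bsub>V\<^esub> = \<one>\<^bsub>V'\<^esub>"
    "add V = add V'" "module.smult V = module.smult V'"
  shows "tensor V V = tensor V' V'" "pure_tensor V V = pure_tensor V' V'"
proof -
  have F: "free_pairs V V = free_pairs V' V'"
    using assms by (simp add: free_pairs_def)
  have N: "tensor_null V V = tensor_null V' V'"
    using assms by (simp add: tensor_null_def tensor_relations_def)
  show "tensor V V = tensor V' V'" by (simp add: tensor_def F N)
  show "pure_tensor V V = pure_tensor V' V'" by (intro ext) (simp add: pure_tensor_def F N)
qed

lemma kalgebra_scheme_cong:
  fixes A :: "('k::field, 'a, 'm) module_scheme" and B :: "('k, 'a, 'n) module_scheme"
  assumes "kalgebra A"
    and sel: "carrier B = carrier A" "monoid.mult B = monoid.mult A" "\<one>\<^bsub>B\<^esub> =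
      \<one>\<^bsub>A\<^esub>" "\<zero>\<^bsub>B\<^esub> = \<zero>\<^bsub>A\<^esub>"
      "add B = add A" "module.smult B = module.smult A"
  shows "kalgebra B"
proof -
  interpret A: kalgebra A by fact
  have "cring B"
  proof (intro cringI abelian_groupI comm_monoidI)
    fix x assume "x \<in> carrier B"
    then show "\<exists>y\<in>carrier B. y \<oplus>\<^bsub>B\<^esub> x = \<zero>\<^bsub>B\<^esub>"
      unfolding sel using A.M.l_neg[of x] by blast
  qed (simp_all add: sel A.M.a_assoc A.m_assoc A.l_distr, simp_all add: A.M.a_comm A.m_comm)
  then show ?thesis
    by (rule kalgebraI) (simp_all add: sel A.sm_add_l A.sm_add_r A.sm_sm A.sm_mult_l)
qed

lemma bilinear_mapI:
  assumes "\<And>x y. x \<in> carrier V \<Longrightarrow> y \<in> carrier W \<Longrightarrow> \<beta> x y \<in>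
    carrier U"
    and "\<And>x x' y. x \<in> carrier V \<Longrightarrow> x' \<in> carrier V \<Longrightarrow> y \<in> carrier
      W \<Longrightarrow>
      \<beta> (x \<oplus>\<^bsub>V\<^esub> x') y = \<beta> x y \<oplus>\<^bsub>U\<^esub> \<beta> x' y"
    and "\<And>x y y'. x \<in> carrier V \<Longrightarrow> y \<in> carrier W \<Longrightarrow> y' \<in> carrier
      W \<Longrightarrow>
      \<beta> x (y \<oplus>\<^bsub>W\<^esub> y') = \<beta> x y \<oplus>\<^bsub>U\<^esub> \<beta> x y'"
    and "\<And>c x y. x \<in> carrier V \<Longrightarrow> y \<in> carrier W \<Longrightarrow> \<beta> (c
      \<odot>\<^bsub>V\<^esub> x) y = c \<odot>\<^bsub>U\<^esub> \<beta> x y"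
    and "\<And>c x y. x \<in> carrier V \<Longrightarrow> y \<in> carrier W \<Longrightarrow> \<beta> x (c
      \<odot>\<^bsub>W\<^esub> y) = c \<odot>\<^bsub>U\<^esub> \<beta> x y"
  shows "bilinear_map V W U \<beta>"
  using assms by (auto simp: bilinear_map_def intro!: linear_mapsI)

lemma bilinear_mapD:
  assumes "bilinear_map V W U \<beta>"
  shows "x \<in> carrier V \<Longrightarrow> y \<in> carrier W \<Longrightarrow> \<beta> x y \<in> carrier U"
    and "x \<in> carrier V \<Longrightarrow> x' \<in> carrier V \<Longrightarrow> y \<in> carrier W \<Longrightarrow>
      \<beta> (x \<oplus>\<^bsub>V\<^esub> x') y = \<beta> x y \<oplus>\<^bsub>U\<^esub> \<beta> x' y"
    and "x \<in> carrier V \<Longrightarrow> y \<in> carrier W \<Longrightarrow> y' \<in> carrier W \<Longrightarrow>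
      \<beta> x (y \<oplus>\<^bsub>W\<^esub> y') = \<beta> x y \<oplus>\<^bsub>U\<^esub> \<beta> x y'"
    and "x \<in> carrier V \<Longrightarrow> y \<in> carrier W \<Longrightarrow> \<beta> (c
      \<odot>\<^bsub>V\<^esub> x) y = c \<odot>\<^bsub>U\<^esub> \<beta> x y"
    and "x \<in> carrier V \<Longrightarrow> y \<in> carrier W \<Longrightarrow> \<beta> x (c
      \<odot>\<^bsub>W\<^esub> y) = c \<odot>\<^bsub>U\<^esub> \<beta> x y"
  using assms by (auto simp: bilinear_map_def linear_maps_def)

lemma bilinear_map_comp:
  assumes "f \<in> linear_maps V V'" "g \<in> linear_maps W W'" "bilinear_map V' W' U \<beta>"
  shows "bilinear_map V W U (\<lambda>x y. \<beta> (f x) (g y))"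
  by (rule bilinear_mapI)
    (simp_all add: linear_mapsD[OF assms(1)] linear_mapsD[OF assms(2)] bilinear_mapD[OF assms(3)])

lemma bilinear_map_mult: "kalgebra A \<Longrightarrow> bilinear_map A A A (\<lambda>x y. x
  \<otimes>\<^bsub>A\<^esub> y)"
proof -
  assume "kalgebra A"
  then interpret kalgebra A .
  show ?thesis by (rule bilinear_mapI) (simp_all add: l_distr r_distr sm_mult_l sm_mult_r)
qed

lemma linear_maps_mult_right:
  assumes "kalgebra A" "z \<in> carrier A"
  shows "(\<lambda>x. x \<otimes>\<^bsub>A\<^esub> z) \<in> linear_maps A A"
  using bilinear_map_mult[OF assms(1)] assms(2) by (simp add: bilinear_map_def)

subsection \<open>Tensor products of maps and associativity\<close>

context
  fixes A :: "('k::field, 'a, 'm) module_scheme" and B :: "('k, 'b, 'n) module_scheme"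
    and V :: "('k, 'c, 'm1) module_scheme" and W :: "('k, 'd, 'n1) module_scheme"
    and f :: "'a \<Rightarrow> 'c" and g :: "'b \<Rightarrow> 'd"
  assumes AB: "kalgebra A" "kalgebra B" and VW: "kalgebra V" "kalgebra W"
begin

interpretation AB: kalgebra_pair A B by (intro kalgebra_pairI AB)
interpretation VW: kalgebra_pair V W by (intro kalgebra_pairI VW)

lemma tensor_map_linear:
  assumes "f \<in> linear_maps A V" "g \<in> linear_maps B W"
  shows "tensor_map V W f g \<in> linear_maps (tensor A B) (tensor V W)"
  unfolding tensor_map_def
  by (intro AB.tensor_lift_linear VW.T_kalgebra bilinear_map_comp[OF assms] VW.pt_bilinear)

lemma tensor_map_pure:
  assumes "f \<in> linear_maps A V" "g \<in> linear_maps B W" "x \<in> carrier A" "y \<in> carrier B"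
  shows "tensor_map V W f g (pure_tensor A B x y) = pure_tensor V W (f x) (g y)"
  unfolding tensor_map_def
  by (rule AB.tensor_lift_pure) (intro VW.T_kalgebra bilinear_map_comp[OF assms(1,2)] VW.pt_bilinear assms)+

lemma tensor_map_algebra:
  assumes f: "f \<in> algebra_maps A V" and g: "g \<in> algebra_maps B W"
  shows "tensor_map V W f g \<in> algebra_maps (tensor A B) (tensor V W)"
  unfolding tensor_map_def
proof (rule AB.tensor_lift_algebra)
  note fl = algebra_mapsD(1)[OF f] and gl = algebra_mapsD(1)[OF g]
  show "bilinear_map A B (tensor V W) (\<lambda>x y. pure_tensor V W (f x) (g y))"
    by (rule bilinear_map_comp[OF fl gl VW.pt_bilinear])
qed (simp_all add: VW.T_kalgebra algebra_mapsD[OF f] algebra_mapsD[OF g] VW.pt_mult VW.T_one)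

end

context kalgebra
begin

interpretation AA: kalgebra_pair A A by (intro kalgebra_pairI kalgebra_axioms)
interpretation A_AA: kalgebra_pair A "tensor A A" by (intro kalgebra_pairI kalgebra_axioms AA.T_kalgebra)
interpretation AA_A: kalgebra_pair "tensor A A" A by (intro kalgebra_pairI kalgebra_axioms AA.T_kalgebra)

lemma assoc_inner_bilinear:
  assumes z: "z \<in> carrier A"
  shows "bilinear_map A A (tensor A (tensor A A))
    (\<lambda>x y. pure_tensor A (tensor A A) x (pure_tensor A A y z))"
  by (rule bilinear_mapI) (use z in \<open>simp_all add: A_AA.pt_add_left A_AA.pt_add_right AA.pt_add_left
    A_AA.pt_smult_left A_AA.pt_smult_right AA.pt_smult_left\<close>)

abbreviation "assoc_inner z \<equiv> tensor_lift (tensor A (tensor A A))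
        (\<lambda>x y. pure_tensor A (tensor A A) x (pure_tensor A A y z))"

lemma assoc_inner_linear: "z \<in> carrier A \<Longrightarrow>
    assoc_inner z \<in> linear_maps (tensor A A) (tensor A (tensor A A))"
  by (intro AA.tensor_lift_linear A_AA.T_kalgebra assoc_inner_bilinear)

lemma assoc_inner_pure: "x \<in> carrier A \<Longrightarrow> y \<in> carrier A \<Longrightarrow> z \<in>
  carrier A \<Longrightarrow>
    assoc_inner z (pure_tensor A A x y) = pure_tensor A (tensor A A) x (pure_tensor A A y z)"
  by (rule AA.tensor_lift_pure) (intro A_AA.T_kalgebra assoc_inner_bilinear | assumption)+

text \<open>Linearity in \<open>t\<close> is that of the inner lift. Linearity in \<open>z\<close>,
  which is only a parameter of the inner lift, is verified on pure tensors.\<close>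

lemma assoc_outer_bilinear:
  "bilinear_map (tensor A A) A (tensor A (tensor A A)) (\<lambda>t z. assoc_inner z t)"
proof (rule bilinear_mapI)
  fix t z z' assume t: "t \<in> carrier (tensor A A)" and z: "z \<in> carrier A" and z': "z' \<in> carrier A"
  show "assoc_inner (z \<oplus> z') t = assoc_inner z t \<oplus>\<^bsub>tensor A (tensor A A)\<^esub> assoc_inner z' t"
    using t by (induction t rule: AA.T_induct)
      (use z z' in \<open>simp_all add: assoc_inner_pure linear_mapsD[OF assoc_inner_linear] AA.pt_add_right
        A_AA.pt_add_right A_AA.T.a_ac\<close>)
next
  fix t z c assume t: "t \<in> carrier (tensor A A)" and z: "z \<in> carrier A"
  show "assoc_inner (c \<odot> z) t = c \<odot>\<^bsub>tensor A (tensor A A)\<^esub> assoc_inner z t"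
    using t by (induction t rule: AA.T_induct)
      (use z in \<open>simp_all add: assoc_inner_pure linear_mapsD[OF assoc_inner_linear] AA.pt_smult_right
        A_AA.pt_smult_right A_AA.T.sm_add_r\<close>)
qed (simp_all add: linear_mapsD[OF assoc_inner_linear])

lemma tensor_assoc_pure:
  assumes "x \<in> carrier A" "y \<in> carrier A" "z \<in> carrier A"
  shows "tensor_assoc A (pure_tensor (tensor A A) A (pure_tensor A A x y) z) =
    pure_tensor A (tensor A A) x (pure_tensor A A y z)"
proof -
  have "tensor_assoc A (pure_tensor (tensor A A) A (pure_tensor A A x y) z) = assoc_inner z (pure_tensor A A x y)"
    unfolding tensor_assoc_def
    by (rule AA_A.tensor_lift_pure[OF A_AA.T_kalgebra assoc_outer_bilinear]) (use assms in auto)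
  then show ?thesis using assms by (simp add: assoc_inner_pure)
qed

lemma tensor_assoc_algebra:
  "tensor_assoc A \<in> algebra_maps (tensor (tensor A A) A) (tensor A (tensor A A))"
  unfolding tensor_assoc_def
proof (rule AA_A.tensor_lift_algebra[OF A_AA.T_kalgebra assoc_outer_bilinear])
  show "assoc_inner \<one> \<one>\<^bsub>tensor A A\<^esub> = \<one>\<^bsub>tensor A (tensor A A)\<^esub>"
    by (simp add: AA.T_one A_AA.T_one assoc_inner_pure)
  fix t u z w assume t: "t \<in> carrier (tensor A A)" and u: "u \<in> carrier (tensor A A)"
    and z: "z \<in> carrier A" and w: "w \<in> carrier A"
  from t show "assoc_inner (z \<otimes> w) (t \<otimes>\<^bsub>tensor A A\<^esub> u) =
      assoc_inner z t \<otimes>\<^bsub>tensor A (tensor A A)\<^esub> assoc_inner w u"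
  proof (induction t rule: AA.T_induct)
    case (pure x y)
    from u show ?case
      by (induction u rule: AA.T_induct)
        (use pure z w in \<open>simp_all add: assoc_inner_pure linear_mapsD[OF assoc_inner_linear] AA.pt_mult
          A_AA.pt_mult
          AA.T.r_distr A_AA.T.r_distr\<close>)
  next
    case (add t t')
    then show ?case using z w u
      by (simp add: linear_mapsD[OF assoc_inner_linear] AA.T.l_distr A_AA.T.l_distr)
  qed
qed

end

section \<open>Bialgebras and antipodes\<close>

lemma bialgebra_kalgebra: "bialgebra H \<Longrightarrow> kalgebra H"
  by (simp add: bialgebra_def kalgebra_def)

text \<open>An antipode matters only on the carrier, so the lifts in \<open>is_antipode\<close> must
  not depend on values outside it.\<close>

lemma tensor_lift_cong:
  assumes "kalgebra A" "kalgebra B" "kalgebra U" "bilinear_map A B U \<beta>"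
    and "\<And>x y. x \<in> carrier A \<Longrightarrow> y \<in> carrier B \<Longrightarrow> \<beta> x y = \<beta>' x y"
    and "t \<in> carrier (tensor A B)"
  shows "tensor_lift U \<beta> t = tensor_lift U \<beta>' t"
proof -
  interpret AB: kalgebra_pair A B by (intro kalgebra_pairI assms)
  have b': "bilinear_map A B U \<beta>'"
    by (rule bilinear_mapI) (simp_all add: assms(5)[symmetric] bilinear_mapD[OF assms(4)])
  show ?thesis
    by (rule AB.T_linear_eqI[of _ U])
      (use assms b' in \<open>simp_all add: AB.tensor_lift_linear AB.tensor_lift_pure\<close>)
qed

context bialgebra
begin

interpretation K: kalgebra H by (rule bialgebra_kalgebra) (rule bialgebra_axioms)
interpretation HH: kalgebra_pair H H by (intro kalgebra_pairI K.kalgebra_axioms)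
interpretation H_HH: kalgebra_pair H "tensor H H" by (intro kalgebra_pairI K.kalgebra_axioms HH.T_kalgebra)
interpretation HH_H: kalgebra_pair "tensor H H" H by (intro kalgebra_pairI K.kalgebra_axioms HH.T_kalgebra)

lemma comult_linear: "comult H \<in> linear_maps H (tensor H H)"
  using algebra_mapsD(1)[OF comult_hom] .

lemma comult_closed: "x \<in> carrier H \<Longrightarrow> comult H x \<in> carrier (tensor H H)"
  using algebra_mapsD(2)[OF comult_hom] .

lemma counit_add: "x \<in> carrier H \<Longrightarrow> y \<in> carrier H \<Longrightarrow> counit H (x \<oplus>
  y) = counit H x + counit H y"
  using ring_hom_add[OF counit_hom] by simp

lemma counit_bilinear_left:
  assumes "kalgebra U" "f \<in> linear_maps H U"
  shows "bilinear_map H H U (\<lambda>y z. counit H y \<odot>\<^bsub>U\<^esub> f z)"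
proof -
  interpret U: kalgebra U by fact
  show ?thesis
    by (rule bilinear_mapI) (simp_all add: linear_mapsD[OF assms(2)] counit_add counit_smult
        U.sm_add_l U.sm_add_r U.sm_sm mult.commute)
qed

lemma counit_bilinear_right:
  assumes "kalgebra U" "f \<in> linear_maps H U"
  shows "bilinear_map H H U (\<lambda>y z. counit H z \<odot>\<^bsub>U\<^esub> f y)"
proof -
  interpret U: kalgebra U by fact
  show ?thesis
    by (rule bilinear_mapI) (simp_all add: linear_mapsD[OF assms(2)] counit_add counit_smult
        U.sm_add_l U.sm_add_r U.sm_sm mult.commute)
qed

text \<open>
  Both sides of coassociativity are sent through \<open>x \<otimes> y \<otimes> z \<mapsto> S x \<cdot> y
    \<cdot> S' z\<close>, which gives
  \<open>S * (id * S') = (S * id) * S'\<close> for the convolution product.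
\<close>

lemma antipode_unique:
  assumes S: "is_antipode H S" and S': "is_antipode H S'" and x: "x \<in> carrier H"
  shows "S x = S' x"
proof -
  have Sl: "S \<in> linear_maps H H" and Sl': "S' \<in> linear_maps H H"
    using S S' by (auto simp: is_antipode_def)
  note [simp] = linear_mapsD[OF Sl] linear_mapsD[OF Sl']
  have bS: "bilinear_map H H H (\<lambda>y z. S y \<otimes> z)"
    using bilinear_map_comp[OF Sl linear_maps_id bilinear_map_mult[OF K.kalgebra_axioms]] by simp
  have bS': "bilinear_map H H H (\<lambda>y z. y \<otimes> S' z)"
    using bilinear_map_comp[OF linear_maps_id Sl' bilinear_map_mult[OF K.kalgebra_axioms]] by simp
  let ?R = "tensor_lift H (\<lambda>y z. y \<otimes> S' z)" and ?L = "tensor_lift H (\<lambda>y z. S y \<otimes> z)"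
  have R: "?R \<in> linear_maps (tensor H H) H" and L: "?L \<in> linear_maps (tensor H H) H"
    by (intro HH.tensor_lift_linear K.kalgebra_axioms bS bS')+
  have bM: "bilinear_map H (tensor H H) H (\<lambda>x t. S x \<otimes> ?R t)"
    by (rule bilinear_map_comp[OF Sl R bilinear_map_mult[OF K.kalgebra_axioms]])
  let ?M = "tensor_lift H (\<lambda>x t. S x \<otimes> ?R t)"
  have M: "?M \<in> linear_maps (tensor H (tensor H H)) H"
    by (intro H_HH.tensor_lift_linear K.kalgebra_axioms bM)
  have Mp: "?M (pure_tensor H (tensor H H) x t) = S x \<otimes> ?R t"
    if "x \<in> carrier H" "t \<in> carrier (tensor H H)" for x t
    by (rule H_HH.tensor_lift_pure[OF K.kalgebra_axioms bM that])
  have Rp: "?R (pure_tensor H H y z) = y \<otimes> S' z" if "y \<in> carrier H" "z \<in> carrier H" for y z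
    by (rule HH.tensor_lift_pure[OF K.kalgebra_axioms bS' that])
  have Lp: "?L (pure_tensor H H y z) = S y \<otimes> z" if "y \<in> carrier H" "z \<in> carrier H" for y z
    by (rule HH.tensor_lift_pure[OF K.kalgebra_axioms bS that])
  have RD: "?R (comult H z) = counit H z \<odot> \<one>" and LD: "?L (comult H z) = counit H z \<odot> \<one>"
    if "z \<in> carrier H" for z
    using S S' that by (auto simp: is_antipode_def)
  have idD: "tensor_map H (tensor H H) id (comult H) \<in> linear_maps (tensor H H) (tensor H (tensor H H))"
    by (intro tensor_map_linear K.kalgebra_axioms HH.T_kalgebra comult_linear)
      (simp add: linear_maps_id id_def)
  have Did: "tensor_map (tensor H H) H (comult H) id \<in> linear_maps (tensor H H) (tensor (tensor H H) H)"
    by (intro tensor_map_linear K.kalgebra_axioms HH.T_kalgebra comult_linear)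
      (simp add: linear_maps_id id_def)
  have idDp: "tensor_map H (tensor H H) id (comult H) (pure_tensor H H y z) =
      pure_tensor H (tensor H H) y (comult H z)" if "y \<in> carrier H" "z \<in> carrier H" for y z
    by (subst tensor_map_pure[where f = id and g = "comult H"])
      (simp_all add: that K.kalgebra_axioms HH.T_kalgebra comult_linear linear_maps_id[folded id_def])
  have Didp: "tensor_map (tensor H H) H (comult H) id (pure_tensor H H y z) =
      pure_tensor (tensor H H) H (comult H y) z" if "y \<in> carrier H" "z \<in> carrier H" for y z
    by (subst tensor_map_pure[where f = "comult H" and g = id])
      (simp_all add: that K.kalgebra_axioms HH.T_kalgebra comult_linear linear_maps_id[folded id_def])
  have 1: "?M (tensor_map H (tensor H H) id (comult H) t) = S (tensor_lift H (\<lambda>y z. counit H z \<odot> y) t)"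
    if "t \<in> carrier (tensor H H)" for t
  proof (rule HH.T_linear_eqI[OF linear_maps_comp[OF idD M] linear_maps_comp[OF _ Sl] _ that])
    note b = counit_bilinear_right[OF K.kalgebra_axioms linear_maps_id]
    show "tensor_lift H (\<lambda>y z. counit H z \<odot> y) \<in> linear_maps (tensor H H) H"
      by (intro HH.tensor_lift_linear K.kalgebra_axioms b)
    fix y z assume *: "y \<in> carrier H" "z \<in> carrier H"
    have e: "tensor_lift H (\<lambda>y z. counit H z \<odot> y) (pure_tensor H H y z) = counit H z \<odot> y"
      by (rule HH.tensor_lift_pure[OF K.kalgebra_axioms b *])
    show "?M (tensor_map H (tensor H H) id (comult H) (pure_tensor H H y z)) =
       S (tensor_lift H (\<lambda>y z. counit H z \<odot> y) (pure_tensor H H y z))"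
      unfolding e using * by (simp add: idDp Mp comult_closed RD K.sm_mult_r)
  qed
  have 2: "?M (tensor_assoc H (tensor_map (tensor H H) H (comult H) id t)) =
      S' (tensor_lift H (\<lambda>y z. counit H y \<odot> z) t)"
    if "t \<in> carrier (tensor H H)" for t
  proof (rule HH.T_linear_eqI[OF linear_maps_comp[OF linear_maps_comp[OF Did
        algebra_mapsD(1)[OF K.tensor_assoc_algebra]] M] linear_maps_comp[OF _ Sl'] _ that])
    note b = counit_bilinear_left[OF K.kalgebra_axioms linear_maps_id]
    show "tensor_lift H (\<lambda>y z. counit H y \<odot> z) \<in> linear_maps (tensor H H) H"
      by (intro HH.tensor_lift_linear K.kalgebra_axioms b)
    fix y z assume *: "y \<in> carrier H" "z \<in> carrier H"
    have e: "tensor_lift H (\<lambda>y z. counit H y \<odot> z) (pure_tensor H H y z) = counit H y \<odot> z"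
      by (rule HH.tensor_lift_pure[OF K.kalgebra_axioms b *])
    \<comment> \<open>The element \<open>u\<close> will be a coproduct and so not pure; both sides
      are linear in it, and on pure tensors the claim is associativity of the product.\<close>
    have MA: "?M (tensor_assoc H (pure_tensor (tensor H H) H u z)) = ?L u \<otimes> S' z"
      if "u \<in> carrier (tensor H H)" for u
    proof (rule HH.T_linear_eqI[OF _ _ _ that])
      show "(\<lambda>u. ?M (tensor_assoc H (pure_tensor (tensor H H) H u z))) \<in> linear_maps (tensor H H) H"
        using *(2) HH_H.pt_bilinear
        by (intro linear_maps_comp[OF linear_maps_comp[OF _ algebra_mapsD(1)[OF K.tensor_assoc_algebra]] M])
          (simp add: bilinear_map_def)
      show "(\<lambda>u. ?L u \<otimes> S' z) \<in> linear_maps (tensor H H) H"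
        by (rule linear_maps_comp[OF L linear_maps_mult_right[OF K.kalgebra_axioms]]) (use * in simp)
      fix a b assume "a \<in> carrier H" "b \<in> carrier H"
      then show "?M (tensor_assoc H (pure_tensor (tensor H H) H (pure_tensor H H a b) z)) =
          ?L (pure_tensor H H a b) \<otimes> S' z"
        using *(2) by (simp add: K.tensor_assoc_pure Mp Rp Lp m_assoc)
    qed
    show "?M (tensor_assoc H (tensor_map (tensor H H) H (comult H) id (pure_tensor H H y z))) =
       S' (tensor_lift H (\<lambda>y z. counit H y \<odot> z) (pure_tensor H H y z))"
      unfolding e using * by (simp add: Didp MA comult_closed LD K.sm_one_mult)
  qed
  have "S x = S (tensor_lift H (\<lambda>y z. counit H z \<odot> y) (comult H x))"
    using x by (simp add: counit_right)
  also have "\<dots> = ?M (tensor_assoc H (tensor_map (tensor H H) H (comult H) id (comult H x)))"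
    using x by (simp add: 1 comult_closed coassoc)
  also have "\<dots> = S' x"
    using x by (simp add: 2 comult_closed counit_left)
  finally show ?thesis .
qed

lemma is_antipode_cong:
  assumes S: "is_antipode H S" and eq: "\<And>x. x \<in> carrier H \<Longrightarrow> S' x = S x"
  shows "is_antipode H S'"
proof -
  have Sl: "S \<in> linear_maps H H"
    using S by (auto simp: is_antipode_def)
  have Sl': "S' \<in> linear_maps H H"
    by (rule linear_mapsI) (simp_all add: linear_mapsD[OF Sl] eq)
  have bS: "bilinear_map H H H (\<lambda>y z. S y \<otimes> z)"
    using bilinear_map_comp[OF Sl linear_maps_id bilinear_map_mult[OF K.kalgebra_axioms]] by simp
  have bS': "bilinear_map H H H (\<lambda>y z. y \<otimes> S z)"
    using bilinear_map_comp[OF linear_maps_id Sl bilinear_map_mult[OF K.kalgebra_axioms]] by simp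
  note c = tensor_lift_cong[OF K.kalgebra_axioms K.kalgebra_axioms K.kalgebra_axioms]
  show ?thesis
    using S Sl' unfolding is_antipode_def
    by (simp add: c[OF bS, of "\<lambda>y z. S' y \<otimes> z", symmetric] c[OF bS', of "\<lambda>y z. y
      \<otimes> S' z", symmetric]
        eq comult_closed)
qed

text \<open>By uniqueness on the carrier, the description in \<open>antipode\<close> has exactly one
  solution: the restriction of any given antipode.\<close>

lemma antipode_eq:
  assumes "is_antipode H S" "x \<in> carrier H"
  shows "antipode H x = S x"
proof -
  have "antipode H = restrict S (carrier H)"
    unfolding antipode_def
  proof (rule the_equality)
    show "restrict S (carrier H) \<in> extensional (carrier H) \<and> is_antipode H (restrict S (carrier H))"
      using is_antipode_cong[OF assms(1), of "restrict S (carrier H)"] by simp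
    fix S' assume "S' \<in> extensional (carrier H) \<and> is_antipode H S'"
    then show "S' = restrict S (carrier H)"
      using antipode_unique[OF assms(1), of S'] by (auto simp: extensional_def restrict_def)
  qed
  then show ?thesis using assms(2) by simp
qed

lemma is_antipode_antipode:
  assumes "is_antipode H S"
  shows "is_antipode H (antipode H)"
  by (rule is_antipode_cong[OF assms]) (rule antipode_eq[OF assms])

end

section \<open>Images of Hopf algebras\<close>

text \<open>Only \<open>H\<close> is assumed to be a Hopf algebra; the axioms for \<open>G\<close>
  are inherited along \<pi>. Since \<open>G\<close> comes without an antipode, compatibility with it
  is replaced by stability of the kernel.\<close>

locale hopf_image = H: hopf_algebra H + G: kalgebra G
  for H :: "('k::field, 'a, 'm) hopf_scheme" and G :: "('k, 'b, 'n) hopf_scheme" and \<pi> +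
  assumes \<pi>: "\<pi> \<in> algebra_maps H G"
    and surj: "\<pi> ` carrier H = carrier G"
    and comult_compat: "x \<in> carrier H \<Longrightarrow> comult G (\<pi> x) = tensor_map G G \<pi> \<pi>
      (comult H x)"
    and counit_compat: "x \<in> carrier H \<Longrightarrow> counit G (\<pi> x) = counit H x"
    and antipode_kernel: "x \<in> carrier H \<Longrightarrow> \<pi> x = \<zero>\<^bsub>G\<^esub>
      \<Longrightarrow> \<pi> (antipode H x) = \<zero>\<^bsub>G\<^esub>"
begin

interpretation K: kalgebra H by (rule bialgebra_kalgebra) (rule H.bialgebra_axioms)
interpretation HH: kalgebra_pair H H by (intro kalgebra_pairI K.kalgebra_axioms)
interpretation GG: kalgebra_pair G G by (intro kalgebra_pairI G.kalgebra_axioms)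
interpretation H_HH: kalgebra_pair H "tensor H H" by (intro kalgebra_pairI K.kalgebra_axioms HH.T_kalgebra)
interpretation HH_H: kalgebra_pair "tensor H H" H by (intro kalgebra_pairI K.kalgebra_axioms HH.T_kalgebra)
interpretation G_GG: kalgebra_pair G "tensor G G" by (intro kalgebra_pairI G.kalgebra_axioms GG.T_kalgebra)
interpretation GG_G: kalgebra_pair "tensor G G" G by (intro kalgebra_pairI G.kalgebra_axioms GG.T_kalgebra)

lemmas kalg = K.kalgebra_axioms G.kalgebra_axioms HH.T_kalgebra GG.T_kalgebra H_HH.T_kalgebra
  HH_H.T_kalgebra G_GG.T_kalgebra GG_G.T_kalgebra

lemma \<pi>_linear: "\<pi> \<in> linear_maps H G" using algebra_mapsD(1)[OF \<pi>] .

lemmas \<pi>_simps = algebra_mapsD(2-6)[OF \<pi>]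

abbreviation "\<pi>\<pi> \<equiv> tensor_map G G \<pi> \<pi>"

lemma \<pi>\<pi>_algebra: "\<pi>\<pi> \<in> algebra_maps (tensor H H) (tensor G G)"
  by (intro tensor_map_algebra kalg \<pi>)

lemma \<pi>\<pi>_linear: "\<pi>\<pi> \<in> linear_maps (tensor H H) (tensor G G)"
  using algebra_mapsD(1)[OF \<pi>\<pi>_algebra] .

lemmas \<pi>\<pi>_simps = algebra_mapsD(2-6)[OF \<pi>\<pi>_algebra]

lemma \<pi>\<pi>_pure: "x \<in> carrier H \<Longrightarrow> y \<in> carrier H \<Longrightarrow>
    \<pi>\<pi> (pure_tensor H H x y) = pure_tensor G G (\<pi> x) (\<pi> y)"
  by (intro tensor_map_pure kalg \<pi>_linear)

lemma surjE: assumes "y \<in> carrier G" obtains x where "x \<in> carrier H" "y = \<pi> x"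
  using assms surj by blast

lemma comult_G: "comult G \<in> algebra_maps G (tensor G G)"
proof (intro algebra_mapsI linear_mapsI)
  note D = algebra_mapsD[OF H.comult_hom]
  have "comult G (\<pi> \<one>\<^bsub>H\<^esub>) = \<one>\<^bsub>tensor G G\<^esub>"
    by (subst comult_compat) (simp_all add: D \<pi>\<pi>_simps)
  then show "comult G \<one>\<^bsub>G\<^esub> = \<one>\<^bsub>tensor G G\<^esub>" by (simp add: \<pi>_simps)
  fix x assume "x \<in> carrier G"
  then obtain x' where x: "x' \<in> carrier H" "x = \<pi> x'" by (rule surjE)
  show "comult G x \<in> carrier (tensor G G)" using x by (simp add: comult_compat D \<pi>\<pi>_simps)
  show "comult G (c \<odot>\<^bsub>G\<^esub> x) = c \<odot>\<^bsub>tensor G G\<^esub> comult G x" for c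
    using x comult_compat[of "c \<odot>\<^bsub>H\<^esub> x'"] by (simp add: comult_compat D \<pi>\<pi>_simps
      \<pi>_simps)
  fix y assume "y \<in> carrier G"
  then obtain y' where y: "y' \<in> carrier H" "y = \<pi> y'" by (rule surjE)
  show "comult G (x \<oplus>\<^bsub>G\<^esub> y) = comult G x \<oplus>\<^bsub>tensor G G\<^esub> comult G y"
    using x y comult_compat[of "x' \<oplus>\<^bsub>H\<^esub> y'"] by (simp add: comult_compat D
      \<pi>\<pi>_simps \<pi>_simps)
  show "comult G (x \<otimes>\<^bsub>G\<^esub> y) = comult G x \<otimes>\<^bsub>tensor G G\<^esub> comult G y"
    using x y comult_compat[of "x' \<otimes>\<^bsub>H\<^esub> y'"] by (simp add: comult_compat D
      \<pi>\<pi>_simps \<pi>_simps)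
qed

lemma comult_G_linear: "comult G \<in> linear_maps G (tensor G G)"
  using algebra_mapsD(1)[OF comult_G] .

text \<open>Naturality of the associativity map: on pure tensors both sides merely rebracket the
  images under \<pi>, and both are additive in \<open>t\<close>.\<close>

lemma assoc_natural:
  assumes "t \<in> carrier (tensor H H)" and y: "y \<in> carrier H"
  shows "tensor_assoc G (pure_tensor (tensor G G) G (\<pi>\<pi> t) (\<pi> y)) =
    tensor_map G (tensor G G) \<pi> \<pi>\<pi> (tensor_assoc H (pure_tensor (tensor H H) H t y))"
  using assms(1)
proof (induction t rule: HH.T_induct)
  case (pure x z)
  then show ?case using y
    by (simp add: \<pi>\<pi>_pure G.tensor_assoc_pure K.tensor_assoc_pure \<pi>_simps
      tensor_map_pure[OF kalg(1) kalg(3) kalg(2) kalg(4) \<pi>_linear \<pi>\<pi>_linear])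
next
  case (add t u)
  note a = algebra_mapsD[OF G.tensor_assoc_algebra] and b = algebra_mapsD[OF K.tensor_assoc_algebra]
  note c = linear_mapsD[OF tensor_map_linear[OF kalg(1) kalg(3) kalg(2) kalg(4) \<pi>_linear \<pi>\<pi>_linear]]
  from add y show ?case
    by (simp add: \<pi>\<pi>_simps \<pi>_simps GG_G.pt_add_left HH_H.pt_add_left a b c)
qed

text \<open>Every element of \<open>G\<close> is some \<open>\<pi> x\<close>. Each side of an axiom
  at \<open>\<pi> x\<close> is the image of the corresponding side for \<open>H\<close> at
  \<open>x\<close>, because all maps involved commute with \<pi> on pure tensors.\<close>

lemma bialgebra_G: "bialgebra G"
proof (intro bialgebra.intro bialgebra_axioms.intro)
  show "algebra base_field G" using G.algebra_axioms .
  show "comult G \<in> algebra_maps G (tensor G G)" by (rule comult_G)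
  show "counit G \<in> ring_hom G base_field"
  proof (rule ring_hom_memI)
    show "counit G \<one>\<^bsub>G\<^esub> = \<one>\<^bsub>base_field\<^esub>"
      using counit_compat[of "\<one>\<^bsub>H\<^esub>"] ring_hom_one[OF H.counit_hom] by (simp add: \<pi>_simps)
    fix x y assume "x \<in> carrier G" and yG: "y \<in> carrier G"
    from this(1) obtain x' where x: "x' \<in> carrier H" "x = \<pi> x'" by (rule surjE)
    from yG obtain y' where y: "y' \<in> carrier H" "y = \<pi> y'" by (rule surjE)
    show "counit G (x \<otimes>\<^bsub>G\<^esub> y) = counit G x \<otimes>\<^bsub>base_field\<^esub> counit G y"
      using x y counit_compat[of "x' \<otimes>\<^bsub>H\<^esub> y'"] ring_hom_mult[OF H.counit_hom, of x' y']
      by (simp add: counit_compat \<pi>_simps)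
    show "counit G (x \<oplus>\<^bsub>G\<^esub> y) = counit G x \<oplus>\<^bsub>base_field\<^esub> counit G y"
      using x y counit_compat[of "x' \<oplus>\<^bsub>H\<^esub> y'"] ring_hom_add[OF H.counit_hom, of x' y']
      by (simp add: counit_compat \<pi>_simps)
  qed simp
  fix x assume "x \<in> carrier G"
  then obtain x' where x: "x' \<in> carrier H" "x = \<pi> x'" by (rule surjE)
  show "counit G (c \<odot>\<^bsub>G\<^esub> x) = c * counit G x" for c
    using x counit_compat[of "c \<odot>\<^bsub>H\<^esub> x'"] by (simp add: counit_compat \<pi>_simps H.counit_smult)
  have D: "comult H x' \<in> carrier (tensor H H)" using x H.comult_closed by simp
  have idl: "id \<in> linear_maps H H" "id \<in> linear_maps G G" by (simp_all add: linear_maps_id id_def)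
  show "tensor_assoc G (tensor_map (tensor G G) G (comult G) id (comult G x)) =
      tensor_map G (tensor G G) id (comult G) (comult G x)"
  proof -
    note tH1 = tensor_map_linear[OF kalg(1) kalg(1) kalg(3) kalg(1) H.comult_linear idl(1)]
      and tH2 = tensor_map_linear[OF kalg(1) kalg(1) kalg(1) kalg(3) idl(1) H.comult_linear]
      and tG1 = tensor_map_linear[OF kalg(2) kalg(2) kalg(4) kalg(2) comult_G_linear idl(2)]
      and tG2 = tensor_map_linear[OF kalg(2) kalg(2) kalg(2) kalg(4) idl(2) comult_G_linear]
      and t\<pi> = tensor_map_linear[OF kalg(1) kalg(3) kalg(2) kalg(4) \<pi>_linear \<pi>\<pi>_linear]
      and aG = algebra_mapsD(1)[OF G.tensor_assoc_algebra]
      and aH = algebra_mapsD(1)[OF K.tensor_assoc_algebra]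
    note pH1 = tensor_map_pure[OF kalg(1) kalg(1) kalg(3) kalg(1) H.comult_linear idl(1)]
      and pH2 = tensor_map_pure[OF kalg(1) kalg(1) kalg(1) kalg(3) idl(1) H.comult_linear]
      and pG1 = tensor_map_pure[OF kalg(2) kalg(2) kalg(4) kalg(2) comult_G_linear idl(2)]
      and pG2 = tensor_map_pure[OF kalg(2) kalg(2) kalg(2) kalg(4) idl(2) comult_G_linear]
      and p\<pi> = tensor_map_pure[OF kalg(1) kalg(3) kalg(2) kalg(4) \<pi>_linear \<pi>\<pi>_linear]
    have "tensor_assoc G (tensor_map (tensor G G) G (comult G) id (\<pi>\<pi> t)) =
        tensor_map G (tensor G G) \<pi> \<pi>\<pi> (tensor_assoc H (tensor_map (tensor H H) H (comult H) id t))"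
      if "t \<in> carrier (tensor H H)" for t
      by (rule HH.T_linear_eqI[OF linear_maps_comp[OF linear_maps_comp[OF \<pi>\<pi>_linear tG1] aG]
          linear_maps_comp[OF linear_maps_comp[OF tH1 aH] t\<pi>] _ that])
        (simp add: \<pi>\<pi>_pure pG1 pH1 \<pi>_simps comult_compat assoc_natural H.comult_closed)
    moreover have "tensor_map G (tensor G G) id (comult G) (\<pi>\<pi> t) =
        tensor_map G (tensor G G) \<pi> \<pi>\<pi> (tensor_map H (tensor H H) id (comult H) t)"
      if "t \<in> carrier (tensor H H)" for t
      by (rule HH.T_linear_eqI[OF linear_maps_comp[OF \<pi>\<pi>_linear tG2]
          linear_maps_comp[OF tH2 t\<pi>] _ that])
        (simp add: \<pi>\<pi>_pure pG2 pH2 p\<pi> \<pi>_simps comult_compat H.comult_closed)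
    ultimately show ?thesis using x D by (simp add: comult_compat H.coassoc)
  qed
  \<comment> \<open>Linearity of the counit is needed for the lifts below at a point where
    \<open>G\<close> is not yet known to be a bialgebra, so it is lifted from \<open>H\<close>
    directly.\<close>
  have cl: "counit G (a \<oplus>\<^bsub>G\<^esub> b) = counit G a + counit G b"
      "counit G (c \<odot>\<^bsub>G\<^esub> a) = c * counit G a"
      if aG: "a \<in> carrier G" and bG: "b \<in> carrier G" for a b c
  proof -
    from aG obtain a' where a: "a' \<in> carrier H" "a = \<pi> a'" by (rule surjE)
    from bG obtain b' where b: "b' \<in> carrier H" "b = \<pi> b'" by (rule surjE)
    show "counit G (a \<oplus>\<^bsub>G\<^esub> b) = counit G a + counit G b"
      using a b counit_compat[of "a' \<oplus>\<^bsub>H\<^esub> b'"] by (simp add: counit_compat \<pi>_simps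
        H.counit_add)
    show "counit G (c \<odot>\<^bsub>G\<^esub> a) = c * counit G a"
      using a b counit_compat[of "c \<odot>\<^bsub>H\<^esub> a'"] by (simp add: counit_compat \<pi>_simps
        H.counit_smult)
  qed
  have b1: "bilinear_map G G G (\<lambda>y z. counit G y \<odot>\<^bsub>G\<^esub> z)"
    by (rule bilinear_mapI) (simp_all add: cl G.sm_add_l G.sm_add_r G.sm_sm mult.commute)
  have b2: "bilinear_map G G G (\<lambda>y z. counit G z \<odot>\<^bsub>G\<^esub> y)"
    by (rule bilinear_mapI) (simp_all add: cl G.sm_add_l G.sm_add_r G.sm_sm mult.commute)
  note b3 = H.counit_bilinear_left[OF kalg(1) linear_maps_id]
    and b4 = H.counit_bilinear_right[OF kalg(1) linear_maps_id]
  have "tensor_lift G (\<lambda>y z. counit G y \<odot>\<^bsub>G\<^esub> z) (\<pi>\<pi> t) = \<pi> (tensor_lift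
    H (\<lambda>y z. counit H y \<odot>\<^bsub>H\<^esub> z) t)"
    if "t \<in> carrier (tensor H H)" for t
    by (rule HH.T_linear_eqI[OF linear_maps_comp[OF \<pi>\<pi>_linear GG.tensor_lift_linear[OF kalg(2) b1]]
          linear_maps_comp[OF HH.tensor_lift_linear[OF kalg(1) b3] \<pi>_linear] _ that])
      (simp add: \<pi>\<pi>_pure \<pi>_simps counit_compat HH.tensor_lift_pure[OF kalg(1) b3]
        GG.tensor_lift_pure[OF kalg(2) b1])
  then show "tensor_lift G (\<lambda>y z. counit G y \<odot>\<^bsub>G\<^esub> z) (comult G x) = x"
    using x D by (simp add: comult_compat H.counit_left)
  have "tensor_lift G (\<lambda>y z. counit G z \<odot>\<^bsub>G\<^esub> y) (\<pi>\<pi> t) = \<pi> (tensor_lift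
    H (\<lambda>y z. counit H z \<odot>\<^bsub>H\<^esub> y) t)"
    if "t \<in> carrier (tensor H H)" for t
    by (rule HH.T_linear_eqI[OF linear_maps_comp[OF \<pi>\<pi>_linear GG.tensor_lift_linear[OF kalg(2) b2]]
          linear_maps_comp[OF HH.tensor_lift_linear[OF kalg(1) b4] \<pi>_linear] _ that])
      (simp add: \<pi>\<pi>_pure \<pi>_simps counit_compat HH.tensor_lift_pure[OF kalg(1) b4]
        GG.tensor_lift_pure[OF kalg(2) b2])
  then show "tensor_lift G (\<lambda>y z. counit G z \<odot>\<^bsub>G\<^esub> y) (comult G x) = x"
    using x D by (simp add: comult_compat H.counit_right)
qed

definition "S\<^sub>G y = \<pi> (antipode H (SOME x. x \<in> carrier H \<and> \<pi> x = y))"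

lemma antipode_H: "is_antipode H (antipode H)"
  using H.antipode_exists H.is_antipode_antipode by blast

text \<open>Two preimages of one element differ by an element of the kernel, which the antipode of
  \<open>H\<close> maps into the kernel; so the choice made in \<open>S\<^sub>G\<close> has no
  influence.\<close>

lemma S\<^sub>G_\<pi>:
  assumes "x \<in> carrier H"
  shows "S\<^sub>G (\<pi> x) = \<pi> (antipode H x)"
proof -
  have al: "antipode H \<in> linear_maps H H" using antipode_H by (simp add: is_antipode_def)
  define x' where "x' = (SOME z. z \<in> carrier H \<and> \<pi> z = \<pi> x)"
  have "x' \<in> carrier H \<and> \<pi> x' = \<pi> x" unfolding x'_def by (rule someI[of _ x]) (simp add: assms)
  then have x': "x' \<in> carrier H" "\<pi> x' = \<pi> x" by auto
  let ?d = "x' \<oplus>\<^bsub>H\<^esub> (-1) \<odot>\<^bsub>H\<^esub> x"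
  have "\<pi> ?d = \<zero>\<^bsub>G\<^esub>"
    using x' assms \<pi>_simps(1)[OF assms] by (simp add: \<pi>_simps G.sm_minus G.r_neg)
  then have "\<pi> (antipode H ?d) = \<zero>\<^bsub>G\<^esub>" using x' assms by (intro antipode_kernel) auto
  then have "\<pi> (antipode H x') \<oplus>\<^bsub>G\<^esub> \<ominus>\<^bsub>G\<^esub> \<pi> (antipode H x) =
    \<zero>\<^bsub>G\<^esub>"
    using x' assms by (simp add: linear_mapsD[OF al] \<pi>_simps G.sm_minus)
  then have "\<pi> (antipode H x') = \<pi> (antipode H x)"
    using x' assms G.r_right_minus_eq[of "\<pi> (antipode H x')" "\<pi> (antipode H x)"]
    by (simp add: linear_mapsD[OF al] \<pi>_simps a_minus_def)
  then show ?thesis by (simp add: S\<^sub>G_def x'_def)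
qed

lemma is_antipode_S\<^sub>G: "is_antipode G S\<^sub>G"
proof -
  have al: "antipode H \<in> linear_maps H H" using antipode_H by (simp add: is_antipode_def)
  note al' = linear_mapsD[OF al]
  have SG: "S\<^sub>G \<in> linear_maps G G"
  proof (rule linear_mapsI)
    fix x assume "x \<in> carrier G"
    then obtain x' where x: "x' \<in> carrier H" "x = \<pi> x'" by (rule surjE)
    show "S\<^sub>G x \<in> carrier G" using x by (simp add: S\<^sub>G_\<pi> al' \<pi>_simps)
    show "S\<^sub>G (c \<odot>\<^bsub>G\<^esub> x) = c \<odot>\<^bsub>G\<^esub> S\<^sub>G x" for c
      using x S\<^sub>G_\<pi>[of "c \<odot>\<^bsub>H\<^esub> x'"] by (simp add: S\<^sub>G_\<pi> al' \<pi>_simps)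
    fix y assume "y \<in> carrier G"
    then obtain y' where y: "y' \<in> carrier H" "y = \<pi> y'" by (rule surjE)
    show "S\<^sub>G (x \<oplus>\<^bsub>G\<^esub> y) = S\<^sub>G x \<oplus>\<^bsub>G\<^esub> S\<^sub>G y"
      using x y S\<^sub>G_\<pi>[of "x' \<oplus>\<^bsub>H\<^esub> y'"] by (simp add: S\<^sub>G_\<pi> al' \<pi>_simps)
  qed
  note mG = bilinear_map_mult[OF kalg(2)] and mH = bilinear_map_mult[OF kalg(1)]
  note b1 = bilinear_map_comp[OF SG linear_maps_id mG] and b2 = bilinear_map_comp[OF linear_maps_id SG mG]
    and b3 = bilinear_map_comp[OF al linear_maps_id mH] and b4 = bilinear_map_comp[OF linear_maps_id al mH]
  have 1: "tensor_lift G (\<lambda>y z. S\<^sub>G y \<otimes>\<^bsub>G\<^esub> z) (\<pi>\<pi> t) = \<pi>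
    (tensor_lift H (\<lambda>y z. antipode H y \<otimes>\<^bsub>H\<^esub> z) t)"
    if "t \<in> carrier (tensor H H)" for t
    by (rule HH.T_linear_eqI[OF linear_maps_comp[OF \<pi>\<pi>_linear GG.tensor_lift_linear[OF kalg(2) b1]]
          linear_maps_comp[OF HH.tensor_lift_linear[OF kalg(1) b3] \<pi>_linear] _ that])
      (simp add: \<pi>\<pi>_pure \<pi>_simps S\<^sub>G_\<pi> al' HH.tensor_lift_pure[OF kalg(1) b3]
        GG.tensor_lift_pure[OF kalg(2) b1])
  have 2: "tensor_lift G (\<lambda>y z. y \<otimes>\<^bsub>G\<^esub> S\<^sub>G z) (\<pi>\<pi> t) = \<pi>
    (tensor_lift H (\<lambda>y z. y \<otimes>\<^bsub>H\<^esub> antipode H z) t)"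
    if "t \<in> carrier (tensor H H)" for t
    by (rule HH.T_linear_eqI[OF linear_maps_comp[OF \<pi>\<pi>_linear GG.tensor_lift_linear[OF kalg(2) b2]]
          linear_maps_comp[OF HH.tensor_lift_linear[OF kalg(1) b4] \<pi>_linear] _ that])
      (simp add: \<pi>\<pi>_pure \<pi>_simps S\<^sub>G_\<pi> al' HH.tensor_lift_pure[OF kalg(1) b4]
        GG.tensor_lift_pure[OF kalg(2) b2])
  show ?thesis
    unfolding is_antipode_def
  proof (intro conjI ballI SG)
    fix x assume "x \<in> carrier G"
    then obtain x' where x: "x' \<in> carrier H" "x = \<pi> x'" by (rule surjE)
    have *: "tensor_lift H (\<lambda>y z. antipode H y \<otimes>\<^bsub>H\<^esub> z) (comult H x') = counit H
      x' \<odot>\<^bsub>H\<^esub> \<one>\<^bsub>H\<^esub>"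
      "tensor_lift H (\<lambda>y z. y \<otimes>\<^bsub>H\<^esub> antipode H z) (comult H x') = counit H x'
        \<odot>\<^bsub>H\<^esub> \<one>\<^bsub>H\<^esub>"
      using antipode_H x by (auto simp: is_antipode_def)
    show "tensor_lift G (\<lambda>y z. S\<^sub>G y \<otimes>\<^bsub>G\<^esub> z) (comult G x) = counit G x
      \<odot>\<^bsub>G\<^esub> \<one>\<^bsub>G\<^esub>"
      "tensor_lift G (\<lambda>y z. y \<otimes>\<^bsub>G\<^esub> S\<^sub>G z) (comult G x) = counit G x
        \<odot>\<^bsub>G\<^esub> \<one>\<^bsub>G\<^esub>"
      using x * by (simp_all add: comult_compat counit_compat 1 2 H.comult_closed \<pi>_simps)
  qed
qed

lemma hopf_algebra_G: "hopf_algebra G"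
  by (intro hopf_algebra.intro hopf_algebra_axioms.intro bialgebra_G exI[of _ S\<^sub>G] is_antipode_S\<^sub>G)

lemma hopf_hom_\<pi>: "hopf_hom H G \<pi>"
  unfolding hopf_hom_def
  using H.hopf_algebra_axioms hopf_algebra_G \<pi> bialgebra.antipode_eq[OF bialgebra_G is_antipode_S\<^sub>G]
  by (simp add: comult_compat counit_compat \<pi>_simps S\<^sub>G_\<pi>)

end

section \<open>The substitution \<open>x \<mapsto> x / (1 - f x)\<close> on power series\<close>

text \<open>The geometric series 1 / (1 - f x), given by coefficients so that no division is
  involved.\<close>

definition fps_geo :: "'a::idom \<Rightarrow> 'a fps" where
  "fps_geo f = Abs_fps (\<lambda>n. f ^ n)"

lemma fps_geo_inverse: "fps_geo f * (1 - fps_const f * fps_X) = 1"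
proof (rule fps_ext)
  fix n show "(fps_geo f * (1 - fps_const f * fps_X)) $ n = 1 $ n"
    by (cases n) (simp_all add: fps_geo_def right_diff_distrib mult.assoc[symmetric] mult.commute[of f])
qed

text \<open>This negative binomial series is the source of the binomial coefficients in the
  coproduct of a chain. Multiplying by 1 - f x lowers the exponent of the geometric factor, which on
  coefficients becomes Pascal's rule.\<close>

lemma fps_X_geo_power_nth:
  "((fps_X * fps_geo f) ^ Suc j) $ Suc k = of_nat (k choose j) * f ^ (k - j)"
proof (induction j arbitrary: k)
  case 0
  then show ?case by (simp add: fps_geo_def)
next
  case (Suc j)
  let ?P = "\<lambda>j. (fps_X * fps_geo f) ^ Suc j"
  have "?P (Suc j) * (1 - fps_const f * fps_X) = ?P j * fps_X * (fps_geo f * (1 - fps_const f * fps_X))"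
    by (simp only: power_Suc mult_ac)
  then have *: "?P (Suc j) * (1 - fps_const f * fps_X) = ?P j * fps_X"
    by (simp add: fps_geo_inverse)
  have "A = B + c * (A * x)" if "A * (1 - c * x) = B" for A B c x :: "'a fps"
    using that by (simp add: algebra_simps)
  from this[OF *] have "?P (Suc j) = ?P j * fps_X + fps_const f * (?P (Suc j) * fps_X)" .
  then have rec: "?P (Suc j) $ n = (?P j * fps_X + fps_const f * (?P (Suc j) * fps_X)) $ n" for n
    by (rule arg_cong)
  then have r: "?P (Suc j) $ Suc n = ?P j $ n + f * ?P (Suc j) $ n" for n
    using rec[of "Suc n"] by simp
  show ?case
  proof (induction k)
    case 0
    show ?case by (subst r) simp
  next
    case (Suc k)
    \<comment> \<open>Where the subtraction in the exponent truncates, the binomial coefficient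
      vanishes.\<close>
    have e: "of_nat (k choose Suc j) * f ^ (k - j) = f * (of_nat (k choose Suc j) * f ^ (k - Suc j))"
    proof (cases "Suc j \<le> k")
      case True
      then have "k - j = Suc (k - Suc j)" by simp
      then show ?thesis by (simp add: ac_simps)
    qed (simp add: binomial_eq_0)
    show ?case by (subst r) (simp only: Suc \<open>\<And>k. ?P j $ Suc k = _ k\<close> binomial_Suc_Suc
      of_nat_add diff_Suc_Suc distrib_right e)
  qed
qed

lemma fps_compose_assoc:
  fixes a :: "'a::idom fps"
  assumes c: "c $ 0 = 0" and d: "d $ 0 = 0"
  shows "(a oo c) oo d = a oo (c oo d)"
proof (rule fps_ext)
  fix n
  have "((a oo c) oo d) $ n = (\<Sum>i=0..n. (\<Sum>k=0..n. a $ k * (c ^ k $ i)) * (d ^ i $ n))"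
  proof -
    \<comment> \<open>As \<open>c\<close> has no constant term, \<open>c ^ k\<close> starts in
      degree at least \<open>k\<close>; the inner sum can therefore be extended to a range
      independent of \<open>i\<close>, and the two sums exchanged.\<close>
    have "(\<Sum>k=0..i. a $ k * (c ^ k $ i)) = (\<Sum>k=0..n. a $ k * (c ^ k $ i))" if "i \<in> {0..n}" for i
      by (rule sum.mono_neutral_left) (use that c in \<open>auto simp: startsby_zero_power_prefix\<close>)
    then show ?thesis by (simp add: fps_compose_nth)
  qed
  also have "\<dots> = (\<Sum>k=0..n. a $ k * (\<Sum>i=0..n. (c ^ k $ i) * (d ^ i $ n)))"
    unfolding sum_distrib_left sum_distrib_right by (subst sum.swap) (simp add: mult.assoc)
  also have "\<dots> = (\<Sum>k=0..n. a $ k * ((c ^ k oo d) $ n))"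
    by (simp add: fps_compose_nth)
  also have "\<dots> = (a oo (c oo d)) $ n"
    by (simp add: fps_compose_nth[of a] fps_compose_power[OF d])
  finally show "((a oo c) oo d) $ n = (a oo (c oo d)) $ n" .
qed

definition fps_shift_subst :: "'a::idom \<Rightarrow> 'a fps \<Rightarrow> 'a fps" where
  "fps_shift_subst f a = a oo (fps_X * fps_geo f)"

lemma fps_shift_subst_mult:
  "fps_shift_subst f (a * b) = fps_shift_subst f a * fps_shift_subst f b"
  unfolding fps_shift_subst_def by (rule fps_compose_mult_distrib) simp

lemma fps_shift_subst_1 [simp]: "fps_shift_subst f 1 = 1"
  by (simp add: fps_shift_subst_def)

lemma fps_shift_subst_nth_0 [simp]: "fps_shift_subst f a $ 0 = a $ 0"
  by (simp add: fps_shift_subst_def)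

lemma fps_geo_0 [simp]: "fps_geo 0 = 1"
  by (rule fps_ext) (simp add: fps_geo_def power_0_left)

lemma fps_shift_subst_0 [simp]: "fps_shift_subst 0 a = a"
  by (simp add: fps_shift_subst_def)

text \<open>The maps x / (1 - f x) are Moebius transformations fixing 0, and their parameters add
  under composition. In series terms two elements are both inverse to 1 - (f + g) x, a nonzero
  factor that can be cancelled.\<close>

lemma fps_shift_subst_subst:
  "fps_shift_subst f (fps_shift_subst g a) = fps_shift_subst (f + g) a"
proof -
  let ?y = "fps_X * fps_geo f"
  have y0: "?y $ 0 = 0" by simp
  let ?z = "fps_geo g oo ?y"
  have lin: "(1 - fps_const g * fps_X) oo ?y = 1 - fps_const g * ?y"
    by (simp add: fps_compose_sub_distrib fps_compose_mult_distrib[OF y0])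
  have "?z * (1 - fps_const g * ?y) = (fps_geo g * (1 - fps_const g * fps_X)) oo ?y"
    by (simp add: fps_compose_mult_distrib[OF y0] lin)
  then have z: "?z * (1 - fps_const g * ?y) = 1" by (simp add: fps_geo_inverse)
  \<comment> \<open>Split 1 - (f + g) x as (1 - f x) - g x; times the geometric series of
    \<open>f\<close> this is 1 - g y, which \<open>?z\<close> inverts.\<close>
  have "fps_geo f * ?z * (1 - fps_const (f + g) * fps_X) =
      ?z * (fps_geo f * (1 - fps_const f * fps_X) - fps_const g * ?y)"
    by (simp add: algebra_simps fps_const_add[symmetric] del: fps_const_add)
  also have "\<dots> = 1" using z by (simp add: fps_geo_inverse)
  also have "1 = fps_geo (f + g) * (1 - fps_const (f + g) * fps_X)" by (simp add: fps_geo_inverse)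
  finally have "fps_geo f * ?z * (1 - fps_const (f + g) * fps_X) =
      fps_geo (f + g) * (1 - fps_const (f + g) * fps_X)" .
  moreover have "1 - fps_const (f + g) * fps_X \<noteq> 0"
    using fps_geo_inverse[of "f + g"] by (metis mult_zero_right zero_neq_one)
  ultimately have "fps_geo f * ?z = fps_geo (f + g)" by simp
  then have "fps_X * fps_geo g oo ?y = fps_X * fps_geo (f + g)"
    by (simp add: fps_compose_mult_distrib[OF y0] mult.assoc)
  then show ?thesis by (simp add: fps_shift_subst_def fps_compose_assoc)
qed

text \<open>Expanding a(x / (1 - f x)) b(x) reproduces the double sum defining the coproduct of a
  chain; the isolated summand comes from the constant term 1 of \<open>a\<close>.\<close>

lemma fps_shift_subst_mult_nth:
  assumes "a $ 0 = 1"
  shows "(fps_shift_subst f a * b) $ n = b $ n +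
    (\<Sum>m=1..n. \<Sum>j=0..n-m. of_nat ((n - m) choose j) * (a $ (j + 1) * (b $ (m - 1) * f ^ (n - m - j))))"
proof -
  have s: "fps_shift_subst f a $ Suc k = (\<Sum>j=0..k. of_nat (k choose j) * a $ (j + 1) * f ^ (k - j))" for k
  proof -
    have "fps_shift_subst f a $ Suc k = (\<Sum>i=0..Suc k. a $ i * (fps_X * fps_geo f) ^ i $ Suc k)"
      by (simp add: fps_shift_subst_def fps_compose_nth)
    also have "\<dots> = (\<Sum>i=Suc 0..Suc k. a $ i * (fps_X * fps_geo f) ^ i $ Suc k)"
      by (subst sum.atLeast_Suc_atMost) simp_all
    also have "\<dots> = (\<Sum>j=0..k. a $ Suc j * (fps_X * fps_geo f) ^ Suc j $ Suc k)"
      by (subst sum.shift_bounds_cl_Suc_ivl) simp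
    also have "\<dots> = (\<Sum>j=0..k. of_nat (k choose j) * a $ (j + 1) * f ^ (k - j))"
      unfolding fps_X_geo_power_nth by (simp add: ac_simps)
    finally show ?thesis .
  qed
  have "(fps_shift_subst f a * b) $ n = (\<Sum>i=0..n. fps_shift_subst f a $ i * b $ (n - i))"
    by (rule fps_mult_nth)
  also have "\<dots> = b $ n + (\<Sum>i=1..n. fps_shift_subst f a $ i * b $ (n - i))"
    by (subst sum.atLeast_Suc_atMost) (simp_all add: assms)
  also have "(\<Sum>i=1..n. fps_shift_subst f a $ i * b $ (n - i)) =
      (\<Sum>m=1..n. fps_shift_subst f a $ Suc (n - m) * b $ (m - 1))"
    \<comment> \<open>The index m of the coproduct formula is n - i + 1, so that \<open>b\<close>
      carries the index m - 1.\<close>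
    by (rule sum.reindex_bij_witness[of _ "\<lambda>m. Suc (n - m)" "\<lambda>i. Suc (n - i)"]) auto
  also have "\<dots> = (\<Sum>m=1..n. \<Sum>j=0..n-m. of_nat ((n - m) choose j) * (a $ (j + 1) * (b $ (m - 1) *
    f ^ (n - m - j))))"
    unfolding s sum_distrib_right by (simp add: ac_simps)
  finally show ?thesis .
qed

section \<open>Evaluation of polynomials in an algebra\<close>

definition mon_eval :: "('k::field, 'a, 'm) module_scheme \<Rightarrow> (nat \<Rightarrow> 'a) \<Rightarrow>
  (nat \<Rightarrow>\<^sub>0 nat) \<Rightarrow> 'a" where
  "mon_eval A g u = (\<Otimes>\<^bsub>A\<^esub>i\<in>keys u. g i [^]\<^bsub>A\<^esub> lookup u i)"

definition poly_eval :: "('k::field, 'a, 'm) module_scheme \<Rightarrow> (nat \<Rightarrow> 'a) \<Rightarrow>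
  'k cg \<Rightarrow> 'a" where
  "poly_eval A g = lext A (mon_eval A g)"

lemma CG_sel [simp]:
  "carrier CG = UNIV" "x \<otimes>\<^bsub>CG\<^esub> y = x * y" "\<one>\<^bsub>CG\<^esub> = 1"
    "\<zero>\<^bsub>CG\<^esub> = 0" "x \<oplus>\<^bsub>CG\<^esub> y = x + y"
  "c \<odot>\<^bsub>CG\<^esub> x = vscale c x" "comult CG = comult_CG" "counit CG x = lookup x 0"
  by (simp_all add: CG_def CG_algebra_def module.extend_def hopf.defs)

lemma CG_cring: "cring (CG :: ('k::field, 'k cg) hopf)"
proof (intro cringI abelian_groupI comm_monoidI)
  fix x :: "'k cg"
  show "\<exists>y\<in>carrier CG. y \<oplus>\<^bsub>CG\<^esub> x = \<zero>\<^bsub>CG\<^esub>" by (intro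
    bexI[of _ "- x"]) auto
qed (simp_all add: algebra_simps)

lemma CG_kalgebra: "kalgebra (CG :: ('k::field, 'k cg) hopf)"
  by (rule kalgebraI[OF CG_cring])
    (auto simp: vs.scale_left_distrib vs.scale_right_distrib vscale_mult_left)

interpretation CG: kalgebra "CG :: ('k::field, 'k cg) hopf" by (rule CG_kalgebra)

lemma CG_pow [simp]: "x [^]\<^bsub>CG\<^esub> (n::nat) = x ^ n"
  by (induction n) (simp_all add: mult.commute)

lemma CG_finsum [simp]: "finsum CG f S = sum f S"
proof (cases "finite S")
  case True
  then show ?thesis by (induction S) auto
qed (simp add: CG.M.add.finprod_infinite)

context kalgebra
begin

lemma mon_eval_superset:
  assumes "finite S" "keys u \<subseteq> S" "g \<in> UNIV \<rightarrow> carrier A"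
  shows "mon_eval A g u = (\<Otimes>i\<in>S. g i [^] lookup u i)"
  unfolding mon_eval_def
  by (rule finprod_mono_neutral_cong_left)
    (use assms in \<open>auto simp: in_keys_iff Pi_iff\<close>)

lemma mon_eval_closed [simp]: "g \<in> UNIV \<rightarrow> carrier A \<Longrightarrow> mon_eval A g u \<in> carrier A"
  unfolding mon_eval_def by (rule finprod_closed) auto

lemma mon_eval_add:
  assumes g: "g \<in> UNIV \<rightarrow> carrier A"
  shows "mon_eval A g (u + v) = mon_eval A g u \<otimes> mon_eval A g v"
proof -
  let ?S = "keys u \<union> keys v"
  note * = mon_eval_superset[of ?S _ g]
  have "mon_eval A g (u + v) = (\<Otimes>i\<in>?S. g i [^] lookup (u + v) i)"
    by (rule *) (use g keys_add[of u v] in auto)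
  also have "\<dots> = (\<Otimes>i\<in>?S. g i [^] lookup u i \<otimes> g i [^] lookup v i)"
    by (rule finprod_cong') (use g in \<open>auto simp: lookup_add nat_pow_mult Pi_iff\<close>)
  also have "\<dots> = (\<Otimes>i\<in>?S. g i [^] lookup u i) \<otimes> (\<Otimes>i\<in>?S. g i [^] lookup v i)"
    by (rule finprod_multf) (use g in auto)
  finally show ?thesis using *[of u] *[of v] g by simp
qed

lemma mon_eval_zero [simp]: "mon_eval A g 0 = \<one>"
  by (simp add: mon_eval_def)

lemma mon_eval_single [simp]:
  "g \<in> UNIV \<rightarrow> carrier A \<Longrightarrow> mon_eval A g (single i n) = g i [^] n"
  by (cases "n = 0") (auto simp: mon_eval_def Pi_iff)

lemma poly_eval_single:
  "g \<in> UNIV \<rightarrow> carrier A \<Longrightarrow> poly_eval A g (single u c) = c \<odot> mon_eval A g u"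
  by (simp add: poly_eval_def)

lemma poly_eval_var [simp]: "g \<in> UNIV \<rightarrow> carrier A \<Longrightarrow> poly_eval A g (cg_var i) = g i"
  by (auto simp: cg_var_def poly_eval_single Pi_iff)

lemma poly_eval_linear:
  assumes g: "g \<in> UNIV \<rightarrow> carrier A"
  shows "poly_eval A g \<in> linear_maps CG A"
proof -
  have b: "mon_eval A g \<in> UNIV \<rightarrow> carrier A" using g by auto
  show ?thesis unfolding poly_eval_def
    by (rule linear_mapsI)
      (simp_all add: lext_closed[OF subset_UNIV b] lext_add[OF subset_UNIV subset_UNIV b]
        lext_vscale[OF subset_UNIV b])
qed

text \<open>The existence half of the freeness of \<open>CG\<close>: generators may be sent
  anywhere. The coproduct, the antipode and the maps to \<open>Sym\<close> all arise in this
  way.\<close>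

lemma poly_eval_algebra:
  assumes g: "g \<in> UNIV \<rightarrow> carrier A"
  shows "poly_eval A g \<in> algebra_maps CG A"
proof (rule algebra_mapsI)
  note lin = poly_eval_linear[OF g]
  show "poly_eval A g \<in> linear_maps CG A" by (rule lin)
  note lin' = linear_mapsD[OF lin, simplified]
  show "poly_eval A g \<one>\<^bsub>CG\<^esub> = \<one>"
    using poly_eval_single[OF g, of 0 1] by simp
  have "poly_eval A g (p * q) = poly_eval A g p \<otimes> poly_eval A g q" for p q
  proof (induction p rule: poly_mapping_induct_on[OF subset_UNIV])
    case 1
    then show ?case by (simp add: lin' poly_eval_def lext_closed[OF subset_UNIV, of "mon_eval A g"] g)
  next
    case (2 u c)
    show ?case
    proof (induction q rule: poly_mapping_induct_on[OF subset_UNIV])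
      case 1
      then show ?case by (simp add: lin' poly_eval_def lext_closed[OF subset_UNIV, of "mon_eval A g"] g)
    next
      case (2 v d)
      then show ?case
        by (simp add: mult_single poly_eval_single g mon_eval_add sm_mult_l sm_mult_r sm_sm mult.commute)
    next
      case (3 p q)
      then show ?case by (simp add: distrib_left lin' r_distr)
    qed
  next
    case (3 p p')
    then show ?case by (simp add: distrib_right lin' l_distr)
  qed
  then show "poly_eval A g (p \<otimes>\<^bsub>CG\<^esub> q) = poly_eval A g p \<otimes> poly_eval A g q" for p
    q by simp
qed

end

lemma cg_var_power: "cg_var i ^ n = single (single i n) 1"
proof (induction n)
  case (Suc n)
  have "single i (Suc n) = single i 1 + single i n"
    by (simp add: single_add[symmetric])
  then show ?case by (simp only: power_Suc Suc) (simp add: cg_var_def mult_single)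
qed simp

text \<open>The uniqueness half of freeness. Agreement spreads from variables to their powers, to
  monomials by multiplicativity, and to polynomials by linearity.\<close>

lemma CG_algebra_maps_eqI:
  fixes A :: "('k::field, 'a, 'm) module_scheme"
  assumes A: "kalgebra A" and f: "f \<in> algebra_maps CG A" and g: "g \<in> algebra_maps CG A"
    and eq: "\<And>i. f (cg_var i) = g (cg_var i)"
  shows "f p = g p"
proof -
  interpret kalgebra A by fact
  note D = algebra_mapsD(2-6)[OF f, simplified] algebra_mapsD(2-6)[OF g, simplified]
  have mon: "f (single u 1) = g (single u 1)" for u
  proof (induction u rule: poly_mapping_induct_on[OF subset_UNIV])
    case 1
    then show ?case by (simp add: D)
  next
    case (2 i n)
    have "single (single i n) 1 = (cg_var i :: 'k cg) ^ n"
      by (rule cg_var_power[symmetric])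
    then show ?case
      using algebra_maps_pow[OF CG_kalgebra A f, of "cg_var i" n]
        algebra_maps_pow[OF CG_kalgebra A g, of "cg_var i" n] eq[of i] by simp
  next
    case (3 u v)
    then show ?case
      using D(4)[of "single u 1" "single v 1"]
        D(9)[of "single u 1" "single v 1"] by (simp add: mult_single)
  qed
  show ?thesis
  proof (induction p rule: poly_mapping_induct_on[OF subset_UNIV])
    case 1
    then show ?case using linear_maps_zero[OF CG_kalgebra A algebra_mapsD(1)[OF f]]
        linear_maps_zero[OF CG_kalgebra A algebra_mapsD(1)[OF g]] by simp
  next
    case (2 u c)
    have "single u c = vscale c (single u 1)" by simp
    then show ?case using mon[of u] by (metis D(3) D(8))
  next
    case (3 p q)
    then show ?case by (simp add: D)
  qed
qed

section \<open>The product of chain sequences\<close>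

text \<open>
  In generating functions, \<^term>\<open>chain_product B a f b\<close> is \<open>a(x / (1 - f x)) \<cdot>
    b(x)\<close> when
  \<open>a\<^sub>0 = 1\<close>; the coproduct of \<open>C\<^sub>n\<close> is the \<open>n\<close>-th term for
    \<open>a = C \<otimes> 1\<close>, \<open>f = 1 \<otimes> F\<close>, \<open>b = 1 \<otimes> C\<close>.
\<close>

definition chain_product ::
  "('k::field, 'a, 'm) module_scheme \<Rightarrow> (nat \<Rightarrow> 'a) \<Rightarrow> 'a \<Rightarrow> (nat
    \<Rightarrow> 'a) \<Rightarrow> nat \<Rightarrow> 'a" where
  "chain_product B a f b n = b n \<oplus>\<^bsub>B\<^esub>
     (\<Oplus>\<^bsub>B\<^esub>m\<in>{1..n}. \<Oplus>\<^bsub>B\<^esub>j\<in>{0..n-m}. of_nat ((n - m) choose j)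
       \<odot>\<^bsub>B\<^esub>
       (a (j + 1) \<otimes>\<^bsub>B\<^esub> (b (m - 1) \<otimes>\<^bsub>B\<^esub> f [^]\<^bsub>B\<^esub> (n -
         m - j))))"

lemma chain_product_closed:
  assumes "kalgebra B" "range a \<subseteq> carrier B" "f \<in> carrier B" "range b \<subseteq> carrier B"
  shows "chain_product B a f b n \<in> carrier B"
proof -
  interpret kalgebra B by fact
  have "a i \<in> carrier B" "b i \<in> carrier B" for i using assms by auto
  then show ?thesis unfolding chain_product_def using assms(3)
    by (intro M.a_closed M.finsum_closed Pi_I sm_closed m_closed nat_pow_closed) auto
qed

lemma chain_product_0 [simp]:
  "kalgebra B \<Longrightarrow> b 0 \<in> carrier B \<Longrightarrow> chain_product B a f b 0 = b 0"
proof -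
  assume "kalgebra B" "b 0 \<in> carrier B"
  then interpret kalgebra B by simp
  show ?thesis using \<open>b 0 \<in> carrier B\<close> by (simp add: chain_product_def)
qed

text \<open>The formula uses only the algebra operations, so algebra maps preserve it. Identities
  proved in a polynomial ring are transported by this lemma.\<close>

lemma algebra_maps_chain_product:
  assumes "kalgebra A" "kalgebra B" "\<phi> \<in> algebra_maps A B"
    "range a \<subseteq> carrier A" "f \<in> carrier A" "range b \<subseteq> carrier A"
  shows "\<phi> (chain_product A a f b n) = chain_product B (\<lambda>i. \<phi> (a i)) (\<phi> f) (\<lambda>i.
    \<phi> (b i)) n"
proof -
  interpret A: kalgebra A by fact
  interpret B: kalgebra B by fact
  note D = algebra_mapsD[OF assms(3)]
  have ab [simp]: "a i \<in> carrier A" "b i \<in> carrier A" for i using assms by auto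
  note [simp] = assms(5)
  have "\<phi> (\<Oplus>\<^bsub>A\<^esub>j\<in>{0..n-m}. of_nat ((n - m) choose j) \<odot>\<^bsub>A\<^esub>
        (a (j + 1) \<otimes>\<^bsub>A\<^esub> (b (m - 1) \<otimes>\<^bsub>A\<^esub> f [^]\<^bsub>A\<^esub> (n -
          m - j)))) =
      (\<Oplus>\<^bsub>B\<^esub>j\<in>{0..n-m}. of_nat ((n - m) choose j) \<odot>\<^bsub>B\<^esub>
        (\<phi> (a (j + 1)) \<otimes>\<^bsub>B\<^esub> (\<phi> (b (m - 1)) \<otimes>\<^bsub>B\<^esub> \<phi> f
          [^]\<^bsub>B\<^esub> (n - m - j))))" for m
    by (subst linear_maps_finsum[OF assms(1,2) D(1)])
      (simp_all add: D(4,5) algebra_maps_pow[OF assms(1-3)] Pi_iff)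
  then show ?thesis
    unfolding chain_product_def
    by (subst D(3)) (simp_all add: linear_maps_finsum[OF assms(1,2) D(1)] A.M.finsum_closed Pi_iff)
qed

lemma chain_product_CG:
  fixes a b :: "nat \<Rightarrow> 'k::field cg"
  assumes "a 0 = 1"
  shows "chain_product CG a f b n = (fps_shift_subst f (Abs_fps a) * Abs_fps b) $ n"
proof -
  \<comment> \<open>The binomial coefficients are scalars in \<open>chain_product\<close> but
    elements of the polynomial ring in the power series formula.\<close>
  have "vscale (of_nat k) p = of_nat k * p" for k and p :: "'k cg"
    by (induction k) (simp_all add: vs.scale_left_distrib distrib_right)
  then show ?thesis
    using assms by (subst fps_shift_subst_mult_nth) (simp_all add: chain_product_def)
qed

text \<open>Both sides are the coefficient of a(x / (1 - (f + g) x)) b(x / (1 - g x)) c(x): the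
  substitution is multiplicative and its parameters add.\<close>

lemma chain_product_assoc_CG:
  fixes a b c :: "nat \<Rightarrow> 'k::field cg"
  assumes "a 0 = 1" "b 0 = 1"
  shows "chain_product CG (chain_product CG a f b) g c n =
    chain_product CG a (f + g) (chain_product CG b g c) n"
proof -
  have "chain_product CG a f b 0 = 1" using assms by (simp add: CG_kalgebra)
  moreover have "Abs_fps (chain_product CG a f b) = fps_shift_subst f (Abs_fps a) * Abs_fps b"
    "Abs_fps (chain_product CG b g c) = fps_shift_subst g (Abs_fps b) * Abs_fps c"
    by (rule fps_ext; simp add: chain_product_CG assms)+
  ultimately show ?thesis
    using assms by (simp add: chain_product_CG fps_shift_subst_mult fps_shift_subst_subst mult.assoc add.commute)
qed

text \<open>\<open>B\<close> need not be an integral domain, so the identity is proved for sequences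
  of independent variables in \<open>CG\<close> and then specialized by evaluation.\<close>

lemma chain_product_assoc:
  fixes B :: "('k::field, 'a, 'm) module_scheme"
  assumes B: "kalgebra B" and a: "range a \<subseteq> carrier B" and b: "range b \<subseteq> carrier B"
    and c: "range c \<subseteq> carrier B" and f: "f \<in> carrier B" and g: "g \<in> carrier B"
    and 0: "a 0 = \<one>\<^bsub>B\<^esub>" "b 0 = \<one>\<^bsub>B\<^esub>" "c 0 = \<one>\<^bsub>B\<^esub>"
  shows "chain_product B (chain_product B a f b) g c n =
    chain_product B a (f \<oplus>\<^bsub>B\<^esub> g) (chain_product B b g c) n"
proof -
  interpret kalgebra B by fact
  \<comment> \<open>Indices modulo 4 keep the variables apart: residues 0, 1, 2 carry the three
    sequences, while variables 3 and 7 carry \<open>f\<close> and \<open>g\<close>. The sequences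
    \<open>v r\<close> start with 1 to match the normalization of \<open>a\<close>,
    \<open>b\<close>, \<open>c\<close>.\<close>
  define \<gamma> where "\<gamma> k = (if k mod 4 = 0 then a (k div 4) else if k mod 4 = 1 then b (k div 4)
    else if k mod 4 = 2 then c (k div 4) else if k = 3 then f else g)" for k
  define v where "v r i = (if i = 0 then 1 else cg_var (4 * i + r) :: 'k cg)" for r i :: nat
  have \<gamma>: "\<gamma> \<in> UNIV \<rightarrow> carrier B" using f g subsetD[OF a rangeI] subsetD[OF b
    rangeI] subsetD[OF c rangeI]
    by (simp add: \<gamma>_def)
  have "(4 * i + 1) mod 4 = 1" "(4 * i + 1) div 4 = i" "(4 * i + 2) mod 4 = 2" "(4 * i + 2) div 4 = i"
    for i :: nat by presburger+
  then have g4: "\<gamma> (4 * i) = a i" "\<gamma> (Suc (4 * i)) = b i" "\<gamma> (Suc (Suc (4 * i))) = c i" for i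
    by (simp_all add: \<gamma>_def)
  let ?e = "poly_eval B \<gamma>"
  have e: "?e \<in> algebra_maps CG B" by (rule poly_eval_algebra[OF \<gamma>])
  have e1: "?e 1 = \<one>\<^bsub>B\<^esub>" using algebra_mapsD(6)[OF e] by simp
  have ev: "?e (v 0 i) = a i" "?e (v 1 i) = b i" "?e (v 2 i) = c i" for i
    using 0 by (auto simp: v_def e1 \<gamma> g4)
  have ef: "?e (cg_var 3) = f" "?e (cg_var 7) = g" using \<gamma> by (auto simp: \<gamma>_def)
  have efg: "?e (cg_var 3 + cg_var 7) = f \<oplus>\<^bsub>B\<^esub> g"
    using algebra_mapsD(3)[OF e, of "cg_var 3" "cg_var 7"] by (simp add: ef)
  note h = algebra_maps_chain_product[OF CG_kalgebra B e]
  have "?e (chain_product CG (chain_product CG (v 0) (cg_var 3) (v 1)) (cg_var 7) (v 2) n) =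
    ?e (chain_product CG (v 0) (cg_var 3 + cg_var 7) (chain_product CG (v 1) (cg_var 7) (v 2)) n)"
    by (subst chain_product_assoc_CG) (simp_all add: v_def)
  then show ?thesis by (simp add: h ev ef efg del: One_nat_def)
qed

context kalgebra_pair
begin

lemma emb_left: "(\<lambda>x. pt x \<one>\<^bsub>B\<^esub>) \<in> algebra_maps A T"
  by (intro algebra_mapsI linear_mapsI) (simp_all add: pt_add_left pt_smult_left pt_mult T_one)

lemma emb_right: "(\<lambda>y. pt \<one>\<^bsub>A\<^esub> y) \<in> algebra_maps B T"
  by (intro algebra_mapsI linear_mapsI) (simp_all add: pt_add_right pt_smult_right pt_mult T_one)

end

section \<open>The Hopf algebra of chain gangs\<close>

lemma tensor_CG:
  "tensor CG_algebra CG_algebra = tensor CG (CG :: ('k::field, 'k cg) hopf)"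
  "pure_tensor CG_algebra CG_algebra = pure_tensor CG (CG :: ('k, 'k cg) hopf)"
  by (rule tensor_scheme_cong; simp add: CG_def module.extend_def)+

context
begin

interpretation CC: kalgebra_pair "CG :: ('k::field, 'k cg) hopf" "CG :: ('k::field, 'k cg) hopf"
  by (intro kalgebra_pairI CG_kalgebra)

lemma CC_pt_closed [simp]: "pure_tensor CG CG x y \<in> carrier (tensor CG CG)"
  by (rule CC.pt_closed) simp_all

lemma chain_0 [simp]: "chain 0 = 1"
  by (simp add: chain_def)

lemma chain_nonzero: "n \<noteq> 0 \<Longrightarrow> chain n = cg_var n"
  by (simp add: chain_def)

abbreviation "CG_emb_left \<equiv> \<lambda>x. pure_tensor CG CG x 1"
abbreviation "CG_emb_right \<equiv> \<lambda>x. pure_tensor CG CG 1 x"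

lemma CG_emb: "CG_emb_left \<in> algebra_maps CG (tensor CG CG)" "CG_emb_right \<in> algebra_maps CG (tensor CG CG)"
  using CC.emb_left CC.emb_right by simp_all

text \<open>Each summand C_{j+1} \<otimes> C_{m-1} F^k is a product of images under the two
  embeddings, which are algebra maps; so the defining double sum is a chain product.\<close>

lemma comult_chain_eq:
  "comult_chain n = chain_product (tensor CG CG) (\<lambda>i. CG_emb_left (chain i)) (CG_emb_right phantom)
     (\<lambda>i. CG_emb_right (chain i)) n"
proof -
  have "pure_tensor CG CG x (y * f ^ k) =
      CG_emb_left x \<otimes>\<^bsub>tensor CG CG\<^esub> (CG_emb_right y \<otimes>\<^bsub>tensor CG CG\<^esub>
        CG_emb_right f [^]\<^bsub>tensor CG CG\<^esub> k)"
    for x y f :: "'a cg" and k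
    using algebra_maps_pow[OF CG_kalgebra CC.T_kalgebra CG_emb(2), of f k, symmetric]
    by (simp add: CC.pt_mult)
  then show ?thesis
    by (simp only: comult_chain_def tensor_CG chain_product_def)
qed

lemma comult_phantom_eq: "comult_phantom = CG_emb_right phantom \<oplus>\<^bsub>tensor CG CG\<^esub>
  CG_emb_left phantom"
  by (simp add: comult_phantom_def tensor_CG)

definition comult_gens :: "nat \<Rightarrow> ('k::field cg \<times> 'k cg \<Rightarrow>\<^sub>0 'k) set" where
  "comult_gens i = (if i = 0 then comult_phantom else comult_chain i)"

lemma comult_gens_closed: "comult_gens \<in> UNIV \<rightarrow> carrier (tensor CG CG)"
  by (auto simp: comult_gens_def comult_phantom_eq comult_chain_eq intro!: chain_product_closed CC.T_kalgebra)

lemma comult_CG_eq: "comult_CG = poly_eval (tensor CG CG) comult_gens"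
  by (intro ext) (simp add: comult_CG_def poly_eval_def lext_def mon_eval_def comult_gens_def tensor_CG)

lemma comult_CG_algebra: "comult_CG \<in> algebra_maps CG (tensor CG CG)"
  unfolding comult_CG_eq by (rule CC.T.poly_eval_algebra[OF comult_gens_closed])

lemmas comult_CG_simps = algebra_mapsD(2-6)[OF comult_CG_algebra, simplified]

lemma comult_CG_phantom: "comult_CG phantom = CG_emb_right phantom \<oplus>\<^bsub>tensor CG CG\<^esub>
  CG_emb_left phantom"
  unfolding comult_CG_eq phantom_def CC.T.poly_eval_var[OF comult_gens_closed]
  by (simp add: comult_gens_def comult_phantom_eq phantom_def)

lemma comult_CG_chain:
  "comult_CG (chain n) = chain_product (tensor CG CG) (\<lambda>i. CG_emb_left (chain i)) (CG_emb_right phantom)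
     (\<lambda>i. CG_emb_right (chain i)) n"
\<comment> \<open>C_0 is not a variable but the unit, so the case is separate.\<close>
proof (cases "n = 0")
  case True
  then show ?thesis
    by (simp add: CC.T_kalgebra comult_CG_simps(5) CC.T_one)
next
  case False
  then show ?thesis
    unfolding comult_CG_eq chain_nonzero[OF False] CC.T.poly_eval_var[OF comult_gens_closed]
    by (simp add: comult_gens_def comult_chain_eq)
qed

lemma CG_maps_eqI:
  assumes "kalgebra A" "f \<in> algebra_maps CG A" "g \<in> algebra_maps CG A"
    and "f phantom = g phantom" "\<And>n. f (chain n) = g (chain n)"
  shows "f p = g p"
proof (rule CG_algebra_maps_eqI[OF assms(1-3)])
  fix i show "f (cg_var i) = g (cg_var i)"
    using assms(4) assms(5)[of i] by (cases "i = 0") (simp_all add: phantom_def chain_def)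
qed

lemma algebra_maps_comult_chain:
  assumes "kalgebra A" "\<phi> \<in> algebra_maps (tensor CG CG) A"
  shows "\<phi> (comult_CG (chain n)) = chain_product A (\<lambda>i. \<phi> (CG_emb_left (chain i)))
    (\<phi> (CG_emb_right phantom)) (\<lambda>i. \<phi> (CG_emb_right (chain i))) n"
  unfolding comult_CG_chain
  by (rule algebra_maps_chain_product[OF CC.T_kalgebra assms]) auto

interpretation C_CC: kalgebra_pair "CG :: ('k::field, 'k cg) hopf" "tensor CG CG :: ('k, _) module"
  by (intro kalgebra_pairI CG_kalgebra CC.T_kalgebra)
interpretation CC_C: kalgebra_pair "tensor CG CG :: ('k::field, _) module" "CG :: ('k::field, 'k cg) hopf"
  by (intro kalgebra_pairI CG_kalgebra CC.T_kalgebra)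

lemma id_CG: "id \<in> algebra_maps CG CG"
  by (simp add: algebra_maps_id id_def)

text \<open>Both sides are algebra maps, so generators suffice. On F the claim is associativity of
  addition; on chains it is associativity of the chain product.\<close>

lemma CG_coassoc:
  "tensor_assoc CG (tensor_map (tensor CG CG) CG comult_CG id (comult_CG x)) =
   tensor_map CG (tensor CG CG) id comult_CG (comult_CG x)"
proof -
  let ?T = "tensor CG (tensor CG CG)" and ?pt = "pure_tensor CG (tensor CG CG)"
  define L where "L t = tensor_assoc CG (tensor_map (tensor CG CG) CG comult_CG id t)" for t :: "('a cg
    \<times> 'a cg \<Rightarrow>\<^sub>0 'a) set"
  define R where "R = tensor_map CG (tensor CG (CG :: ('a, 'a cg) hopf)) id comult_CG"
  note k = CG_kalgebra CC.T_kalgebra C_CC.T_kalgebra CC_C.T_kalgebra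
  note a = CG.tensor_assoc_algebra
  note comult_lin = algebra_mapsD(1)[OF comult_CG_algebra] and id_lin = algebra_mapsD(1)[OF id_CG]
  note pl = tensor_map_pure[OF k(1) k(1) k(2) k(1) comult_lin id_lin, simplified]
  note pr = tensor_map_pure[OF k(1) k(1) k(1) k(2) id_lin comult_lin, simplified]
  have L: "L \<in> algebra_maps (tensor CG CG) ?T"
    unfolding L_def[abs_def]
    by (rule algebra_maps_comp[OF tensor_map_algebra[OF k(1) k(1) k(2) k(1) comult_CG_algebra id_CG] a])
  have R: "R \<in> algebra_maps (tensor CG CG) ?T"
    unfolding R_def
    by (rule tensor_map_algebra[OF k(1) k(1) k(1) k(2) id_CG comult_CG_algebra])
  note ap = CG.tensor_assoc_pure[simplified]
  have D1: "comult_CG 1 = pure_tensor CG CG 1 1" by (simp add: comult_CG_simps(5) CC.T_one)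
  have L2: "L (CG_emb_right y) = ?pt 1 (pure_tensor CG CG 1 y)" for y
    by (simp add: L_def pl D1 ap)
  have R1: "R (CG_emb_left x) = ?pt x (pure_tensor CG CG 1 1)" for x
    by (simp add: R_def pr D1)
  have R2: "R (CG_emb_right y) = ?pt 1 (comult_CG y)" for y
    by (simp add: R_def pr)
  have L1: "L (CG_emb_left y) = tensor_assoc CG (pure_tensor (tensor CG CG) CG (comult_CG y) 1)" for y
    by (simp add: L_def pl)
  have A1: "(\<lambda>t. tensor_assoc CG (pure_tensor (tensor CG CG) CG t 1)) \<in> algebra_maps (tensor CG CG) ?T"
    using algebra_maps_comp[OF CC_C.emb_left a] by simp
  have A2: "(\<lambda>t. ?pt 1 t) \<in> algebra_maps (tensor CG CG) ?T"
    using C_CC.emb_right by simp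
  have ptc: "?pt x (pure_tensor CG CG y z) \<in> carrier ?T" for x y z by (rule C_CC.pt_closed) simp_all
  show ?thesis
    unfolding L_def[symmetric] R_def[symmetric]
  proof (rule CG_maps_eqI[OF k(3) algebra_maps_comp[OF comult_CG_algebra L] algebra_maps_comp[OF comult_CG_algebra R]])
    have "L (comult_CG phantom) = ?pt 1 (pure_tensor CG CG 1 phantom) \<oplus>\<^bsub>?T\<^esub>
        (?pt 1 (pure_tensor CG CG phantom 1) \<oplus>\<^bsub>?T\<^esub> ?pt phantom (pure_tensor CG CG 1 1))"
      unfolding comult_CG_phantom by (subst algebra_mapsD(3)[OF L])
        (simp_all add: L1 L2 comult_CG_phantom algebra_mapsD(3)[OF A1] ap)
    moreover have "R (comult_CG phantom) = (?pt 1 (pure_tensor CG CG 1 phantom) \<oplus>\<^bsub>?T\<^esub>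
        ?pt 1 (pure_tensor CG CG phantom 1)) \<oplus>\<^bsub>?T\<^esub> ?pt phantom (pure_tensor CG CG 1 1)"
      unfolding comult_CG_phantom by (subst algebra_mapsD(3)[OF R])
        (simp_all add: R1 R2 comult_CG_phantom algebra_mapsD(3)[OF A2])
    ultimately show "L (comult_CG phantom) = R (comult_CG phantom)"
      using ptc by (simp add: C_CC.T.M.a_assoc)
  next
    fix n
    \<comment> \<open>The chain sequences in the three tensor positions, and the phantom in the
      second and third.\<close>
    let ?a = "\<lambda>i. ?pt (chain i) (pure_tensor CG CG 1 1)" and ?b = "\<lambda>i. ?pt 1 (pure_tensor CG CG
      (chain i) 1)"
      and ?c = "\<lambda>i. ?pt 1 (pure_tensor CG CG 1 (chain i))" and ?f = "?pt 1 (pure_tensor CG CG phantom 1)"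
      and ?g = "?pt 1 (pure_tensor CG CG 1 phantom)"
    let ?f = "?pt 1 (pure_tensor CG CG phantom 1)"
    have "L (comult_CG (chain n)) = chain_product ?T (chain_product ?T ?a ?f ?b) ?g ?c n"
      unfolding algebra_maps_comult_chain[OF k(3) L] L1 L2 algebra_maps_comult_chain[OF k(3) A1]
      by (simp add: ap)
    also have "\<dots> = chain_product ?T ?a (?f \<oplus>\<^bsub>?T\<^esub> ?g) (chain_product ?T ?b ?g ?c) n"
      using ptc by (intro chain_product_assoc k) (auto simp: C_CC.T_one CC.T_one)
    \<comment> \<open>The parameter \<open>?f \<oplus> ?g\<close> is the coproduct of F placed in
      the last two positions, up to the order of the summands.\<close>
    also have "\<dots> = R (comult_CG (chain n))"
      unfolding algebra_maps_comult_chain[OF k(3) R] R1 R2 algebra_maps_comult_chain[OF k(3) A2] comult_CG_phantom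
      using ptc by (subst algebra_mapsD(3)[OF A2]) (simp_all add: C_CC.T.a_comm)
    finally show "L (comult_CG (chain n)) = R (comult_CG (chain n))" .
  qed
qed

end

text \<open>Exponents cannot cancel: a product of monomials is trivial only if both factors are.
  This makes the counit multiplicative.\<close>

lemma lookup_mult_zero:
  fixes p q :: "'k::field cg"
  shows "lookup (p * q) 0 = lookup p 0 * lookup q 0"
proof (induction p rule: poly_mapping_induct_on[OF subset_UNIV])
  case (2 u c)
  show ?case
  proof (induction q rule: poly_mapping_induct_on[OF subset_UNIV])
    case (2 v d)
    have "u + v = 0 \<longleftrightarrow> u = 0 \<and> v = 0"
      by (auto simp: poly_mapping_eq_iff fun_eq_iff lookup_add)
    then show ?case by (auto simp: mult_single lookup_single when_def)
  qed (simp_all add: distrib_left lookup_add)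
qed (simp_all add: distrib_right lookup_add)

lemma single_Suc_neq_zero [simp]: "single i (Suc n) \<noteq> 0"
  by (metis Zero_not_Suc lookup_single_eq lookup_zero)

lemma lookup_chain_zero: "lookup (chain n :: 'k::field cg) 0 = (if n = 0 then 1 else 0)"
  by (auto simp: chain_def cg_var_def lookup_single when_def)

lemma lookup_phantom_zero: "lookup (phantom :: 'k::field cg) 0 = 0"
  by (simp add: phantom_def cg_var_def lookup_single when_def)

section \<open>Generating series, convolution and the antipode of \<open>CG\<close>\<close>

definition chain_fps :: "'k::field cg fps" where
  "chain_fps = Abs_fps chain"

text \<open>The argument \<open>1\<close> is the inverse of the constant term, from which the
  recursion for the other coefficients starts.\<close>

definition inverse_chain_fps :: "'k::field cg fps" where
  "inverse_chain_fps = fps_right_inverse chain_fps 1"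

lemma inverse_chain_fps: "chain_fps * inverse_chain_fps = 1"
  unfolding inverse_chain_fps_def by (rule fps_right_inverse) (simp add: chain_fps_def)

lemma inverse_chain_fps_0: "inverse_chain_fps $ 0 = 1"
  using arg_cong[OF inverse_chain_fps, of "\<lambda>a. a $ 0"] by (simp add: chain_fps_def)

text \<open>
  \<open>CG\<close> represents pairs \<open>(f, c)\<close> with \<open>c(x)\<close> a power series with
    constant term 1; the inverse
  of such a pair is \<open>(- f, 1 / c(x / (1 + f x)))\<close>.
\<close>

definition antipode_fps :: "'k::field cg fps" where
  "antipode_fps = fps_shift_subst (- phantom) inverse_chain_fps"

definition CG_antipode :: "'k::field cg \<Rightarrow> 'k cg" where
  "CG_antipode = poly_eval CG (\<lambda>i. if i = 0 then - phantom else antipode_fps $ i)"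

lemma CG_antipode_algebra: "CG_antipode \<in> algebra_maps CG CG"
  unfolding CG_antipode_def by (rule CG.poly_eval_algebra) simp

lemmas CG_antipode_simps = algebra_mapsD(2-6)[OF CG_antipode_algebra, simplified]

lemma CG_antipode_phantom: "CG_antipode phantom = - phantom"
  unfolding CG_antipode_def by (subst (2) phantom_def) (subst CG.poly_eval_var, simp_all)

lemma CG_antipode_chain: "CG_antipode (chain n) = antipode_fps $ n"
proof (cases "n = 0")
  case True
  then show ?thesis by (simp add: CG_antipode_simps antipode_fps_def inverse_chain_fps_0)
next
  case False
  then show ?thesis
    unfolding CG_antipode_def chain_nonzero[OF False] by (subst CG.poly_eval_var) simp_all
qed

lemma chain_product_CG_nth:
  fixes a b :: "'k::field cg fps"
  assumes "a $ 0 = 1"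
  shows "chain_product CG (\<lambda>i. a $ i) f (\<lambda>i. b $ i) n = (fps_shift_subst f a * b) $ n"
  by (subst chain_product_CG) (simp_all add: assms fps_nth_inverse)

context
begin

interpretation CC: kalgebra_pair "CG :: ('k::field, 'k cg) hopf" "CG :: ('k::field, 'k cg) hopf"
  by (intro kalgebra_pairI CG_kalgebra)

text \<open>The map is multiplication after \<phi> \<otimes> \<psi>, an algebra map because
  \<open>CG\<close> is commutative. So the convolution of two algebra maps is determined on
  generators.\<close>

lemma CG_lift_algebra:
  fixes \<phi> \<psi> :: "'k::field cg \<Rightarrow> 'k cg"
  assumes \<phi>: "\<phi> \<in> algebra_maps CG CG" and \<psi>: "\<psi> \<in> algebra_maps CG CG"
  shows "tensor_lift CG (\<lambda>y z. \<phi> y * \<psi> z) \<in> algebra_maps (tensor CG CG) CG"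
    and "tensor_lift CG (\<lambda>y z. \<phi> y * \<psi> z) (pure_tensor CG CG x y) = \<phi> x * \<psi> y"
proof -
  have b: "bilinear_map CG CG CG (\<lambda>y z. \<phi> y * \<psi> z)"
    using bilinear_map_comp[OF algebra_mapsD(1)[OF \<phi>] algebra_mapsD(1)[OF \<psi>]
        bilinear_map_mult[OF CG_kalgebra]] by simp
  note D = algebra_mapsD(2-6)[OF \<phi>, simplified] algebra_mapsD(2-6)[OF \<psi>, simplified]
  show "tensor_lift CG (\<lambda>y z. \<phi> y * \<psi> z) \<in> algebra_maps (tensor CG CG) CG"
    by (rule CC.tensor_lift_algebra[OF CG_kalgebra b]) (simp_all add: D mult_ac)
  show "tensor_lift CG (\<lambda>y z. \<phi> y * \<psi> z) (pure_tensor CG CG x y) = \<phi> x * \<psi> y"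
    by (rule CC.tensor_lift_pure[OF CG_kalgebra b]) simp_all
qed

text \<open>The group law in coordinates: if \<phi> and \<psi> correspond to (f, a) and (g, b),
  their convolution corresponds to (f + g, a(x / (1 - g x)) b(x)).\<close>

lemma convolution_chain:
  fixes \<phi> \<psi> :: "'k::field cg \<Rightarrow> 'k cg"
  assumes \<phi>: "\<phi> \<in> algebra_maps CG CG" and \<psi>: "\<psi> \<in> algebra_maps CG CG"
    and \<phi>_chain: "\<And>n. \<phi> (chain n) = a $ n" and \<psi>_chain: "\<And>n. \<psi> (chain n) = b $ n"
  shows "tensor_lift CG (\<lambda>y z. \<phi> y * \<psi> z) (comult_CG (chain n)) = (fps_shift_subst (\<psi>
    phantom) a * b) $ n"
proof -
  note D = algebra_mapsD(2-6)[OF \<phi>, simplified] algebra_mapsD(2-6)[OF \<psi>, simplified]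
  have "a $ 0 = 1" using \<phi>_chain[of 0] D by simp
  then show ?thesis
    by (subst algebra_maps_comult_chain[OF CG_kalgebra CG_lift_algebra(1)[OF \<phi> \<psi>]])
      (simp add: CG_lift_algebra(2)[OF \<phi> \<psi>] D \<phi>_chain \<psi>_chain chain_product_CG_nth)
qed

lemma convolution_phantom:
  fixes \<phi> \<psi> :: "'k::field cg \<Rightarrow> 'k cg"
  assumes \<phi>: "\<phi> \<in> algebra_maps CG CG" and \<psi>: "\<psi> \<in> algebra_maps CG CG"
  shows "tensor_lift CG (\<lambda>y z. \<phi> y * \<psi> z) (comult_CG phantom) = \<psi> phantom + \<phi> phantom"
proof -
  note D = algebra_mapsD(2-6)[OF \<phi>, simplified] algebra_mapsD(2-6)[OF \<psi>, simplified]
  show ?thesis unfolding comult_CG_phantom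
    by (subst algebra_mapsD(3)[OF CG_lift_algebra(1)[OF \<phi> \<psi>]])
      (simp_all add: CG_lift_algebra(2)[OF \<phi> \<psi>] D)
qed

text \<open>The neutral element of convolution, the pair (0, 1) in these coordinates. It has values
  in \<open>CG\<close>, so that the counit can be treated as an algebra map into an algebra of the
  same kind.\<close>

definition CG_unit_counit :: "'k::field cg \<Rightarrow> 'k cg" where
  "CG_unit_counit p = vscale (lookup p 0) 1"

lemma CG_unit_counit_algebra: "CG_unit_counit \<in> algebra_maps CG CG"
  by (intro algebra_mapsI linear_mapsI)
    (simp_all add: CG_unit_counit_def lookup_add vs.scale_left_distrib lookup_mult_zero vscale_mult_left)

lemma CG_unit_counit_chain: "CG_unit_counit (chain n) = 1 $ n"
  by (simp add: CG_unit_counit_def lookup_chain_zero)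

lemma CG_unit_counit_phantom: "CG_unit_counit phantom = 0"
  by (simp add: CG_unit_counit_def lookup_phantom_zero)

lemma id_CG': "(\<lambda>x. x) \<in> algebra_maps CG CG"
  by (rule algebra_maps_id)

lemma chain_eq_nth: "chain n = chain_fps $ n"
  by (simp add: chain_fps_def)

text \<open>Counit and antipode laws alike become one identity of power series and one of phantom
  values.\<close>

lemma CG_convolution_eqI:
  fixes \<phi> \<psi> \<theta> :: "'k::field cg \<Rightarrow> 'k cg"
  assumes \<phi>: "\<phi> \<in> algebra_maps CG CG" and \<psi>: "\<psi> \<in> algebra_maps CG CG" and \<theta>:
    "\<theta> \<in> algebra_maps CG CG"
    and \<phi>_chain: "\<And>n. \<phi> (chain n) = a $ n" and \<psi>_chain: "\<And>n. \<psi> (chain n) = b $ n"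
    and \<theta>_chain: "\<And>n. \<theta> (chain n) = c $ n"
    and c: "fps_shift_subst (\<psi> phantom) a * b = c" and "\<psi> phantom + \<phi> phantom = \<theta> phantom"
  shows "tensor_lift CG (\<lambda>y z. \<phi> y * \<psi> z) (comult_CG x) = \<theta> x"
  by (rule CG_maps_eqI[OF CG_kalgebra algebra_maps_comp[OF comult_CG_algebra CG_lift_algebra(1)[OF \<phi>
    \<psi>]] \<theta>])
    (simp_all add: convolution_chain[OF \<phi> \<psi> \<phi>_chain \<psi>_chain] convolution_phantom[OF \<phi>
      \<psi>] assms)

lemma CG_bialgebra: "bialgebra (CG :: ('k::field, 'k cg) hopf)"
proof (intro bialgebra.intro bialgebra_axioms.intro)
  show "algebra base_field (CG :: ('k::field, 'k cg) hopf)"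
    using CG_kalgebra by (simp add: kalgebra_def)
  show "comult CG \<in> algebra_maps CG (tensor CG (CG :: ('k::field, 'k cg) hopf))"
    by (simp add: comult_CG_algebra)
  show "counit CG \<in> ring_hom CG (base_field :: 'k ring)"
    by (rule ring_hom_memI) (simp_all add: lookup_add lookup_mult_zero)
  fix x :: "'k cg"
  show "counit CG (c \<odot>\<^bsub>CG\<^esub> x) = c * counit CG x" for c by simp
  show "tensor_assoc CG (tensor_map (tensor CG CG) CG (comult CG) id (comult CG x)) =
      tensor_map CG (tensor CG CG) id (comult CG) (comult CG x)"
    by (simp add: CG_coassoc)
  \<comment> \<open>The counit law reads: convolution with the neutral element is the
    identity.\<close>
  have "tensor_lift CG (\<lambda>y z. CG_unit_counit y * z) (comult_CG x) = x"
    by (rule CG_convolution_eqI[OF CG_unit_counit_algebra id_CG' id_CG' CG_unit_counit_chain chain_eq_nth chain_eq_nth])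
      (simp_all add: CG_unit_counit_phantom)
  then show "tensor_lift CG (\<lambda>y z. counit CG y \<odot>\<^bsub>CG\<^esub> z) (comult CG x) = x"
    by (simp add: CG_unit_counit_def vscale_mult_left)
  have "tensor_lift CG (\<lambda>y z. y * CG_unit_counit z) (comult_CG x) = x"
    by (rule CG_convolution_eqI[OF id_CG' CG_unit_counit_algebra id_CG' chain_eq_nth CG_unit_counit_chain chain_eq_nth])
      (simp_all add: CG_unit_counit_phantom)
  then show "tensor_lift CG (\<lambda>y z. counit CG z \<odot>\<^bsub>CG\<^esub> y) (comult CG x) = x"
    by (simp add: CG_unit_counit_def vscale_mult_left mult.commute[of _ "vscale _ 1"])
qed

lemma CG_is_antipode: "is_antipode CG CG_antipode"
  unfolding is_antipode_def
proof (intro conjI ballI)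
  show "CG_antipode \<in> linear_maps CG CG" by (rule algebra_mapsD(1)[OF CG_antipode_algebra])
  fix x :: "'k::field cg"
  \<comment> \<open>The substitutions with parameters F and -F cancel, leaving C(x) times its
    inverse.\<close>
  have "tensor_lift CG (\<lambda>y z. CG_antipode y * z) (comult_CG x) = CG_unit_counit x"
    by (rule CG_convolution_eqI[OF CG_antipode_algebra id_CG' CG_unit_counit_algebra CG_antipode_chain
      chain_eq_nth CG_unit_counit_chain])
      (simp_all add: CG_unit_counit_phantom CG_antipode_phantom antipode_fps_def fps_shift_subst_subst
        inverse_chain_fps mult.commute[of inverse_chain_fps])
  then show "tensor_lift CG (\<lambda>y z. CG_antipode y \<otimes>\<^bsub>CG\<^esub> z) (comult CG x) = counit
    CG x \<odot>\<^bsub>CG\<^esub> \<one>\<^bsub>CG\<^esub>"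
    by (simp add: CG_unit_counit_def)
  \<comment> \<open>Here both factors undergo the substitution with parameter -F, and it maps the
    product 1 to 1.\<close>
  have "tensor_lift CG (\<lambda>y z. y * CG_antipode z) (comult_CG x) = CG_unit_counit x"
    by (rule CG_convolution_eqI[OF id_CG' CG_antipode_algebra CG_unit_counit_algebra chain_eq_nth
      CG_antipode_chain CG_unit_counit_chain])
      (simp_all add: CG_unit_counit_phantom CG_antipode_phantom antipode_fps_def
        inverse_chain_fps fps_shift_subst_mult[symmetric])
  then show "tensor_lift CG (\<lambda>y z. y \<otimes>\<^bsub>CG\<^esub> CG_antipode z) (comult CG x) = counit
    CG x \<odot>\<^bsub>CG\<^esub> \<one>\<^bsub>CG\<^esub>"
    by (simp add: CG_unit_counit_def)
qed

lemma CG_hopf_algebra: "hopf_algebra (CG :: ('k::field, 'k cg) hopf)"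
  by (intro hopf_algebra.intro hopf_algebra_axioms.intro CG_bialgebra exI[of _ CG_antipode] CG_is_antipode)

lemma antipode_CG: "antipode CG x = CG_antipode x"
  by (rule bialgebra.antipode_eq[OF CG_bialgebra CG_is_antipode]) simp

section \<open>The ideal of phantoms\<close>

text \<open>Induction on the monomial gives a list of positive indices in arbitrary order, which
  commutativity then allows to be sorted into a partition.\<close>

lemma monomial_eq_chains:
  "\<exists>ns. is_partition ns \<and> single u 1 = (chains ns * phantom ^ lookup u 0 :: 'k::field cg)"
proof -
  have "\<exists>ns. 0 \<notin> set ns \<and> single u 1 = (chains ns * phantom ^ lookup u 0 :: 'k cg)"
  proof (induction u rule: poly_mapping_induct_on[OF subset_UNIV])
    case 1
    show ?case by (rule exI[of _ "[]"]) (simp add: chains_def)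
  next
    case (2 i n)
    show ?case
    proof (cases "i = 0")
      case True
      then show ?thesis by (intro exI[of _ "[]"]) (simp add: chains_def phantom_def cg_var_power)
    next
      case False
      have "chains (replicate n i) = (chain i :: 'k cg) ^ n"
        by (induction n) (simp_all add: chains_def)
      then show ?thesis using False
        by (intro exI[of _ "replicate n i"]) (simp add: lookup_single when_def chain_def cg_var_power)
    qed
  next
    case (3 u v)
    then obtain ns ms where "0 \<notin> set ns" "0 \<notin> set ms"
      "single u 1 = (chains ns * phantom ^ lookup u 0 :: 'k cg)"
      "single v 1 = (chains ms * phantom ^ lookup v 0 :: 'k cg)" by blast
    moreover have "single (u + v) 1 = (single u 1 * single v 1 :: 'k cg)"
      by (simp add: mult_single)
    ultimately show ?case
      by (intro exI[of _ "ns @ ms"]) (simp add: chains_def lookup_add power_add mult_ac)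
  qed
  then obtain ns where ns: "0 \<notin> set ns" "single u 1 = (chains ns * phantom ^ lookup u 0 :: 'k cg)"
    by blast
  \<comment> \<open>As a product over a multiset, \<open>chains\<close> is invariant under
    sorting.\<close>
  have c: "chains ms = prod_mset (image_mset chain (mset ms))" for ms :: "nat list"
    by (simp add: chains_def flip: prod_mset_prod_list)
  have "chains (rev (sort ns)) = (chains ns :: 'k cg)" by (simp add: c)
  moreover have "is_partition (rev (sort ns))"
    using ns(1) by (simp add: is_partition_def sorted_wrt_rev)
  ultimately show ?thesis using ns(2) by metis
qed

lemma phantom_multiple_iff:
  fixes p :: "'k::field cg"
  shows "p \<in> range ((*) phantom) \<longleftrightarrow> (\<forall>u\<in>keys p. lookup u 0 > 0)"
proof
  assume "p \<in> range ((*) phantom)"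
  then obtain q where q: "p = phantom * q" by blast
  show "\<forall>u\<in>keys p. lookup u 0 > 0"
  proof
    fix u assume "u \<in> keys p"
    then obtain v where "u = single 0 1 + v"
      using keys_mult[of phantom q] unfolding q by (auto simp: phantom_def cg_var_def split: if_splits)
    then show "lookup u 0 > 0" by (simp add: lookup_add)
  qed
next
  assume "\<forall>u\<in>keys p. lookup u 0 > 0"
  then have "keys p \<subseteq> {u. lookup u 0 > 0}" by blast
  then show "p \<in> range ((*) phantom)"
  proof (induction p rule: poly_mapping_induct_on)
    case zero
    then show ?case by (intro image_eqI[of _ _ 0]) auto
  next
    case (single u c)
    have "u = single 0 1 + (u - single 0 1)"
      using single by (auto intro!: poly_mapping_eqI simp: lookup_add lookup_minus lookup_single when_def)
    then have "single u c = (phantom * single (u - single 0 1) c :: 'k cg)"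
      by (simp add: phantom_def cg_var_def mult_single)
    then show ?case by blast
  next
    case (add p q)
    then obtain p' q' where "p = phantom * p'" "q = phantom * q'" by blast
    then have "p + q = phantom * (p' + q')" by (simp add: distrib_left)
    then show ?case by blast
  qed
qed

text \<open>Each spanning monomial contains F, and conversely each monomial containing F is a
  spanning one. In the form of a principal ideal, all closure properties reduce to the behaviour of
  F.\<close>

lemma phantom_ideal_eq: "phantom_ideal = (range ((*) phantom) :: 'k::field cg set)"
proof
  have sub: "vs.subspace (range ((*) phantom) :: 'k cg set)"
  proof (rule vs.subspaceI)
    show "0 \<in> (range ((*) phantom) :: 'k cg set)" by (intro image_eqI[of _ _ 0]) auto
    fix p q :: "'k cg" and c assume "p \<in> range ((*) phantom)"
    then obtain p' where p: "p = phantom * p'" by blast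
    have "vscale c p = phantom * vscale c p'"
      by (simp add: p mult.commute[of phantom] vscale_mult_left)
    then show "vscale c p \<in> range ((*) phantom)" by blast
    assume "q \<in> range ((*) phantom)"
    then obtain q' where "q = phantom * q'" by blast
    then have "p + q = phantom * (p' + q')" by (simp add: p distrib_left)
    then show "p + q \<in> range ((*) phantom)" by blast
  qed
  show "phantom_ideal \<subseteq> (range ((*) phantom) :: 'k cg set)"
    unfolding phantom_ideal_def
  proof (rule vs.span_minimal[OF _ sub], clarify)
    fix ns :: "nat list" and n :: nat assume "n > 0"
    then have "chains ns * phantom ^ n = phantom * (chains ns * phantom ^ (n - 1) :: 'k cg)"
      by (cases n) (simp_all add: mult_ac)
    then show "chains ns * phantom ^ n \<in> (range ((*) phantom) :: 'k cg set)" by blast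
  qed
  show "(range ((*) phantom) :: 'k cg set) \<subseteq> phantom_ideal"
  proof
    fix p :: "'k cg" assume "p \<in> range ((*) phantom)"
    then have "keys p \<subseteq> {u. lookup u 0 > 0}"
      by (auto simp: phantom_multiple_iff)
    then show "p \<in> phantom_ideal"
    proof (induction p rule: poly_mapping_induct_on)
      case zero
      then show ?case by (simp add: phantom_ideal_def vs.span_zero)
    next
      case (single u c)
      obtain ns where ns: "is_partition ns" "single u 1 = (chains ns * phantom ^ lookup u 0 :: 'k cg)"
        using monomial_eq_chains by blast
      have "single u 1 \<in> (phantom_ideal :: 'k cg set)"
        unfolding phantom_ideal_def using ns single by (intro vs.span_base) auto
      then have "vscale c (single u 1) \<in> (phantom_ideal :: 'k cg set)"
        unfolding phantom_ideal_def by (rule vs.span_scale)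
      then show ?case by simp
    next
      case (add p q)
      then show ?case by (simp add: phantom_ideal_def vs.span_add)
    qed
  qed
qed

lemma phantom_ideal_iff:
  "p \<in> phantom_ideal \<longleftrightarrow> (\<forall>u\<in>keys p. lookup u 0 > 0)"
  by (simp add: phantom_ideal_eq phantom_multiple_iff)

lemma CG_minus: "\<ominus>\<^bsub>CG\<^esub> x = - x"
  by (rule CG.M.minus_equality) simp_all

lemma phantom_ideal_ideal: "ideal phantom_ideal (CG :: ('k::field, 'k cg) hopf)"
proof (rule idealI)
  show "ring (CG :: ('k::field, 'k cg) hopf)" by (rule cring.axioms(1)[OF CG_cring])
  show "subgroup phantom_ideal (add_monoid (CG :: ('k::field, 'k cg) hopf))"
  proof (rule CG.M.add.subgroupI)
    fix p assume "p \<in> (phantom_ideal :: 'k cg set)"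
    then show "\<ominus>\<^bsub>CG\<^esub> p \<in> phantom_ideal"
      by (simp add: CG_minus phantom_ideal_def vs.span_neg)
  next
    fix p q assume "p \<in> (phantom_ideal :: 'k cg set)" "q \<in> (phantom_ideal :: 'k cg set)"
    then show "p \<oplus>\<^bsub>CG\<^esub> q \<in> phantom_ideal" by (simp add: phantom_ideal_def vs.span_add)
  qed (auto simp: phantom_ideal_eq)
  fix a x assume "a \<in> (phantom_ideal :: 'k cg set)"
  then obtain q where "a = phantom * q" by (auto simp: phantom_ideal_eq)
  then have "x * a = phantom * (x * q)" "a * x = phantom * (x * q)" by (simp_all add: mult_ac)
  then show "x \<otimes>\<^bsub>CG\<^esub> a \<in> phantom_ideal" "a \<otimes>\<^bsub>CG\<^esub> x \<in> phantom_ideal"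
    by (auto simp: phantom_ideal_eq)
qed

text \<open>F is primitive, so the coproduct of F q is F \<otimes> 1 times that of q plus 1
  \<otimes> F times that of q, one summand for each side of the coideal condition.\<close>

lemma comult_phantom_ideal:
  "comult_CG ` phantom_ideal \<subseteq>
     tensor_subspace CG CG phantom_ideal UNIV <+>\<^bsub>tensor CG (CG :: ('k::field, 'k cg) hopf)\<^esub>
     tensor_subspace CG CG UNIV phantom_ideal"
proof
  fix t assume "t \<in> comult_CG ` (phantom_ideal :: 'k cg set)"
  then obtain q :: "'k cg" where q: "t = comult_CG (phantom * q)" by (auto simp: phantom_ideal_eq)
  \<comment> \<open>A representative is chosen because \<open>tensor_subspace\<close> is described
    by the support of representatives.\<close>
  obtain r where r: "comult_CG q = tensor_null CG CG +>\<^bsub>free_pairs CG CG\<^esub> r"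
    using comult_CG_simps(1)[of q] by (auto simp: CC.carrier_T)
  let ?l = "single (phantom, 1) 1 \<otimes>\<^bsub>free_pairs CG CG\<^esub> r"
    and ?r = "single (1, phantom) 1 \<otimes>\<^bsub>free_pairs CG CG\<^esub> r"
  have rc: "r \<in> carrier (free_pairs CG CG)" by simp
  have sc: "single s 1 \<in> carrier (free_pairs CG CG)" for s :: "'k cg \<times> 'k cg" by simp
  have "t = (pure_tensor CG CG 1 phantom \<oplus>\<^bsub>tensor CG CG\<^esub> pure_tensor CG CG phantom 1)
    \<otimes>\<^bsub>tensor CG CG\<^esub> comult_CG q"
    unfolding q by (simp add: comult_CG_simps comult_CG_phantom)
  also have "\<dots> = pure_tensor CG CG phantom 1 \<otimes>\<^bsub>tensor CG CG\<^esub> comult_CG q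
      \<oplus>\<^bsub>tensor CG CG\<^esub> pure_tensor CG CG 1 phantom \<otimes>\<^bsub>tensor CG CG\<^esub>
        comult_CG q"
    by (simp add: CC.T.l_distr comult_CG_simps CC.T.a_comm)
  also have "\<dots> = (tensor_null CG CG +>\<^bsub>free_pairs CG CG\<^esub> ?l) \<oplus>\<^bsub>tensor CG CG\<^esub>
      (tensor_null CG CG +>\<^bsub>free_pairs CG CG\<^esub> ?r)"
    unfolding r pure_tensor_def CC.coset_mult[OF sc rc] ..
  finally have t: "t = (tensor_null CG CG +>\<^bsub>free_pairs CG CG\<^esub> ?l) \<oplus>\<^bsub>tensor CG CG\<^esub>
      (tensor_null CG CG +>\<^bsub>free_pairs CG CG\<^esub> ?r)" .
  have p: "phantom * x \<in> phantom_ideal" for x :: "'k cg"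
    unfolding phantom_ideal_eq by (rule rangeI)
  \<comment> \<open>Multiplying on representatives multiplies every left, respectively right, entry
    by F.\<close>
  have kl: "keys ?l \<subseteq> phantom_ideal \<times> UNIV" and kr: "keys ?r \<subseteq> UNIV \<times> phantom_ideal"
    by (subst free_pairs_mult_superset[OF _ order_refl _ order_refl]; simp;
        force dest!: subsetD[OF keys_sum] simp: p split: if_splits)+
  show "t \<in> tensor_subspace CG CG phantom_ideal UNIV <+>\<^bsub>tensor CG CG\<^esub> tensor_subspace CG CG
    UNIV phantom_ideal"
    unfolding t set_add_def' tensor_subspace_def using kl kr by blast
qed

lemma phantom_hopf_ideal: "hopf_ideal (CG :: ('k::field, 'k cg) hopf) phantom_ideal"
proof (intro hopf_ideal.intro hopf_ideal_axioms.intro)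
  show "hopf_algebra (CG :: ('k::field, 'k cg) hopf)" by (rule CG_hopf_algebra)
  show "ideal phantom_ideal (CG :: ('k::field, 'k cg) hopf)" by (rule phantom_ideal_ideal)
  show "submodule phantom_ideal base_field (CG :: ('k::field, 'k cg) hopf)"
    by (intro submodule.intro submodule_axioms.intro)
      (use additive_subgroup.a_subgroup[OF ideal.axioms(1)[OF phantom_ideal_ideal]] in
        \<open>auto simp: phantom_ideal_def vs.span_scale\<close>)
  show "comult CG ` phantom_ideal \<subseteq> tensor_subspace CG CG phantom_ideal (carrier CG)
    <+>\<^bsub>tensor CG (CG :: ('k, 'k cg) hopf)\<^esub>
      tensor_subspace CG CG (carrier CG) phantom_ideal"
    using comult_phantom_ideal by simp
  show "counit CG ` phantom_ideal \<subseteq> {0 :: 'k}"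
    by (auto simp: phantom_ideal_eq lookup_mult_zero lookup_phantom_zero)
  show "antipode CG ` phantom_ideal \<subseteq> (phantom_ideal :: 'k cg set)"
  proof
    fix x assume "x \<in> antipode CG ` (phantom_ideal :: 'k cg set)"
    then obtain q where "x = CG_antipode (phantom * q)" by (auto simp: phantom_ideal_eq antipode_CG)
    then have "x = phantom * (- CG_antipode q)" by (simp add: CG_antipode_simps CG_antipode_phantom)
    then show "x \<in> phantom_ideal" unfolding phantom_ideal_eq by blast
  qed
qed

end

section \<open>The algebra of symmetric functions\<close>

lemma lookup_map_key: "inj \<sigma> \<Longrightarrow> lookup (map_key \<sigma> u) i = lookup u (\<sigma> i)"
  by (simp add: map_key.rep_eq)

lemma map_key_inverse:
  assumes "bij \<sigma>"
  shows "map_key \<sigma> (map_key (inv_into UNIV \<sigma>) u) = u"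
    and "map_key (inv_into UNIV \<sigma>) (map_key \<sigma> u) = u"
  using assms bij_imp_bij_inv[OF assms]
  by (auto intro!: poly_mapping_eqI simp: lookup_map_key bij_is_inj bij_is_surj surj_f_inv_f)

abbreviation mon_splits :: "(nat \<Rightarrow>\<^sub>0 nat) \<Rightarrow> ((nat \<Rightarrow>\<^sub>0 nat)
  \<times> (nat \<Rightarrow>\<^sub>0 nat)) set" where
  "mon_splits u \<equiv> {(v, w). v + w = u}"

text \<open>Sums over infinite sets are zero by convention, so products of series make sense only by
  this fact. A splitting is determined by exponents on the support of \<open>u\<close>, each bounded
  by that of \<open>u\<close>.\<close>

lemma finite_mon_splits [simp]: "finite (mon_splits u)"
proof -
  let ?K = "keys u"
  define r where "r v = restrict (lookup v) ?K" for v :: "nat \<Rightarrow>\<^sub>0 nat"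
  have "inj_on (\<lambda>(v, w). (r v, r w)) (mon_splits u)"
  proof (rule inj_onI, clarify)
    fix v w v' w' assume vw: "u = v + w" "v' + w' = v + w" and eq: "r v = r v'" "r w = r w'"
    have out: "lookup v i = 0 \<and> lookup w i = 0 \<and> lookup v' i = 0 \<and>
        lookup w' i = 0" if "i \<notin> ?K" for i
    proof -
      have "lookup (v + w) i = 0" "lookup (v' + w') i = 0"
        using that vw by (auto simp: in_keys_iff)
      then show ?thesis by (simp add: lookup_add)
    qed
    have i: "lookup v i = lookup v' i" "lookup w i = lookup w' i"
      if "i \<in> ?K" for i
      using fun_cong[OF eq(1), of i] fun_cong[OF eq(2), of i] that by (simp_all add: r_def)
    show "v = v' \<and> w = w'" using i out by (metis poly_mapping_eqI)
  qed
  moreover have "(\<lambda>(v, w). (r v, r w)) ` mon_splits u \<subseteq>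
      (\<Pi>\<^sub>E i\<in>?K. {..lookup u i}) \<times> (\<Pi>\<^sub>E i\<in>?K. {..lookup u i})"
    by (auto simp: r_def lookup_add)
  moreover have "finite ((\<Pi>\<^sub>E i\<in>?K. {..lookup u i}) \<times> (\<Pi>\<^sub>E i\<in>?K. {..lookup u i}))"
    by (intro finite_cartesian_product finite_PiE) auto
  ultimately show ?thesis by (metis inj_on_finite)
qed

lemma finite_mon_splits' [simp]: "finite {p. fst p + snd p = (u :: nat \<Rightarrow>\<^sub>0 nat)}"
  using finite_mon_splits[of u] by (simp add: split_def)

lemma mon_degree_superset:
  "finite S \<Longrightarrow> keys u \<subseteq> S \<Longrightarrow> mon_degree u = (\<Sum>i\<in>S. lookup u i)"
  unfolding mon_degree_def by (rule sum.mono_neutral_left) (auto simp: in_keys_iff)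

lemma mon_degree_add [simp]: "mon_degree (u + v) = mon_degree u + mon_degree v"
proof -
  let ?S = "keys u \<union> keys v"
  show ?thesis
    using keys_add[of u v] by (subst (1 2 3) mon_degree_superset[of ?S]) (auto simp: lookup_add sum.distrib)
qed

lemma mon_degree_0 [simp]: "mon_degree 0 = 0"
  by (simp add: mon_degree_def)

lemma mon_degree_eq_0_iff [simp]: "mon_degree u = 0 \<longleftrightarrow> u = 0"
  by (auto simp: mon_degree_def in_keys_iff intro!: poly_mapping_eqI)

lemma mon_degree_single [simp]: "mon_degree (single i n) = n"
  by (simp add: mon_degree_def)

lemma mon_degree_map_key: "bij \<sigma> \<Longrightarrow> mon_degree (map_key \<sigma> u) = mon_degree u"
  unfolding mon_degree_def
  by (rule sum.reindex_bij_witness[of _ "inv_into UNIV \<sigma>" \<sigma>])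
    (auto simp: lookup_map_key in_keys_iff bij_is_inj bij_is_surj surj_f_inv_f)

section \<open>Multiplication of formal series\<close>

definition series_mult :: "'k::comm_ring_1 mpseries \<Rightarrow> 'k mpseries \<Rightarrow> 'k mpseries" where
  "series_mult f g u = (\<Sum>(v, w)\<in>mon_splits u. f v * g w)"

lemma series_mult_comm: "series_mult f g = series_mult g f"
  by (rule ext, unfold series_mult_def,
      rule sum.reindex_bij_witness[of _ "\<lambda>(v, w). (w, v)" "\<lambda>(v, w). (w, v)"])
    (auto simp: add.commute mult.commute)

text \<open>Both sides sum over the triples v + w + x = u, bracketed in the two possible
  ways.\<close>

lemma series_mult_assoc: "series_mult (series_mult f g) h = series_mult f (series_mult g h)"
proof
  fix u
  have "series_mult (series_mult f g) h u =
      (\<Sum>(vw, x)\<in>mon_splits u. \<Sum>(v, w)\<in>mon_splits vw. f v * g w * h x)"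
    unfolding series_mult_def by (auto simp: sum_distrib_right intro!: sum.cong)
  also have "\<dots> = (\<Sum>((vw, x), (v, w))\<in>Sigma (mon_splits u) (\<lambda>(vw, x). mon_splits vw). f v
    * g w * h x)"
    by (subst sum.Sigma[symmetric]) (auto simp: split_def)
  also have "\<dots> = (\<Sum>((v, wx), (w, x))\<in>Sigma (mon_splits u) (\<lambda>(v, wx). mon_splits wx). f v
    * (g w * h x))"
    by (rule sum.reindex_bij_witness[of _ "\<lambda>((v, wx), (w, x)). ((v + w, x), (v, w))"
          "\<lambda>((vw, x), (v, w)). ((v, w + x), (w, x))"]) (auto simp: ac_simps)
  also have "\<dots> = (\<Sum>(v, wx)\<in>mon_splits u. \<Sum>(w, x)\<in>mon_splits wx. f v * (g w * h x))"
    by (subst sum.Sigma[symmetric]) (auto simp: split_def)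
  also have "\<dots> = series_mult f (series_mult g h) u"
    unfolding series_mult_def by (auto simp: sum_distrib_left intro!: sum.cong)
  finally show "series_mult (series_mult f g) h u = series_mult f (series_mult g h) u" .
qed

lemma series_mult_one: "series_mult (\<lambda>u. if u = 0 then 1 else 0) f = f"
proof
  fix u
  have "series_mult (\<lambda>u. if u = 0 then 1 else 0) f u =
      (\<Sum>(v, w)\<in>{(0 :: nat \<Rightarrow>\<^sub>0 nat, u)}. (if v = 0 then 1 else 0) * f w)"
    unfolding series_mult_def by (rule sum.mono_neutral_right) (auto split: if_splits)
  then show "series_mult (\<lambda>u. if u = 0 then 1 else 0) f u = f u" by simp
qed

lemma series_mult_nonzeroE:
  assumes "series_mult f g u \<noteq> 0"
  obtains v w where "u = v + w" "f v \<noteq> 0" "g w \<noteq> 0"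
proof -
  from assms obtain p where "p \<in> mon_splits u" "(case p of (v, w) \<Rightarrow> f v * g w) \<noteq> 0"
    unfolding series_mult_def by (rule sum.not_neutral_contains_not_neutral)
  then have "u = fst p + snd p" "f (fst p) * g (snd p) \<noteq> 0" by auto
  moreover from this(2) have "f (fst p) \<noteq> 0" "g (snd p) \<noteq> 0"
    by (metis mult_zero_left, metis mult_zero_right)
  ultimately show ?thesis by (intro that)
qed

text \<open>A permutation of the variables maps the factorizations of \<open>u\<close> bijectively
  to those of the permuted monomial.\<close>

lemma series_mult_map_key:
  assumes \<sigma>: "bij \<sigma>" and f: "\<And>u. f (map_key \<sigma> u) = f u"
    and g: "\<And>u. g (map_key \<sigma> u) = g u"
  shows "series_mult f g (map_key \<sigma> u) = series_mult f g u"
  unfolding series_mult_def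
  by (rule sum.reindex_bij_witness[of _ "\<lambda>(v, w). (map_key \<sigma> v, map_key \<sigma> w)"
        "\<lambda>(v, w). (map_key (inv_into UNIV \<sigma>) v, map_key (inv_into UNIV \<sigma>) w)"])
    (use f g bij_imp_bij_inv[OF \<sigma>] in \<open>auto simp: map_key_inverse[OF \<sigma>]
      map_key_plus[symmetric] bij_is_inj[OF \<sigma>] bij_is_inj\<close>,
     (metis f g map_key_inverse(1)[OF \<sigma>])+)

section \<open>The commutative algebra of symmetric functions\<close>

lemma Sym_carrier: "carrier Sym = {f. (\<forall>\<sigma> u. bij \<sigma> \<longrightarrow> f (map_key \<sigma>
  u) = f u) \<and>
    (\<exists>d. \<forall>u. f u \<noteq> 0 \<longrightarrow> mon_degree u \<le> d)}"
  by (simp add: Sym_def Sym_algebra_def module.extend_def hopf.defs)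

lemma Sym_sel [simp]:
  "f \<otimes>\<^bsub>Sym\<^esub> g = series_mult f g" "\<one>\<^bsub>Sym\<^esub> = (\<lambda>u. if u = 0 then
    1 else 0)" "\<zero>\<^bsub>Sym\<^esub> = (\<lambda>u. 0)"
  "f \<oplus>\<^bsub>Sym\<^esub> g = (\<lambda>u. f u + g u)" "c \<odot>\<^bsub>Sym\<^esub> f = (\<lambda>u. c
    * f u)" "comult Sym = comult_Sym"
  "counit Sym f = f 0"
  by (simp_all add: Sym_def Sym_algebra_def module.extend_def hopf.defs series_mult_def fun_eq_iff)

lemma SymI:
  assumes "\<And>\<sigma> u. bij \<sigma> \<Longrightarrow> f (map_key \<sigma> u) = f u"
    and "\<And>u. f u \<noteq> 0 \<Longrightarrow> mon_degree u \<le> d"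
  shows "f \<in> carrier Sym"
  using assms unfolding Sym_carrier by blast

lemma Sym_symmetric: "f \<in> carrier Sym \<Longrightarrow> bij \<sigma> \<Longrightarrow> f (map_key \<sigma> u) = f u"
  by (simp add: Sym_carrier)

lemma Sym_degree_bound: "f \<in> carrier Sym \<Longrightarrow> \<exists>d. \<forall>u. f u \<noteq> 0
  \<longrightarrow> mon_degree u \<le> d"
  unfolding Sym_carrier by blast

lemma Sym_add_closed: "f \<in> carrier Sym \<Longrightarrow> g \<in> carrier Sym \<Longrightarrow> (\<lambda>u.
  f u + g u) \<in> carrier Sym"
proof -
  assume f: "f \<in> carrier Sym" and g: "g \<in> carrier Sym"
  obtain d where d: "\<And>u. f u \<noteq> 0 \<Longrightarrow> mon_degree u \<le> d" using Sym_degree_bound[OF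
    f] by blast
  obtain e where e: "\<And>u. g u \<noteq> 0 \<Longrightarrow> mon_degree u \<le> e" using Sym_degree_bound[OF
    g] by blast
  show ?thesis
  proof (rule SymI[of _ "max d e"])
    fix u assume "f u + g u \<noteq> 0"
    then have "f u \<noteq> 0 \<or> g u \<noteq> 0" by auto
    then show "mon_degree u \<le> max d e" using d[of u] e[of u] by auto
  qed (simp add: Sym_symmetric[OF f] Sym_symmetric[OF g])
qed

lemma Sym_smult_closed: "f \<in> carrier Sym \<Longrightarrow> (\<lambda>u. c * f u) \<in> carrier Sym"
proof -
  assume f: "f \<in> carrier Sym"
  obtain d where d: "\<And>u. f u \<noteq> 0 \<Longrightarrow> mon_degree u \<le> d" using Sym_degree_bound[OF
    f] by blast
  show ?thesis
  proof (rule SymI[of _ d])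
    fix u assume "c * f u \<noteq> 0"
    then show "mon_degree u \<le> d" using d[of u] by auto
  qed (simp add: Sym_symmetric[OF f])
qed

lemma Sym_mult_closed: "f \<in> carrier Sym \<Longrightarrow> g \<in> carrier Sym \<Longrightarrow> series_mult
  f g \<in> carrier Sym"
proof -
  assume f: "f \<in> carrier Sym" and g: "g \<in> carrier Sym"
  obtain d where d: "\<And>u. f u \<noteq> 0 \<Longrightarrow> mon_degree u \<le> d" using Sym_degree_bound[OF
    f] by blast
  obtain e where e: "\<And>u. g u \<noteq> 0 \<Longrightarrow> mon_degree u \<le> e" using Sym_degree_bound[OF
    g] by blast
  show ?thesis
  proof (rule SymI[of _ "d + e"])
    fix u assume "series_mult f g u \<noteq> 0"
    then obtain v w where "u = v + w" "f v \<noteq> 0" "g w \<noteq> 0" by (rule series_mult_nonzeroE)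
    then show "mon_degree u \<le> d + e" using d[of v] e[of w] by simp
  qed (simp add: series_mult_map_key Sym_symmetric[OF f] Sym_symmetric[OF g])
qed

lemma map_key_eq_0_iff: "bij \<sigma> \<Longrightarrow> map_key \<sigma> u = 0 \<longleftrightarrow> u = 0"
  for u :: "nat \<Rightarrow>\<^sub>0 nat" and \<sigma> :: "nat \<Rightarrow> nat"
  by (simp only: mon_degree_eq_0_iff[symmetric] mon_degree_map_key)

lemma Sym_one_closed: "(\<lambda>u. if u = 0 then 1 else 0) \<in> carrier Sym"
  by (rule SymI[of _ 0]) (auto simp: map_key_eq_0_iff split: if_splits)

lemma series_mult_add_left: "series_mult (\<lambda>u. f u + g u) h = (\<lambda>u. series_mult f h u +
  series_mult g h u)"
  by (rule ext) (simp add: series_mult_def distrib_right split_def sum.distrib)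

lemma series_mult_smult_left: "series_mult (\<lambda>u. c * f u) h = (\<lambda>u. c * series_mult f h u)"
  by (rule ext) (simp add: series_mult_def sum_distrib_left split_def mult.assoc)

lemma Sym_cring: "cring (Sym :: ('k::field, 'k mpseries) hopf)"
proof (intro cringI abelian_groupI comm_monoidI)
  fix f assume f: "f \<in> carrier (Sym :: ('k, 'k mpseries) hopf)"
  show "\<exists>g\<in>carrier Sym. g \<oplus>\<^bsub>Sym\<^esub> f = \<zero>\<^bsub>Sym\<^esub>"
    by (rule bexI[OF _ Sym_smult_closed[OF f, of "-1"]]) simp
next
  show "\<zero>\<^bsub>Sym\<^esub> \<in> carrier (Sym :: ('k, 'k mpseries) hopf)"
    by (simp add: Sym_carrier)
qed (simp_all add: Sym_add_closed Sym_mult_closed Sym_one_closed series_mult_assoc series_mult_one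
    series_mult_add_left fun_eq_iff add.assoc add.commute, simp add: series_mult_comm)

lemma Sym_kalgebra: "kalgebra (Sym :: ('k::field, 'k mpseries) hopf)"
  by (rule kalgebraI[OF Sym_cring])
    (auto simp: Sym_smult_closed series_mult_smult_left algebra_simps)

interpretation Sym: kalgebra "Sym :: ('k::field, 'k mpseries) hopf" by (rule Sym_kalgebra)

lemma Sym_finsum_apply:
  "finite S \<Longrightarrow> f \<in> S \<rightarrow> carrier Sym \<Longrightarrow> finsum Sym f S u =
    (\<Sum>s\<in>S. f s u)"
  by (induction S rule: finite_induct) auto

section \<open>Complete homogeneous and elementary symmetric functions\<close>

definition elementary :: "nat \<Rightarrow> 'k::field mpseries" where
  "elementary n u = (if mon_degree u = n \<and> (\<forall>i. lookup u i \<le> 1) then 1 else 0)"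

lemma complete_homogeneous_closed [simp]: "complete_homogeneous n \<in> carrier Sym"
  by (rule SymI[of _ n]) (auto simp: complete_homogeneous_def mon_degree_map_key split: if_splits)

lemma elementary_closed [simp]: "elementary n \<in> carrier Sym"
proof (rule SymI[of _ n])
  fix \<sigma> :: "nat \<Rightarrow> nat" and u :: "nat \<Rightarrow>\<^sub>0 nat" assume \<sigma>: "bij \<sigma>"
  have "(\<forall>i. lookup u (\<sigma> i) \<le> 1) \<longleftrightarrow> (\<forall>i. lookup u i \<le> 1)"
    using bij_is_surj[OF \<sigma>] by (metis surjD)
  then show "elementary n (map_key \<sigma> u) = (elementary n u :: 'a)"
    using \<sigma> by (simp add: elementary_def mon_degree_map_key lookup_map_key bij_is_inj)
qed (auto simp: elementary_def split: if_splits)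

lemma complete_homogeneous_0: "complete_homogeneous 0 = \<one>\<^bsub>Sym\<^esub>"
  by (rule ext) (simp add: complete_homogeneous_def)

lemma elementary_0: "elementary 0 = \<one>\<^bsub>Sym\<^esub>"
  by (rule ext) (auto simp: elementary_def)

text \<open>
  Toggling the exponent of a fixed variable of \<open>u\<close> is a sign-reversing involution on the
  factorizations \<open>u = v w\<close> with \<open>v\<close> squarefree.
\<close>

lemma squarefree_sign_sum:
  assumes "u \<noteq> 0"
  shows "(\<Sum>(v, w)\<in>mon_splits u. if \<forall>i. lookup v i \<le> 1 then (- 1) ^ mon_degree v else (0 ::
    'k::field)) = 0"
proof -
  obtain k where k: "lookup u k \<noteq> 0" using assms by (metis poly_mapping_eqI lookup_zero)
  let ?sq = "\<lambda>v. \<forall>i. lookup v i \<le> 1"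
  let ?P = "\<lambda>n. {(v, w). v + w = u \<and> ?sq v \<and> lookup v k = n}"
  have fin: "finite (?P n)" for n by (rule finite_subset[OF _ finite_mon_splits[of u]]) auto
  have 01: "?P 0 \<union> ?P 1 = {(v, w). v + w = u \<and> ?sq v}" by (auto simp: le_Suc_eq)
  have "(\<Sum>(v, w)\<in>mon_splits u. if ?sq v then (- 1) ^ mon_degree v else (0 :: 'k)) =
      (\<Sum>(v, w)\<in>?P 0 \<union> ?P 1. (- 1) ^ mon_degree v)"
    unfolding 01 by (rule sum.mono_neutral_cong_right) (auto split: if_splits)
  also have "\<dots> = (\<Sum>(v, w)\<in>?P 0. (- 1) ^ mon_degree v) + (\<Sum>(v, w)\<in>?P 1. (- 1) ^ mon_degree v)"
    by (rule sum.union_disjoint) (auto simp: fin[simplified])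
  also have "(\<Sum>(v, w)\<in>?P 1. (- 1) ^ mon_degree v) = (\<Sum>(v, w)\<in>?P 0. - ((- 1) ^ mon_degree v :: 'k))"
  proof (rule sum.reindex_bij_witness[of _ "\<lambda>(v, w). (v + single k 1, w - single k 1)"
        "\<lambda>(v, w). (v - single k 1, w + single k 1)"])
    fix p assume "p \<in> ?P 1"
    then obtain v w where p: "p = (v, w)" "v + w = u" "?sq v" "lookup v k = 1" by auto
    \<comment> \<open>The truncated subtraction is genuine because \<open>k\<close> has exponent 1
      in \<open>v\<close>.\<close>
    have v: "v - single k 1 + single k 1 = v"
      using p by (auto intro!: poly_mapping_eqI simp: lookup_add lookup_minus lookup_single when_def)
    then show "(case case p of (v, w) \<Rightarrow> (v - single k 1, w + single k 1) of
       (v, w) \<Rightarrow> (v + single k 1, w - single k 1)) = p"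
      by (simp add: p)
    have "v - single k 1 + (w + single k 1) = u"
      using v p(2) by (metis add.assoc add.commute)
    then show "(case p of (v, w) \<Rightarrow> (v - single k 1, w + single k 1)) \<in> ?P 0"
      using p by (auto simp: lookup_minus lookup_single when_def intro: le_diff_conv[THEN iffD2] le_SucI)
    have "mon_degree v = Suc (mon_degree (v - single k 1))"
      using arg_cong[OF v, of mon_degree] by simp
    then show "(case case p of (v, w) \<Rightarrow> (v - single k 1, w + single k 1) of
         (v, w) \<Rightarrow> - ((- 1) ^ mon_degree v)) = (case p of (v, w) \<Rightarrow> (- 1 :: 'k) ^ mon_degree v)"
      by (simp add: p)
  next
    fix p assume "p \<in> ?P 0"
    then obtain v w where p: "p = (v, w)" "v + w = u" "?sq v" "lookup v k = 0" by auto
    have "lookup w k \<noteq> 0" using k p(2,4) by (auto simp: lookup_add)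
    then have w: "single k 1 + (w - single k 1) = w"
      by (auto intro!: poly_mapping_eqI simp: lookup_add lookup_minus lookup_single when_def)
    then show "(case case p of (v, w) \<Rightarrow> (v + single k 1, w - single k 1) of
       (v, w) \<Rightarrow> (v - single k 1, w + single k 1)) = p"
      by (simp add: p add.commute)
    have "v + single k 1 + (w - single k 1) = u"
      using w p(2) by (simp add: add.assoc)
    then show "(case p of (v, w) \<Rightarrow> (v + single k 1, w - single k 1)) \<in> ?P 1"
      using p by (auto simp: lookup_add lookup_single when_def)
  qed
  finally show ?thesis by (simp add: split_def sum_negf)
qed

text \<open>For a fixed factorization u = v w only i = deg v contributes, which leaves the signed
  count in \<open>squarefree_sign_sum\<close>. This is the relation E(-x) H(x) = 1 linking the two
  families.\<close>

lemma elementary_complete_homogeneous: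
  assumes "n > 0"
  shows "(\<Sum>i=0..n. (- 1) ^ i * series_mult (elementary i) (complete_homogeneous (n - i)) u) = (0 :: 'k::field)"
proof -
  let ?sq = "\<lambda>v. \<forall>i. lookup v i \<le> 1"
  have "(\<Sum>i=0..n. (- 1) ^ i * series_mult (elementary i) (complete_homogeneous (n - i)) u) =
      (\<Sum>(v, w)\<in>mon_splits u. \<Sum>i=0..n. (- 1) ^ i * (elementary i v * complete_homogeneous (n - i)
        w :: 'k))"
    unfolding series_mult_def sum_distrib_left by (subst sum.swap) (simp add: split_def)
  also have "\<dots> = (\<Sum>(v, w)\<in>mon_splits u. if mon_degree u = n \<and> ?sq v then (- 1) ^ mon_degree
    v else 0)"
  proof (rule sum.cong[OF refl], clarify)
    fix v w assume "u = v + w"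
    have "(\<Sum>i=0..n. (- 1) ^ i * (elementary i v * complete_homogeneous (n - i) w :: 'k)) =
        (\<Sum>i=0..n. if i = mon_degree v then (if mon_degree (v + w) = n \<and> ?sq v then (- 1) ^ mon_degree
          v else 0) else 0)"
      by (rule sum.cong) (auto simp: elementary_def complete_homogeneous_def)
    also have "\<dots> = (if mon_degree (v + w) = n \<and> ?sq v then (- 1) ^ mon_degree v else 0)"
      by (subst sum.delta) auto
    finally show "(\<Sum>i=0..n. (- 1) ^ i * (elementary i v * complete_homogeneous (n - i) w :: 'k)) =
      (if mon_degree (v + w) = n \<and> ?sq v then (- 1) ^ mon_degree v else 0)" .
  qed
  also have "\<dots> = 0"
  proof (cases "mon_degree u = n")
    case True
    then have "u \<noteq> 0" using assms by auto
    then show ?thesis using squarefree_sign_sum[of u] True by simp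
  qed (simp add: split_def)
  finally show ?thesis .
qed

section \<open>Leading monomials\<close>

text \<open>Exponent functions are ordered lexicographically, variable 0 first. Requiring
  coefficient 1 makes leading monomials multiplicative.\<close>

definition leading :: "'k::comm_ring_1 mpseries \<Rightarrow> (nat \<Rightarrow>\<^sub>0 nat) \<Rightarrow> bool" where
  "leading f u \<longleftrightarrow> f u = 1 \<and> (\<forall>w>u. f w = 0)"

text \<open>The order is compatible with addition: a factorization of u + v other than (u, v), or
  any factorization of something larger, has a factor beyond \<open>u\<close> or beyond
  \<open>v\<close>.\<close>

lemma leading_mult:
  assumes "leading f u" "leading g v"
  shows "leading (series_mult f g) (u + v)"
proof -
  have f: "f u = 1" "\<And>w. u < w \<Longrightarrow> f w = 0" and g: "g v = 1" "\<And>w. v < w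
    \<Longrightarrow> g w = 0"
    using assms by (auto simp: leading_def)
  have "series_mult f g (u + v) = (\<Sum>(a, b)\<in>{(u, v)}. f a * g b)"
    unfolding series_mult_def
  proof (rule sum.mono_neutral_right)
    show "\<forall>i\<in>mon_splits (u + v) - {(u, v)}. (case i of (a, b) \<Rightarrow> f a * g b) = 0"
    proof
      fix p assume "p \<in> mon_splits (u + v) - {(u, v)}"
      then obtain a b where p: "p = (a, b)" and ab: "a + b = u + v" "(a, b) \<noteq> (u, v)" by auto
      have "a \<noteq> u" using ab by auto
      then consider "u < a" | "a < u" by (meson linorder_neqE)
      then show "(case p of (a, b) \<Rightarrow> f a * g b) = 0"
      proof cases
        case 2
        then have "v < b" using ab(1) add_less_le_mono[of a u b v] by (metis not_le order_less_irrefl)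
        then show ?thesis by (simp add: g p)
      qed (simp add: f p)
    qed
  qed auto
  moreover have "series_mult f g w = 0" if "u + v < w" for w
    unfolding series_mult_def
  proof (rule sum.neutral, clarify)
    fix a b assume w: "w = a + b"
    have "u < a \<or> v < b" using that add_mono[of a u b v] unfolding w by (metis not_le)
    then show "f a * g b = 0" by (auto simp: f g)
  qed
  ultimately show ?thesis using f g by (simp add: leading_def)
qed

lemma leading_one: "leading (\<lambda>u. if u = 0 then 1 else 0) 0"
  by (simp add: leading_def)

text \<open>The monomial x_0 ... x_{n-1}, the lexicographically largest squarefree one of degree
  n.\<close>

definition initial_mon :: "nat \<Rightarrow> (nat \<Rightarrow>\<^sub>0 nat)" where
  "initial_mon n = (\<Sum>i<n. single i 1)"

lemma lookup_initial_mon: "lookup (initial_mon n) i = (if i < n then 1 else 0)"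
  by (simp add: initial_mon_def lookup_sum lookup_single when_def)

lemma mon_degree_initial_mon: "mon_degree (initial_mon n) = n"
proof -
  have "mon_degree (initial_mon n) = (\<Sum>i<n. lookup (initial_mon n) i)"
    by (rule mon_degree_superset) (auto simp: in_keys_iff lookup_initial_mon split: if_splits)
  then show ?thesis by (simp add: lookup_initial_mon)
qed

lemma poly_mapping_less_ex:
  fixes u w :: "nat \<Rightarrow>\<^sub>0 nat"
  assumes "u < w"
  shows "\<exists>k. lookup u k < lookup w k \<and>
    (\<forall>i<k. lookup u i = lookup w i)"
  using assms by (auto simp: less_poly_mapping.rep_eq less_fun_def)

text \<open>A larger squarefree monomial must contain all of the first n variables and, at the first
  difference, one more; its degree then exceeds n.\<close>

lemma leading_elementary: "leading (elementary n :: 'k::field mpseries) (initial_mon n)"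
proof -
  have "elementary n w = (0 :: 'k)" if less: "initial_mon n < w" for w
  proof (rule ccontr)
    assume "elementary n w \<noteq> (0 :: 'k)"
    then have w: "mon_degree w = n" "\<And>i. lookup w i \<le> 1"
      by (auto simp: elementary_def split: if_splits)
    obtain k where k: "lookup (initial_mon n) k < lookup w k"
      "\<And>i. i < k \<Longrightarrow> lookup (initial_mon n) i = lookup w i"
      using poly_mapping_less_ex[OF less] by blast
    have nk: "n \<le> k" using k(1) w(2)[of k] by (auto simp: lookup_initial_mon split: if_splits)
    have "lookup w i = 1" if "i < n" for i
      using k(2)[of i] nk that by (simp add: lookup_initial_mon)
    then have "lookup w i \<ge> 1" if "i \<in> insert k {..<n}" for i
      using k(1) that by auto
    note ge = this
    have "Suc n = (\<Sum>i\<in>insert k {..<n}. 1)" using nk by simp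
    also have "\<dots> \<le> (\<Sum>i\<in>insert k {..<n}. lookup w i)"
      by (intro sum_mono ge)
    also have "\<dots> \<le> (\<Sum>i\<in>insert k {..<n} \<union> keys w. lookup w i)"
      by (rule sum_mono2) auto
    also have "\<dots> = n" using w(1) by (subst mon_degree_superset[symmetric]) auto
    finally show False by simp
  qed
  moreover have "elementary n (initial_mon n) = (1 :: 'k)"
    by (simp add: elementary_def mon_degree_initial_mon lookup_initial_mon)
  ultimately show ?thesis by (simp add: leading_def)
qed

definition mon_scale :: "nat \<Rightarrow> (nat \<Rightarrow>\<^sub>0 nat) \<Rightarrow> (nat
  \<Rightarrow>\<^sub>0 nat)" where
  "mon_scale n = Poly_Mapping.map ((*) n)"

lemma lookup_mon_scale [simp]: "lookup (mon_scale n u) i = n * lookup u i"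
  by (simp add: mon_scale_def map.rep_eq when_def)

text \<open>Variable 0 is the phantom, whose image is zero so that evaluation factors through the
  quotient.\<close>

definition elementary_gens :: "nat \<Rightarrow> 'k::field mpseries" where
  "elementary_gens i = (if i = 0 then \<zero>\<^bsub>Sym\<^esub> else elementary i)"

lemma elementary_gens_closed: "elementary_gens \<in> UNIV \<rightarrow> carrier Sym"
  using Sym.M.zero_closed by (auto simp: elementary_gens_def simp del: Sym_sel)

text \<open>The leading monomial of \<open>\<Prod>i. e\<^sub>i ^ v i\<close>: it is the conjugate of the partition
  with \<open>v i\<close> parts equal to \<open>i\<close>.\<close>

definition lead_mon :: "(nat \<Rightarrow>\<^sub>0 nat) \<Rightarrow> (nat \<Rightarrow>\<^sub>0 nat)" where
  "lead_mon v = (\<Sum>i\<in>keys v. mon_scale (lookup v i) (initial_mon i))"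

lemma lead_mon_superset:
  "finite S \<Longrightarrow> keys v \<subseteq> S \<Longrightarrow>
    lead_mon v = (\<Sum>i\<in>S. mon_scale (lookup v i) (initial_mon i))"
  unfolding lead_mon_def by (rule sum.mono_neutral_left) (auto simp: in_keys_iff intro!: poly_mapping_eqI)

lemma mon_scale_add: "mon_scale (m + n) u = mon_scale m u + mon_scale n u"
  by (rule poly_mapping_eqI) (simp add: lookup_add distrib_right)

lemma lead_mon_add: "lead_mon (u + v) = lead_mon u + lead_mon v"
proof -
  let ?S = "keys u \<union> keys v"
  show ?thesis
    using keys_add[of u v] by (subst (1 2 3) lead_mon_superset[of ?S])
      (auto simp: lookup_add sum.distrib mon_scale_add)
qed

lemma lead_mon_0 [simp]: "lead_mon 0 = 0"
  by (simp add: lead_mon_def)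

lemma lead_mon_single: "lead_mon (single i n) = mon_scale n (initial_mon i)"
  by (subst lead_mon_superset[of "{i}"]) auto

text \<open>The exponent of x_j is the sum of the \<open>lookup v i\<close> with i > j. Consecutive
  differences therefore recover \<open>v\<close>, which gives both injectivity and
  surjectivity.\<close>

lemma lookup_lead_mon: "lookup (lead_mon v) j =
    lookup v (Suc j) + lookup (lead_mon v) (Suc j)"
proof -
  let ?S = "insert (Suc j) (keys v)"
  have *: "lookup (lead_mon v) k = (\<Sum>i\<in>?S. if k < i then lookup v i else 0)" for k
    by (subst lead_mon_superset[of ?S]) (auto simp: lookup_sum lookup_initial_mon intro!: sum.cong)
  have "(\<Sum>i\<in>?S. if j < i then lookup v i else 0) =
      (\<Sum>i\<in>?S. (if i = Suc j then lookup v i else 0) + (if Suc j < i then lookup v i else 0))"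
    by (rule sum.cong) auto
  also have "\<dots> = lookup v (Suc j) + (\<Sum>i\<in>?S. if Suc j < i then lookup v i else 0)"
    by (simp add: sum.distrib sum.delta del: sum.insert_if sum.insert)
  finally show ?thesis unfolding * .
qed

text \<open>Positive indices are recovered as differences. The monomial \<open>initial_mon 0\<close>
  is trivial, so the exponent of variable 0 is invisible and has to be fixed.\<close>

lemma lead_mon_inject:
  assumes "lead_mon u = lead_mon v" "lookup u 0 = 0" "lookup v 0 = 0"
  shows "u = v"
proof (rule poly_mapping_eqI)
  fix i show "lookup u i = lookup v i"
  proof (cases i)
    case (Suc j)
    then show ?thesis using lookup_lead_mon[of u j] lookup_lead_mon[of v j] assms(1) by simp
  qed (use assms in simp)
qed

definition decreasing :: "(nat \<Rightarrow>\<^sub>0 nat) \<Rightarrow> bool" where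
  "decreasing w \<longleftrightarrow> (\<forall>i. lookup w (Suc i) \<le> lookup w i)"

lemma eventually_zero: "\<exists>N. \<forall>i\<ge>N. lookup (w :: nat \<Rightarrow>\<^sub>0 nat) i = 0"
proof (intro exI allI impI)
  fix i assume "Suc (Max (insert 0 (keys w))) \<le> i"
  moreover have "i \<le> Max (insert 0 (keys w))" if "i \<in> keys w"
    by (rule Max_ge) (use that in auto)
  ultimately have "i \<notin> keys w" by linarith
  then show "lookup w i = 0" by (simp add: in_keys_iff)
qed

text \<open>Take as multiplicity of j + 1 the drop of \<open>w\<close> from j to j + 1; a decreasing
  sequence makes the truncated subtraction genuine.\<close>

lemma lead_mon_surj:
  assumes "decreasing w"
  shows "\<exists>v. lookup v 0 = 0 \<and> lead_mon v = w"
proof -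
  obtain N where N: "\<And>i. i \<ge> N \<Longrightarrow> lookup w i = 0" using eventually_zero[of w] by blast
  define g where "g i = (case i of 0 \<Rightarrow> 0 | Suc j \<Rightarrow> lookup w j - lookup w (Suc j))" for i
  have gS: "g (Suc j) = lookup w j - lookup w (Suc j)" for j
    by (simp add: g_def)
  have gz: "g i = 0" if "\<not> i \<le> N" for i
    using that N[of "i - 1"] by (cases i) (simp_all add: g_def)
  have "{i. g i \<noteq> 0} \<subseteq> {..N}"
  proof
    fix i assume "i \<in> {i. g i \<noteq> 0}"
    then show "i \<in> {..N}" using gz[of i] by (cases "i \<le> N") simp_all
  qed
  then have "finite {i. g i \<noteq> 0}" by (rule finite_subset) simp
  then have g: "lookup (Abs_poly_mapping g) i = g i" for i by simp
  let ?v = "Abs_poly_mapping g"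
  obtain M where M: "\<And>i. i \<ge> M \<Longrightarrow> lookup (lead_mon ?v) i = 0" using eventually_zero[of
    "lead_mon ?v"] by blast
  have "lookup (lead_mon ?v) i = lookup w i" for i
  proof (cases "i \<le> max M N")
    case True
    then show ?thesis
    \<comment> \<open>Downward induction from a bound at which both exponents vanish.\<close>
    proof (induction i rule: inc_induct)
      case base
      show ?case using M[of "max M N"] N[of "max M N"] by simp
    next
      case (step i)
      then show ?case using lookup_lead_mon[of ?v i] assms
        by (simp add: g gS decreasing_def)
    qed
  qed (use M[of i] N[of i] in simp)
  then have "lead_mon ?v = w" by (rule poly_mapping_eqI)
  moreover have "lookup ?v 0 = 0" by (simp add: g g_def)
  ultimately show ?thesis by blast
qed

lemma leading_mon_eval:
  assumes "lookup v 0 = 0"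
  shows "leading (mon_eval Sym elementary_gens v :: 'k::field mpseries) (lead_mon v)"
proof -
  have "keys v \<subseteq> {0<..}" using assms by (auto simp: in_keys_iff intro: gr0I)
  then show ?thesis
  proof (induction v rule: poly_mapping_induct_on)
    case zero
    show ?case using leading_one by simp
  next
    case (single i n)
    have "leading (elementary i [^]\<^bsub>Sym\<^esub> n :: 'k mpseries) (mon_scale n (initial_mon i))"
    proof (induction n)
      case 0
      have "mon_scale 0 (initial_mon i) = 0" by (rule poly_mapping_eqI) simp
      then show ?case using leading_one by simp
    next
      case (Suc n)
      have "mon_scale (Suc n) (initial_mon i) = mon_scale n (initial_mon i) + initial_mon i"
        by (rule poly_mapping_eqI) (simp add: lookup_add)
      then show ?case using leading_mult[OF Suc leading_elementary] by simp
    qed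
    moreover have "elementary_gens i = (elementary i :: 'k mpseries)"
      using single by (simp add: elementary_gens_def)
    ultimately show ?case
      by (simp add: Sym.mon_eval_single[OF elementary_gens_closed] lead_mon_single)
  next
    case (add u v)
    then show ?case
      using leading_mult[of "mon_eval Sym elementary_gens u" _ "mon_eval Sym elementary_gens v"]
      by (simp add: Sym.mon_eval_add[OF elementary_gens_closed] lead_mon_add)
  qed
qed

definition homogeneous :: "'k::comm_ring_1 mpseries \<Rightarrow> bool" where
  "homogeneous f \<longleftrightarrow> (\<exists>d. \<forall>u. f u \<noteq> 0 \<longrightarrow> mon_degree u = d)"

lemma homogeneous_mult: "homogeneous f \<Longrightarrow> homogeneous g \<Longrightarrow> homogeneous (series_mult f g)"
proof -
  assume "homogeneous f" "homogeneous g"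
  then obtain d e where de: "\<And>u. f u \<noteq> 0 \<Longrightarrow> mon_degree u = d" "\<And>u. g u \<noteq>
    0 \<Longrightarrow> mon_degree u = e"
    unfolding homogeneous_def by blast
  have "mon_degree u = d + e" if nz: "series_mult f g u \<noteq> 0" for u
  proof -
    obtain v w where "u = v + w" "f v \<noteq> 0" "g w \<noteq> 0" using nz by (rule series_mult_nonzeroE) blast
    then show ?thesis using de(1)[of v] de(2)[of w] by simp
  qed
  then show ?thesis unfolding homogeneous_def by blast
qed

lemma homogeneous_mon_eval: "homogeneous (mon_eval Sym elementary_gens v :: 'k::field mpseries)"
proof (induction v rule: poly_mapping_induct_on[OF subset_UNIV])
  case 1
  show ?case by (simp add: homogeneous_def)
next
  case (2 i n)
  have g: "homogeneous (elementary_gens i :: 'k mpseries)"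
    by (auto simp: homogeneous_def elementary_gens_def elementary_def)
  have "homogeneous (elementary_gens i [^]\<^bsub>Sym\<^esub> n :: 'k mpseries)"
  proof (induction n)
    case 0
    show ?case by (simp add: homogeneous_def)
  next
    case (Suc n)
    then show ?case using homogeneous_mult[OF Suc g] by simp
  qed
  then show ?case by (simp add: Sym.mon_eval_single[OF elementary_gens_closed])
next
  case (3 u v)
  then show ?case
    using homogeneous_mult[of "mon_eval Sym elementary_gens u" "mon_eval Sym elementary_gens v"]
    by (simp add: Sym.mon_eval_add[OF elementary_gens_closed])
qed

text \<open>Homogeneity gives the whole support the degree of the leading monomial. This preserves
  degree bounds when leading terms are subtracted.\<close>

lemma degree_mon_eval:
  assumes "lookup v 0 = 0" "(mon_eval Sym elementary_gens v :: 'k::field mpseries) u \<noteq> 0"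
  shows "mon_degree u = mon_degree (lead_mon v)"
  using homogeneous_mon_eval[of v, where 'k = 'k] leading_mon_eval[OF assms(1), where 'k = 'k] assms(2)
  unfolding homogeneous_def leading_def by (metis zero_neq_one)

abbreviation elementary_eval :: "'k::field cg \<Rightarrow> 'k mpseries" where
  "elementary_eval \<equiv> poly_eval Sym elementary_gens"

lemma elementary_eval_apply:
  "elementary_eval p u = (\<Sum>v\<in>keys p. lookup p v * mon_eval Sym elementary_gens v u)"
  unfolding poly_eval_def lext_def
  by (subst Sym_finsum_apply) (auto simp: Sym_smult_closed Sym.mon_eval_closed[OF elementary_gens_closed])

text \<open>Algebraic independence of the e_n: phantom-free monomials have distinct leading
  monomials, so the largest one among them cannot cancel.\<close>

lemma elementary_eval_inject:
  fixes p :: "'k::field cg"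
  assumes "\<And>u. u \<in> keys p \<Longrightarrow> lookup u 0 = 0" "p \<noteq> 0"
  shows "elementary_eval p \<noteq> \<zero>\<^bsub>Sym\<^esub>"
proof -
  let ?K = "keys p"
  have ne: "?K \<noteq> {}" using assms(2) by (metis keys_eq_empty)
  then have "Max (lead_mon ` ?K) \<in> lead_mon ` ?K" by (intro Max_in) auto
  then obtain v where v: "v \<in> ?K" "lead_mon v = Max (lead_mon ` ?K)" by auto
  have less: "lead_mon u < lead_mon v" if "u \<in> ?K" "u \<noteq> v" for u
  proof -
    have "lead_mon u \<le> lead_mon v" unfolding v(2) using that by simp
    moreover have "lead_mon u \<noteq> lead_mon v" using lead_mon_inject[OF _ assms(1)[OF that(1)] assms(1)[OF
      v(1)]] that(2) by metis
    ultimately show ?thesis by simp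
  qed
  have "elementary_eval p (lead_mon v) = (\<Sum>u\<in>{v}. lookup p u * mon_eval Sym elementary_gens u (lead_mon v))"
    unfolding elementary_eval_apply
  proof (rule sum.mono_neutral_right)
    show "\<forall>u\<in>?K - {v}. lookup p u * mon_eval Sym elementary_gens u (lead_mon v) = 0"
      using leading_mon_eval[OF assms(1), where 'k = 'k] less by (auto simp: leading_def)
  qed (use v in auto)
  also have "\<dots> = lookup p v"
    using leading_mon_eval[OF assms(1)[OF v(1)], where 'k = 'k] by (simp add: leading_def)
  also have "\<dots> \<noteq> 0" using v(1) by (simp add: in_keys_iff)
  finally show ?thesis by auto
qed

section \<open>Elementary symmetric functions generate\<close>

text \<open>Sort an initial segment of exponents beyond which all vanish and fix the other
  variables. By symmetry, the coefficients at decreasing monomials thus determine a symmetric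
  function.\<close>

lemma decreasing_rearrangement: "\<exists>\<sigma>. bij \<sigma> \<and> decreasing (map_key \<sigma> u)"
  for u :: "nat \<Rightarrow>\<^sub>0 nat"
proof -
  obtain N where N: "\<And>i. i \<ge> N \<Longrightarrow> lookup u i = 0" using eventually_zero[of u] by blast
  define xs where "xs = map (lookup u) [0..<N]"
  define ys where "ys = rev (sort xs)"
  have "mset ys = mset xs" by (simp add: ys_def)
  then obtain \<sigma> where \<sigma>: "\<sigma> permutes {..<length xs}" "permute_list \<sigma> xs = ys"
    by (rule mset_eq_permutation)
  have len: "length xs = N" "length ys = N" by (simp_all add: xs_def ys_def)
  have lk: "lookup u (\<sigma> i) = (if i < N then ys ! i else 0)" for i
  proof (cases "i < N")
    case True
    then have "\<sigma> i < N" using permutes_in_image[OF \<sigma>(1)] len by simp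
    then show ?thesis using True permute_list_nth[OF \<sigma>(1), of i] \<sigma>(2) len by (simp add: xs_def)
  next
    case False
    then have "\<sigma> i = i" using permutes_not_in[OF \<sigma>(1), of i] len by simp
    then show ?thesis using False N by simp
  qed
  have bij: "bij \<sigma>" by (rule permutes_bij[OF \<sigma>(1)])
  have "sorted_wrt (\<ge>) ys" by (simp add: ys_def sorted_wrt_rev)
  then have "ys ! Suc i \<le> ys ! i" if "Suc i < N" for i
    using that len by (simp add: sorted_wrt_iff_nth_less)
  then have "decreasing (map_key \<sigma> u)"
    using bij by (auto simp: decreasing_def lookup_map_key bij_is_inj lk)
  then show ?thesis using bij by blast
qed

text \<open>A decreasing monomial involving variable i involves all earlier ones, so its degree is
  at least i + 1. Bounded degree thus bounds both support and exponents.\<close>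

lemma finite_decreasing: "finite {w. decreasing w \<and> mon_degree w \<le> d}"
proof -
  define r where "r w = restrict (lookup w) {..d}" for w :: "nat \<Rightarrow>\<^sub>0 nat"
  have z: "lookup w i = 0" if "decreasing w" "mon_degree w \<le> d" "i > d" for w i
  proof (rule ccontr)
    assume nz: "lookup w i \<noteq> 0"
    have mono: "antimono (lookup w)"
      using \<open>decreasing w\<close> unfolding decreasing_def decseq_Suc_iff .
    have ge: "Suc 0 \<le> lookup w j" if "j \<le> i" for j
      using antimonoD[OF mono \<open>j \<le> i\<close>] nz by simp
    have "Suc i = (\<Sum>j\<le>i. 1)" by simp
    also have "\<dots> \<le> (\<Sum>j\<le>i. lookup w j)" by (intro sum_mono) (simp add: ge)
    also have "\<dots> \<le> (\<Sum>j\<in>{..i} \<union> keys w. lookup w j)"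
      by (rule sum_mono2) auto
    also have "\<dots> = mon_degree w" by (subst mon_degree_superset[symmetric]) auto
    finally show False using that by simp
  qed
  have "inj_on r {w. decreasing w \<and> mon_degree w \<le> d}"
  proof (rule inj_onI, rule poly_mapping_eqI)
    fix u w i assume *: "u \<in> {w. decreasing w \<and> mon_degree w \<le> d}" "w \<in> {w. decreasing w
      \<and> mon_degree w \<le> d}" "r u = r w"
    show "lookup u i = lookup w i"
    proof (cases "i \<le> d")
      case True
      then show ?thesis using fun_cong[OF *(3), of i] by (simp add: r_def)
    qed (use * z in simp)
  qed
  moreover have le: "lookup w i \<le> mon_degree w" for w :: "nat \<Rightarrow>\<^sub>0 nat" and i
  proof -
    have "lookup w i \<le> (\<Sum>j\<in>insert i (keys w). lookup w j)"
      by (rule member_le_sum) auto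
    also have "\<dots> = mon_degree w" by (subst mon_degree_superset[symmetric]) auto
    finally show ?thesis .
  qed
  have "r ` {w. decreasing w \<and> mon_degree w \<le> d} \<subseteq> (\<Pi>\<^sub>E i\<in>{..d}. {..d})"
  proof (rule image_subsetI)
    fix w assume "w \<in> {w. decreasing w \<and> mon_degree w \<le> d}"
    then have "lookup w i \<le> d" for i using le[of w i] by simp
    then show "r w \<in> (\<Pi>\<^sub>E i\<in>{..d}. {..d})" unfolding r_def restrict_PiE_iff by simp
  qed
  moreover have "finite (\<Pi>\<^sub>E i\<in>{..d}. {..d::nat})" by (intro finite_PiE) auto
  ultimately show ?thesis by (rule inj_on_finite)
qed

text \<open>The largest decreasing monomial in the support is the leading monomial of a product of
  e_n; subtracting a multiple of that product removes it, and the process ends.\<close>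

lemma elementary_eval_surj:
  fixes f :: "'k::field mpseries"
  assumes "f \<in> carrier Sym"
  shows "f \<in> range elementary_eval"
proof -
  note E = linear_mapsD[OF Sym.poly_eval_linear[OF elementary_gens_closed], simplified]
  obtain d where d: "\<And>u. f u \<noteq> 0 \<Longrightarrow> mon_degree u \<le> d" using Sym_degree_bound[OF
    assms] by blast
  let ?P = "{w. decreasing w \<and> mon_degree w \<le> d}"
  \<comment> \<open>A subtraction may create smaller monomials, so the measure counts everything
    below the support instead of the support itself.\<close>
  let ?M = "\<lambda>f. {w\<in>?P. \<exists>w'\<in>?P. w \<le> w' \<and> f w' \<noteq> 0}"
  have fin: "finite (?M f)" for f :: "'k mpseries" by (rule finite_subset[OF _ finite_decreasing[of d]]) auto
  from assms d show ?thesis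
  proof (induction "card (?M f)" arbitrary: f rule: less_induct)
    case less
    let ?A = "{w\<in>?P. f w \<noteq> 0}"
    have finA: "finite ?A" by (rule finite_subset[OF _ finite_decreasing[of d]]) auto
    show ?case
    proof (cases "?A = {}")
      case True
      \<comment> \<open>Any monomial in the support could be rearranged into a decreasing one, by
        symmetry of \<open>f\<close>.\<close>
      have "f u = 0" for u
      proof (rule ccontr)
        assume nz: "f u \<noteq> 0"
        obtain \<sigma> where \<sigma>: "bij \<sigma>" "decreasing (map_key \<sigma> u)"
          using decreasing_rearrangement by blast
        have "f (map_key \<sigma> u) = f u" by (rule Sym_symmetric[OF less.prems(1) \<sigma>(1)])
        then show False using True \<sigma> nz less.prems(2)[of "map_key \<sigma> u"] by auto
      qed
      then have "f = elementary_eval 0" by (auto simp: elementary_eval_apply)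
      then show ?thesis by blast
    next
      case False
      define w where "w = Max ?A"
      have w: "w \<in> ?A" unfolding w_def using finA False by (rule Max_in)
      have wmax: "w' \<le> w" if "w' \<in> ?A" for w' unfolding w_def using finA that by (rule Max_ge)
      obtain v where v: "lookup v 0 = 0" "lead_mon v = w"
        using lead_mon_surj[of w] w by blast
      let ?e = "mon_eval Sym elementary_gens v :: 'k mpseries"
      have ew: "?e w = 1" "\<And>w'. w < w' \<Longrightarrow> ?e w' = 0"
        using leading_mon_eval[OF v(1), where 'k = 'k] v(2) by (auto simp: leading_def)
      define f' where "f' u = f u + - f w * ?e u" for u
      have ec: "?e \<in> carrier Sym" by (rule Sym.mon_eval_closed[OF elementary_gens_closed])
      have f': "f' \<in> carrier Sym" unfolding f'_def
        by (intro Sym_add_closed[OF less.prems(1)] Sym_smult_closed ec)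
      have degf': "mon_degree u \<le> d" if "f' u \<noteq> 0" for u
      proof -
        have "f u \<noteq> 0 \<or> ?e u \<noteq> 0" using that by (auto simp: f'_def)
        then show ?thesis
        proof
          assume "?e u \<noteq> 0"
          then have "mon_degree u = mon_degree w" using degree_mon_eval[OF v(1), of u] v(2) by metis
          then show ?thesis using w by simp
        qed (rule less.prems(2))
      qed
      \<comment> \<open>The terms at \<open>w\<close> cancel, and beyond \<open>w\<close> neither
        series has a decreasing monomial of degree at most \<open>d\<close> in its support.\<close>
      have lt: "w' < w" if "w' \<in> ?P" "f' w' \<noteq> 0" for w'
      proof (rule ccontr)
        assume "\<not> w' < w"
        then have "w' = w \<or> w < w'" by auto
        moreover have "f w' = 0" if "w < w'" using wmax[of w'] \<open>w' \<in> ?P\<close> that by (auto simp: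
          not_less[symmetric])
        ultimately show False using \<open>f' w' \<noteq> 0\<close> ew by (auto simp: f'_def)
      qed
      have "?M f' \<subseteq> ?M f" using lt w by (auto intro: order_trans less_imp_le)
      moreover have "w \<in> ?M f" using w by auto
      moreover have "w \<notin> ?M f'" using lt by (auto simp: not_less[symmetric] dest!: lt)
      ultimately have "?M f' \<subset> ?M f" by blast
      then have "card (?M f') < card (?M f)" by (rule psubset_card_mono[OF fin])
      from less.hyps[OF this f' degf'] obtain p where p: "f' = elementary_eval p" by blast
      have "elementary_eval (p + single v (f w)) = (\<lambda>u. elementary_eval p u + f w * ?e u)"
        using E(2)[of p "single v (f w)"] Sym.poly_eval_single[OF elementary_gens_closed, of v "f w"] by simp
      also have "\<dots> = f" unfolding p[symmetric] by (auto simp: f'_def)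
      finally show ?thesis by (metis rangeI)
    qed
  qed
qed

section \<open>Evaluation at complete homogeneous symmetric functions\<close>

definition homogeneous_gens :: "nat \<Rightarrow> 'k::field mpseries" where
  "homogeneous_gens i = (if i = 0 then \<zero>\<^bsub>Sym\<^esub> else complete_homogeneous i)"

lemma homogeneous_gens_closed: "homogeneous_gens \<in> UNIV \<rightarrow> carrier Sym"
  using Sym.M.zero_closed by (auto simp: homogeneous_gens_def simp del: Sym_sel)

abbreviation homogeneous_eval :: "'k::field cg \<Rightarrow> 'k mpseries" where
  "homogeneous_eval \<equiv> poly_eval Sym homogeneous_gens"

lemma homogeneous_eval_algebra: "homogeneous_eval \<in> algebra_maps CG Sym"
  by (rule Sym.poly_eval_algebra[OF homogeneous_gens_closed])

lemma elementary_eval_algebra: "elementary_eval \<in> algebra_maps CG Sym"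
  by (rule Sym.poly_eval_algebra[OF elementary_gens_closed])

lemma homogeneous_eval_phantom: "homogeneous_eval phantom = \<zero>\<^bsub>Sym\<^esub>"
  unfolding phantom_def Sym.poly_eval_var[OF homogeneous_gens_closed] by (simp add: homogeneous_gens_def)

lemma elementary_eval_phantom: "elementary_eval phantom = \<zero>\<^bsub>Sym\<^esub>"
  unfolding phantom_def Sym.poly_eval_var[OF elementary_gens_closed] by (simp add: elementary_gens_def)

lemma homogeneous_eval_chain: "homogeneous_eval (chain n) = complete_homogeneous n"
proof (cases "n = 0")
  case True
  then show ?thesis using algebra_mapsD(6)[OF homogeneous_eval_algebra]
    by (simp add: complete_homogeneous_0)
next
  case False
  then show ?thesis unfolding chain_nonzero[OF False] Sym.poly_eval_var[OF homogeneous_gens_closed]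
    by (simp add: homogeneous_gens_def)
qed

lemma elementary_eval_chain: "elementary_eval (chain n) = elementary n"
proof (cases "n = 0")
  case True
  then show ?thesis using algebra_mapsD(6)[OF elementary_eval_algebra]
    by (simp add: elementary_0)
next
  case False
  then show ?thesis unfolding chain_nonzero[OF False] Sym.poly_eval_var[OF elementary_gens_closed]
    by (simp add: elementary_gens_def)
qed

text \<open>
  The involution of the polynomial ring that exchanges the \<open>e\<^sub>n\<close> and the
    \<open>h\<^sub>n\<close>; in generating
  functions it maps \<open>c(x)\<close> to \<open>1 / c(- x)\<close>.
\<close>

definition fps_alternate :: "'a::comm_ring_1 fps \<Rightarrow> 'a fps" where
  "fps_alternate a = Abs_fps (\<lambda>n. (- 1) ^ n * a $ n)"

lemma fps_alternate_mult: "fps_alternate (a * b) = fps_alternate a * fps_alternate b"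
proof (rule fps_ext)
  fix n
  have "(- 1 :: 'a) ^ n = (- 1) ^ i * (- 1) ^ (n - i)" if "i \<in> {0..n}" for i
    using that by (simp flip: power_add)
  then show "fps_alternate (a * b) $ n = (fps_alternate a * fps_alternate b) $ n"
    by (auto simp: fps_alternate_def fps_mult_nth sum_distrib_left mult_ac intro!: sum.cong)
qed

lemma fps_alternate_1 [simp]: "fps_alternate 1 = 1"
  by (rule fps_ext) (simp add: fps_alternate_def)

lemma fps_alternate_alternate [simp]: "fps_alternate (fps_alternate a) = a"
  by (rule fps_ext) (simp add: fps_alternate_def mult.assoc[symmetric] power_mult_distrib[symmetric])

definition omega_fps :: "'k::field cg fps" where
  "omega_fps = fps_alternate inverse_chain_fps"

lemma omega_fps: "fps_alternate chain_fps * omega_fps = 1"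
  by (simp add: omega_fps_def inverse_chain_fps fps_alternate_mult[symmetric])

lemma omega_fps_0: "omega_fps $ 0 = 1"
  by (simp add: omega_fps_def fps_alternate_def inverse_chain_fps_0)

definition CG_omega :: "'k::field cg \<Rightarrow> 'k cg" where
  "CG_omega = poly_eval CG (\<lambda>i. if i = 0 then phantom else omega_fps $ i)"

lemma CG_omega_algebra: "CG_omega \<in> algebra_maps CG CG"
  unfolding CG_omega_def by (rule CG.poly_eval_algebra) simp

lemmas CG_omega_simps = algebra_mapsD(2-6)[OF CG_omega_algebra, simplified]

lemma CG_omega_phantom: "CG_omega phantom = phantom"
  unfolding CG_omega_def by (subst (2) phantom_def) (subst CG.poly_eval_var, simp_all)

lemma CG_omega_chain: "CG_omega (chain n) = omega_fps $ n"
proof (cases "n = 0")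
  case True
  then show ?thesis by (simp add: CG_omega_simps omega_fps_0)
next
  case False
  then show ?thesis
    unfolding CG_omega_def chain_nonzero[OF False] by (subst CG.poly_eval_var) simp_all
qed

lemma CG_omega_sum: "CG_omega (sum g S) = (\<Sum>s\<in>S. CG_omega (g s))"
  using linear_maps_finsum[OF CG_kalgebra CG_kalgebra algebra_mapsD(1)[OF CG_omega_algebra], of g S] by simp

lemma CG_omega_0 [simp]: "CG_omega 0 = 0"
  using linear_maps_zero[OF CG_kalgebra CG_kalgebra algebra_mapsD(1)[OF CG_omega_algebra]] by simp

lemma CG_omega_minus: "CG_omega (- p) = - CG_omega p"
  using CG_omega_simps(2)[of "- p" p] by (simp add: eq_neg_iff_add_eq_0)

lemma CG_omega_minus_one_power: "CG_omega ((- 1) ^ n) = (- 1) ^ n"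
  by (induction n) (simp_all add: CG_omega_simps CG_omega_minus)

text \<open>Applying the map to the coefficients of C(-x) W(x) = 1, where W is the image series, and
  changing x to -x in that relation exhibit two inverses of W(-x): the image of W and C itself. They
  are equal.\<close>

lemma CG_omega_omega: "CG_omega (CG_omega p) = p"
proof (rule CG_maps_eqI[OF CG_kalgebra algebra_maps_comp[OF CG_omega_algebra CG_omega_algebra] algebra_maps_id])
  show "CG_omega (CG_omega phantom) = (phantom :: 'a cg)" by (simp add: CG_omega_phantom)
  fix n
  let ?W = "Abs_fps (\<lambda>n. CG_omega (omega_fps $ n)) :: 'a cg fps"
  have "fps_alternate omega_fps * ?W = 1"
  proof (rule fps_ext)
    fix n
    have "(fps_alternate omega_fps * ?W) $ n = CG_omega ((fps_alternate chain_fps * omega_fps) $ n)"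
      by (simp add: fps_mult_nth fps_alternate_def CG_omega_sum CG_omega_simps CG_omega_minus_one_power
          chain_eq_nth[symmetric] CG_omega_chain)
    also have "\<dots> = 1 $ n" by (simp add: omega_fps CG_omega_simps)
    finally show "(fps_alternate omega_fps * ?W) $ n = 1 $ n" .
  qed
  moreover have "fps_alternate omega_fps * chain_fps = (1 :: 'a cg fps)"
    using arg_cong[OF omega_fps, of fps_alternate] by (simp add: fps_alternate_mult mult.commute)
  moreover have "chain_fps * (fps_alternate omega_fps * ?W) = ?W * (fps_alternate omega_fps * chain_fps)"
    by (simp only: mult_ac)
  ultimately have "?W = chain_fps" by simp
  then have "?W $ n = chain_fps $ n" by simp
  then show "CG_omega (CG_omega (chain n)) = (chain n :: 'a cg)"
    by (simp add: CG_omega_chain chain_fps_def)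
qed

text \<open>The h_n and the evaluated coefficients of \<open>omega_fps\<close> satisfy the same
  recursion with signed e_i as coefficients, and both start with 1.\<close>

lemma homogeneous_eval_eq: "homogeneous_eval p = elementary_eval (CG_omega p)"
proof (rule CG_maps_eqI[OF Sym_kalgebra homogeneous_eval_algebra
      algebra_maps_comp[OF CG_omega_algebra elementary_eval_algebra]])
  show "homogeneous_eval phantom = (elementary_eval (CG_omega phantom) :: 'a mpseries)"
    by (simp only: CG_omega_phantom homogeneous_eval_phantom elementary_eval_phantom)
  fix n
  note E = algebra_mapsD[OF elementary_eval_algebra, simplified]
  have "complete_homogeneous n = (elementary_eval (omega_fps $ n) :: 'a mpseries)"
  proof (induction n rule: less_induct)
    case (less n)
    show ?case
    proof (cases "n = 0")
      case True
      then show ?thesis by (simp add: complete_homogeneous_0 omega_fps_0 E)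
    next
      case False
      \<comment> \<open>Signs in the polynomial ring are rewritten as scalars, through which the
        linear evaluation passes.\<close>
      have sg: "(- 1) ^ i = (single 0 ((- 1) ^ i) :: 'a cg)" for i :: nat
        by (induction i) (simp_all add: mult_single[of 0 _ 0, simplified, symmetric] single_uminus)
      have vs: "(- 1) ^ i * p = vscale ((- 1) ^ i) p" for i and p :: "'a cg"
        by (simp add: sg vscale_def mult_map_scale_conv_mult)
      have "elementary_eval ((fps_alternate chain_fps * omega_fps) $ n :: 'a cg) =
          (\<Oplus>\<^bsub>Sym\<^esub>i\<in>{0..n}. elementary_eval (vscale ((- 1) ^ i) (chain i * omega_fps $
            (n - i))))"
        using linear_maps_finsum[OF CG_kalgebra Sym_kalgebra E(1), of "\<lambda>i. vscale ((- 1) ^ i) (chain i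
          * omega_fps $ (n - i))" "{0..n}"]
        by (simp add: fps_mult_nth fps_alternate_def chain_eq_nth[symmetric] vs vscale_mult_left mult.assoc)
      also have "\<dots> = (\<lambda>u. \<Sum>i=0..n. (- 1) ^ i * series_mult (elementary i) (elementary_eval
        (omega_fps $ (n - i))) u)"
        by (rule ext, subst Sym_finsum_apply) (auto simp: E elementary_eval_chain intro!: Sym_smult_closed
          Sym_mult_closed)
      finally have "(\<lambda>u. \<Sum>i=0..n. (- 1) ^ i * series_mult (elementary i) (elementary_eval
        (omega_fps $ (n - i))) u) =
          elementary_eval ((fps_alternate chain_fps * omega_fps) $ n :: 'a cg)" by simp
      also have "\<dots> = elementary_eval 0" using False by (simp add: omega_fps)
      also have "\<dots> = (\<lambda>u. 0)" using linear_maps_zero[OF CG_kalgebra Sym_kalgebra E(1)] by simp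
      finally have 1: "(\<Sum>i=0..n. (- 1) ^ i * series_mult (elementary i) (elementary_eval (omega_fps $ (n -
        i))) u) = (0 :: 'a)" for u
        by (rule fun_cong)
      have 2: "(\<Sum>i=0..n. (- 1) ^ i * series_mult (elementary i) (complete_homogeneous (n - i)) u) = (0 ::
        'a)" for u
        using False by (intro elementary_complete_homogeneous) simp
      \<comment> \<open>For i > 0 the summands agree by the induction hypothesis; as both full sums
        vanish and e_0 = 1, so do the terms for i = 0.\<close>
      have "(\<Sum>i=1..n. (- 1) ^ i * series_mult (elementary i) (elementary_eval (omega_fps $ (n - i))) u) =
          (\<Sum>i=1..n. (- 1) ^ i * series_mult (elementary i) (complete_homogeneous (n - i)) u :: 'a)" for u
        by (rule sum.cong) (use less False in auto)
      then have "elementary_eval (omega_fps $ n) u = (complete_homogeneous n u :: 'a)" for u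
        using 1[of u] 2[of u]
        by (simp add: sum.atLeast_Suc_atMost[of 0] elementary_0 series_mult_one)
          (simp add: eq_neg_iff_add_eq_0[symmetric])
      then show ?thesis by auto
    qed
  qed
  then show "homogeneous_eval (chain n) = (elementary_eval (CG_omega (chain n)) :: 'a mpseries)"
    by (simp add: homogeneous_eval_chain CG_omega_chain)
qed

lemma homogeneous_eval_surj: "range (homogeneous_eval :: 'k::field cg \<Rightarrow> _) = carrier Sym"
proof
  show "range (homogeneous_eval :: 'k cg \<Rightarrow> _) \<subseteq> carrier Sym"
    using algebra_mapsD(2)[OF homogeneous_eval_algebra] by auto
  show "carrier Sym \<subseteq> range (homogeneous_eval :: 'k cg \<Rightarrow> _)"
  proof
    fix f assume "f \<in> carrier (Sym :: ('k, 'k mpseries) hopf)"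
    then obtain p where "f = elementary_eval p" using elementary_eval_surj by blast
    then have "f = homogeneous_eval (CG_omega p)" by (simp add: homogeneous_eval_eq CG_omega_omega)
    then show "f \<in> range (homogeneous_eval :: 'k cg \<Rightarrow> _)" by blast
  qed
qed

lemma CG_omega_phantom_ideal: "p \<in> phantom_ideal \<Longrightarrow> CG_omega p \<in> phantom_ideal"
  by (auto simp: phantom_ideal_eq CG_omega_simps CG_omega_phantom)

lemma algebra_map_phantom_ideal:
  assumes "kalgebra B" "g \<in> algebra_maps CG B" "g phantom = \<zero>\<^bsub>B\<^esub>" "p \<in> phantom_ideal"
  shows "g p = \<zero>\<^bsub>B\<^esub>"
proof -
  interpret kalgebra B by fact
  obtain q where "p = phantom * q" using assms(4) by (auto simp: phantom_ideal_eq)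
  then show ?thesis
    using assms(3) algebra_mapsD(2)[OF assms(2), of q] algebra_mapsD(5)[OF assms(2), of phantom q] by simp
qed

lemma phantom_ideal_decomposition:
  "\<exists>q r. p = q + r \<and> (\<forall>u\<in>keys q. lookup u 0 = 0) \<and> r \<in> phantom_ideal"
  for p :: "'k::field cg"
proof (induction p rule: poly_mapping_induct_on[OF subset_UNIV])
  case 1
  show ?case by (rule exI[of _ 0], rule exI[of _ 0]) (simp add: phantom_ideal_iff)
next
  case (2 u c)
  show ?case
  proof (cases "lookup u 0 = 0")
    case True
    then show ?thesis by (intro exI[of _ "single u c"] exI[of _ 0]) (simp add: phantom_ideal_iff)
  next
    case False
    \<comment> \<open>Here the witnesses are taken in the opposite order, \<open>q = 0\<close> and
      \<open>r = single u c\<close>.\<close>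
    then show ?thesis by (intro exI[of _ "single u c"] exI[of _ 0]) (simp add: phantom_ideal_iff)
  qed
next
  case (3 p p')
  then obtain q r q' r' where "p = q + r" "\<forall>u\<in>keys q. lookup u 0 = 0" "r \<in> phantom_ideal"
    "p' = q' + r'" "\<forall>u\<in>keys q'. lookup u 0 = 0" "r' \<in> phantom_ideal" by blast
  then show ?case
    by (intro exI[of _ "q + q'"] exI[of _ "r + r'"]) (auto simp: phantom_ideal_iff dest!: keys_addD)
qed

text \<open>Split \<open>CG_omega p\<close> into a phantom-free part and a part in the ideal.
  Evaluation at the e_n kills the latter and is injective on the former, so
  \<open>CG_omega p\<close> lies in the ideal; the involution preserves the ideal and brings
  \<open>p\<close> back.\<close>

lemma homogeneous_eval_eq_zero_iff: "homogeneous_eval p = \<zero>\<^bsub>Sym\<^esub> \<longleftrightarrow> p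
  \<in> phantom_ideal"
proof
  assume "p \<in> phantom_ideal"
  then show "homogeneous_eval p = \<zero>\<^bsub>Sym\<^esub>"
    by (rule algebra_map_phantom_ideal[OF Sym_kalgebra homogeneous_eval_algebra homogeneous_eval_phantom])
next
  assume 0: "homogeneous_eval p = \<zero>\<^bsub>Sym\<^esub>"
  obtain q r where qr: "CG_omega p = q + r" "\<forall>u\<in>keys q. lookup u 0 = 0" "r \<in> phantom_ideal"
    using phantom_ideal_decomposition by blast
  have "elementary_eval r = \<zero>\<^bsub>Sym\<^esub>"
    by (rule algebra_map_phantom_ideal[OF Sym_kalgebra elementary_eval_algebra elementary_eval_phantom qr(3)])
  then have "elementary_eval q = \<zero>\<^bsub>Sym\<^esub>"
    using 0 algebra_mapsD(3)[OF elementary_eval_algebra, of q r]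
    unfolding homogeneous_eval_eq qr(1) by simp
  then have "q = 0" using elementary_eval_inject[of q] qr(2) by blast
  then have "CG_omega p \<in> phantom_ideal" using qr by simp
  then have "CG_omega (CG_omega p) \<in> phantom_ideal" by (rule CG_omega_phantom_ideal)
  then show "p \<in> phantom_ideal" by (simp add: CG_omega_omega)
qed

lemma homogeneous_eval_chains: "homogeneous_eval (chains ns) = complete_homogeneous_part ns"
proof (induction ns)
  case Nil
  then show ?case using algebra_mapsD(6)[OF homogeneous_eval_algebra]
    by (simp add: chains_def complete_homogeneous_part_def Sym_algebra_def)
next
  case (Cons n ns)
  have "f \<otimes>\<^bsub>Sym_algebra\<^esub> g = f \<otimes>\<^bsub>Sym\<^esub> g" for f g :: "'a mpseries"
    by (simp add: Sym_algebra_def series_mult_def fun_eq_iff)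
  then show ?case using Cons
    by (simp add: chains_def complete_homogeneous_part_def homogeneous_eval_chain
        algebra_mapsD(5)[OF homogeneous_eval_algebra, simplified])
qed

section \<open>The comparison isomorphism\<close>

text \<open>Substitution with parameter 0 is the identity, so the chain product degenerates to the
  Cauchy product. This is why the coproduct modulo F takes the form of that of the h_n.\<close>

lemma chain_product_zero:
  fixes B :: "('k::field, 'a, 'm) module_scheme"
  assumes B: "kalgebra B" and a: "range a \<subseteq> carrier B" and b: "range b \<subseteq> carrier B" and a0:
    "a 0 = \<one>\<^bsub>B\<^esub>"
  shows "chain_product B a \<zero>\<^bsub>B\<^esub> b n = (\<Oplus>\<^bsub>B\<^esub>i\<in>{0..n}. a i
    \<otimes>\<^bsub>B\<^esub> b (n - i))"
proof -
  interpret kalgebra B by fact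
  \<comment> \<open>Even variables carry \<open>a\<close> and odd ones \<open>b\<close>.\<close>
  define \<gamma> where "\<gamma> k = (if even k then a (k div 2) else b (k div 2))" for k
  define v where "v i = (if i = 0 then 1 else cg_var (2 * i) :: 'k cg)" for i :: nat
  define w where "w i = (cg_var (2 * i + 1) :: 'k cg)" for i :: nat
  have \<gamma>: "\<gamma> \<in> UNIV \<rightarrow> carrier B"
    using subsetD[OF a rangeI] subsetD[OF b rangeI] by (simp add: \<gamma>_def)
  let ?e = "poly_eval B \<gamma>"
  have e: "?e \<in> algebra_maps CG B" by (rule poly_eval_algebra[OF \<gamma>])
  note D = algebra_mapsD(2-6)[OF e, simplified]
  have ev: "?e (v i) = a i" "?e (w i) = b i" for i
    using a0 by (simp_all add: v_def w_def D \<gamma>) (simp_all add: \<gamma>_def)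
  have e0: "?e 0 = \<zero>\<^bsub>B\<^esub>" using linear_maps_zero[OF CG_kalgebra B algebra_mapsD(1)[OF e]] by simp
  have "chain_product B a \<zero>\<^bsub>B\<^esub> b n = ?e (chain_product CG v 0 w n)"
    using algebra_maps_chain_product[OF CG_kalgebra B e, of v 0 w n] by (simp add: ev e0)
  also have "chain_product CG v 0 w n = (\<Sum>i=0..n. v i * w (n - i))"
    by (subst chain_product_CG) (simp_all add: v_def fps_mult_nth)
  also have "?e \<dots> = (\<Oplus>\<^bsub>B\<^esub>i\<in>{0..n}. a i \<otimes>\<^bsub>B\<^esub> b (n - i))"
    using linear_maps_finsum[OF CG_kalgebra B algebra_mapsD(1)[OF e], of "\<lambda>i. v i * w (n - i)" "{0..n}"]
    by (simp add: D ev)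
  finally show ?thesis .
qed

text \<open>A surjection onto \<open>A\<close> whose kernel is killed by \<open>g\<close> lets
  \<open>g\<close> descend by choosing preimages. Both the coproduct of \<open>Sym\<close> and the
  comparison map are constructed in this way.\<close>

lemma factor_through:
  fixes A :: "('k::field, 'a, 'm) module_scheme" and B :: "('k, 'b, 'n) module_scheme"
  assumes A: "kalgebra A" and B: "kalgebra B" and \<phi>: "\<phi> \<in> algebra_maps CG A" and g: "g \<in>
    algebra_maps CG B"
    and surj: "range \<phi> = carrier A" and ker: "\<And>p. \<phi> p = \<zero>\<^bsub>A\<^esub>
      \<Longrightarrow> g p = \<zero>\<^bsub>B\<^esub>"
  shows "\<exists>f. f \<in> extensional (carrier A) \<and> f \<in> algebra_maps A B \<and> (\<forall>p. f
    (\<phi> p) = g p)"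
proof -
  interpret A: kalgebra A by fact
  interpret B: kalgebra B by fact
  note D\<phi> = algebra_mapsD(2-6)[OF \<phi>, simplified] and Dg = algebra_mapsD(2-6)[OF g, simplified]
  have cong: "g p = g q" if "\<phi> p = \<phi> q" for p q
  proof -
    have "\<phi> (p + vscale (-1) q) = \<zero>\<^bsub>A\<^esub>" using that D\<phi>(1)[of q] by (simp only:
      D\<phi>(2,3) A.sm_minus A.M.r_neg)
    then have "g (p + vscale (-1) q) = \<zero>\<^bsub>B\<^esub>" by (rule ker)
    then have "g p \<ominus>\<^bsub>B\<^esub> g q = \<zero>\<^bsub>B\<^esub>" using Dg(1)[of q] by (simp only:
      Dg(2,3) B.sm_minus a_minus_def)
    then show ?thesis using B.r_right_minus_eq[of "g p" "g q"] Dg(1) by blast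
  qed
  define f where "f = restrict (\<lambda>y. g (SOME p. \<phi> p = y)) (carrier A)"
  have f: "f (\<phi> p) = g p" for p
  proof -
    have "\<phi> (SOME q. \<phi> q = \<phi> p) = \<phi> p" by (rule someI[of _ p]) simp
    then have "g (SOME q. \<phi> q = \<phi> p) = g p" by (rule cong)
    then show ?thesis using D\<phi>(1)[of p] by (simp add: f_def)
  qed
  have "f \<in> algebra_maps A B"
  proof (intro algebra_mapsI linear_mapsI)
    show "f \<one>\<^bsub>A\<^esub> = \<one>\<^bsub>B\<^esub>" using f[of 1] by (simp add: D\<phi> Dg)
    fix x assume "x \<in> carrier A"
    then obtain p where p: "x = \<phi> p" using surj by blast
    show "f x \<in> carrier B" by (simp add: p f Dg)
    show "f (c \<odot>\<^bsub>A\<^esub> x) = c \<odot>\<^bsub>B\<^esub> f x" for c using f[of "vscale c p"] by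
      (simp add: p f Dg D\<phi>)
    fix y assume "y \<in> carrier A"
    then obtain q where q: "y = \<phi> q" using surj by blast
    show "f (x \<oplus>\<^bsub>A\<^esub> y) = f x \<oplus>\<^bsub>B\<^esub> f y" using f[of "p + q"] by (simp
      add: p q f Dg D\<phi>)
    show "f (x \<otimes>\<^bsub>A\<^esub> y) = f x \<otimes>\<^bsub>B\<^esub> f y" using f[of "p * q"] by (simp
      add: p q f Dg D\<phi>)
  qed
  moreover have "f \<in> extensional (carrier A)" by (simp add: f_def)
  ultimately show ?thesis using f by blast
qed

section \<open>The quotient by the phantoms as a Hopf algebra\<close>

abbreviation chain_quot :: "('k::field, 'k cg set) hopf" where
  "chain_quot \<equiv> quot_hopf CG phantom_ideal"

abbreviation chain_proj :: "'k::field cg \<Rightarrow> 'k cg set" where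
  "chain_proj x \<equiv> phantom_ideal +>\<^bsub>CG\<^esub> x"

context
begin

interpretation CI: kalgebra_ideal "CG :: ('k::field, 'k cg) hopf" phantom_ideal
  by (intro kalgebra_ideal.intro CG_kalgebra phantom_ideal_ideal)

lemma chain_quot_sel:
  "carrier chain_quot = carrier (quot_algebra CG (phantom_ideal :: 'k::field cg set))"
  "monoid.mult chain_quot = monoid.mult (quot_algebra CG (phantom_ideal :: 'k cg set))"
  "\<one>\<^bsub>chain_quot\<^esub> = \<one>\<^bsub>quot_algebra CG (phantom_ideal :: 'k cg set)\<^esub>"
  "\<zero>\<^bsub>chain_quot\<^esub> = \<zero>\<^bsub>quot_algebra CG (phantom_ideal :: 'k cg set)\<^esub>"
  "add chain_quot = add (quot_algebra CG (phantom_ideal :: 'k cg set))"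
  "module.smult chain_quot = module.smult (quot_algebra CG (phantom_ideal :: 'k cg set))"
  by (simp_all add: quot_hopf_def module.extend_def)

lemma chain_quot_kalgebra: "kalgebra (chain_quot :: ('k::field, 'k cg set) hopf)"
  by (rule kalgebra_scheme_cong[OF CI.quot_kalgebra chain_quot_sel])

lemma chain_proj_algebra: "chain_proj \<in> algebra_maps CG (chain_quot :: ('k::field, 'k cg set) hopf)"
  using CI.quot_proj unfolding algebra_maps_def linear_maps_def ring_hom_def chain_quot_sel .

lemma chain_proj_surj: "range chain_proj = carrier (chain_quot :: ('k::field, 'k cg set) hopf)"
  unfolding chain_quot_sel CI.carrier_quot by simp

lemma chain_proj_zero_iff: "chain_proj x = \<zero>\<^bsub>chain_quot\<^esub> \<longleftrightarrow> x \<in>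
  (phantom_ideal :: 'k::field cg set)"
  unfolding chain_quot_sel CI.quot_zero using CI.coset_eq_zero_iff[of x] by simp

text \<open>The structure maps of \<open>quot_hopf\<close> apply \<open>the_elem\<close> to the
  image of a coset; a map that kills F kills the ideal and makes this image a singleton.\<close>

lemma coset_image_const:
  assumes B: "kalgebra B" and g: "g \<in> algebra_maps CG B" and p: "g phantom = \<zero>\<^bsub>B\<^esub>"
  shows "g ` chain_proj x = {g (x :: 'k::field cg)}"
proof -
  interpret B: kalgebra B by fact
  have "g y = g x" if y: "y \<in> chain_proj x" for y
  proof -
    obtain i where "i \<in> phantom_ideal" "y = i + x"
      using y unfolding a_r_coset_def'[of CG phantom_ideal x] by auto
    then show ?thesis
      using algebra_map_phantom_ideal[OF B g p, of i] algebra_mapsD(2,3)[OF g, simplified] by simp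
  qed
  moreover have "x \<in> chain_proj x" by (rule CI.a_rcos_self) simp
  ultimately show ?thesis by blast
qed

lemma tensor_chain_quot:
  "tensor (quot_algebra CG phantom_ideal) (quot_algebra CG phantom_ideal) = tensor chain_quot (chain_quot ::
    ('k::field, 'k cg set) hopf)"
  "pure_tensor (quot_algebra CG phantom_ideal) (quot_algebra CG phantom_ideal) = pure_tensor chain_quot
    (chain_quot :: ('k, 'k cg set) hopf)"
  by (rule tensor_scheme_cong; simp only: chain_quot_sel)+

end

text \<open>Once F is killed in both tensor factors, the parameter of the chain product is zero. The
  computation is shared by the quotient and \<open>Sym\<close>.\<close>

lemma comult_map_phantom:
  fixes A :: "('k::field, 'a, 'm) module_scheme"
  assumes A: "kalgebra A" and \<phi>: "\<phi> \<in> algebra_maps CG A" and p: "\<phi> phantom =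
    \<zero>\<^bsub>A\<^esub>"
  shows "(\<lambda>x. tensor_map A A \<phi> \<phi> (comult_CG x)) \<in> algebra_maps CG (tensor A A)"
    and "tensor_map A A \<phi> \<phi> (comult_CG phantom) = \<zero>\<^bsub>tensor A A\<^esub>"
    and "tensor_map A A \<phi> \<phi> (comult_CG (chain n)) =
      (\<Oplus>\<^bsub>tensor A A\<^esub>i\<in>{0..n}. pure_tensor A A (\<phi> (chain i)) (\<phi> (chain (n - i))))"
proof -
  interpret AA: kalgebra_pair A A by (intro kalgebra_pairI A)
  note D = algebra_mapsD(2-6)[OF \<phi>, simplified]
  note t = tensor_map_algebra[OF CG_kalgebra CG_kalgebra A A \<phi> \<phi>]
  show "(\<lambda>x. tensor_map A A \<phi> \<phi> (comult_CG x)) \<in> algebra_maps CG (tensor A A)"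
    by (rule algebra_maps_comp[OF comult_CG_algebra t])
  have tp: "tensor_map A A \<phi> \<phi> (pure_tensor CG CG x y) = pure_tensor A A (\<phi> x) (\<phi> y)" for x y
    using algebra_mapsD(1)[OF \<phi>] by (intro tensor_map_pure CG_kalgebra A) simp_all
  have z: "pure_tensor A A \<zero>\<^bsub>A\<^esub> y = \<zero>\<^bsub>tensor A A\<^esub>" "pure_tensor A A y
    \<zero>\<^bsub>A\<^esub> = \<zero>\<^bsub>tensor A A\<^esub>"
    if "y \<in> carrier A" for y
    using AA.pt_smult_left[of "\<zero>\<^bsub>A\<^esub>" y 0] AA.pt_smult_right[of y "\<zero>\<^bsub>A\<^esub>"
      0] that by simp_all
  show "tensor_map A A \<phi> \<phi> (comult_CG phantom) = \<zero>\<^bsub>tensor A A\<^esub>"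
    unfolding comult_CG_phantom by (subst algebra_mapsD(3)[OF t]) (simp_all add: tp p z D)
  have "chain_product (tensor A A) (\<lambda>i. pure_tensor A A (\<phi> (chain i)) \<one>\<^bsub>A\<^esub>)
    \<zero>\<^bsub>tensor A A\<^esub>
      (\<lambda>i. pure_tensor A A \<one>\<^bsub>A\<^esub> (\<phi> (chain i))) n =
    (\<Oplus>\<^bsub>tensor A A\<^esub>i\<in>{0..n}. pure_tensor A A (\<phi> (chain i)) \<one>\<^bsub>A\<^esub>
      \<otimes>\<^bsub>tensor A A\<^esub>
      pure_tensor A A \<one>\<^bsub>A\<^esub> (\<phi> (chain (n - i))))"
    by (rule chain_product_zero[OF AA.T_kalgebra]) (auto simp: D AA.T_one)
  then show "tensor_map A A \<phi> \<phi> (comult_CG (chain n)) =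
      (\<Oplus>\<^bsub>tensor A A\<^esub>i\<in>{0..n}. pure_tensor A A (\<phi> (chain i)) (\<phi> (chain (n - i))))"
    by (simp add: algebra_maps_comult_chain[OF AA.T_kalgebra t] tp p z D AA.pt_mult)
qed

lemma comult_chain_quot:
  "comult chain_quot (chain_proj x) = tensor_map chain_quot chain_quot chain_proj chain_proj (comult_CG x)"
  for x :: "'k::field cg"
proof -
  let ?g = "\<lambda>x :: 'k cg. tensor_map chain_quot chain_quot chain_proj chain_proj (comult_CG x)"
  have p: "chain_proj phantom = \<zero>\<^bsub>chain_quot :: ('k, 'k cg set) hopf\<^esub>"
    unfolding chain_proj_zero_iff by (simp only: phantom_ideal_eq) (rule image_eqI[of _ _ 1], simp_all)
  interpret QQ: kalgebra_pair "chain_quot :: ('k, 'k cg set) hopf" "chain_quot :: ('k, 'k cg set) hopf"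
    by (intro kalgebra_pairI chain_quot_kalgebra)
  note c = comult_map_phantom[OF chain_quot_kalgebra chain_proj_algebra p]
  have "?g ` chain_proj x = {?g x}"
    by (rule coset_image_const[OF QQ.T_kalgebra c(1,2)])
  then have "the_elem (?g ` chain_proj x) = ?g x" by simp
  moreover have "comult chain_quot (chain_proj x) = the_elem ((\<lambda>x.
      tensor_map (quot_algebra CG phantom_ideal) (quot_algebra CG phantom_ideal) chain_proj chain_proj
        (comult_CG x)) ` chain_proj x)"
    by (simp add: quot_hopf_def module.extend_def hopf.defs)
  moreover have "tensor_map (quot_algebra CG phantom_ideal) (quot_algebra CG phantom_ideal) chain_proj chain_proj =
      tensor_map chain_quot (chain_quot :: ('k, 'k cg set) hopf) (chain_proj :: 'k cg \<Rightarrow> _)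
        (chain_proj :: 'k cg \<Rightarrow> _)"
    unfolding tensor_map_def tensor_chain_quot ..
  ultimately show ?thesis by simp
qed

text \<open>Constancy on cosets is available for algebra maps into a \<open>kalgebra\<close>, so the
  counit is replaced by \<open>CG_unit_counit\<close>, from which the constant term is read off
  again.\<close>

lemma counit_chain_quot: "counit chain_quot (chain_proj x) = lookup x 0"
  for x :: "'k::field cg"
proof -
  have "CG_unit_counit ` chain_proj x = {CG_unit_counit x}"
    by (rule coset_image_const[OF CG_kalgebra CG_unit_counit_algebra]) (simp add: CG_unit_counit_phantom)
  then have "(\<lambda>p. lookup p 0) ` CG_unit_counit ` chain_proj x = {lookup (CG_unit_counit x) 0}"
    by simp
  then have "(\<lambda>p. lookup p 0) ` chain_proj x = {lookup x 0}"
    by (simp add: image_image CG_unit_counit_def)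
  moreover have "counit chain_quot (chain_proj x) = the_elem ((\<lambda>p. lookup p 0) ` chain_proj x)"
    by (simp add: quot_hopf_def module.extend_def hopf.defs)
  ultimately show ?thesis by simp
qed

lemma antipode_phantom_ideal: "x \<in> phantom_ideal \<Longrightarrow> antipode CG x \<in> phantom_ideal"
  using hopf_ideal.antipode_ideal[OF phantom_hopf_ideal] by blast

lemma chain_proj_hopf_image: "hopf_image CG (chain_quot :: ('k::field, 'k cg set) hopf) chain_proj"
proof (intro hopf_image.intro hopf_image_axioms.intro)
  show "hopf_algebra (CG :: ('k, 'k cg) hopf)" by (rule CG_hopf_algebra)
  show "kalgebra (chain_quot :: ('k, 'k cg set) hopf)" by (rule chain_quot_kalgebra)
  show "chain_proj \<in> algebra_maps CG (chain_quot :: ('k, 'k cg set) hopf)" by (rule chain_proj_algebra)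
  show "chain_proj ` carrier CG = carrier (chain_quot :: ('k, 'k cg set) hopf)" by (simp add: chain_proj_surj)
qed (simp_all add: comult_chain_quot counit_chain_quot chain_proj_zero_iff antipode_phantom_ideal)

section \<open>Symmetric functions as a Hopf image of \<open>CG\<close>\<close>

lemma tensor_Sym:
  "tensor Sym_algebra Sym_algebra = tensor Sym (Sym :: ('k::field, 'k mpseries) hopf)"
  "pure_tensor Sym_algebra Sym_algebra = pure_tensor Sym (Sym :: ('k, 'k mpseries) hopf)"
  by (rule tensor_scheme_cong; simp add: Sym_def module.extend_def)+

text \<open>The description of \<open>comult_Sym\<close> has a solution because the right-hand side
  kills the kernel of evaluation and so descends to \<open>Sym\<close>. The solution is unique
  because the h_n generate \<open>Sym\<close>.\<close>

lemma comult_Sym_homogeneous_eval: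
  "comult_Sym (homogeneous_eval x) = tensor_map Sym Sym homogeneous_eval homogeneous_eval (comult_CG x)"
  for x :: "'k::field cg"
proof -
  interpret SS: kalgebra_pair "Sym :: ('k, 'k mpseries) hopf" "Sym :: ('k, 'k mpseries) hopf"
    by (intro kalgebra_pairI Sym_kalgebra)
  note c = comult_map_phantom[OF Sym_kalgebra homogeneous_eval_algebra homogeneous_eval_phantom]
  have "\<exists>D. D \<in> extensional (carrier Sym) \<and> D \<in> algebra_maps Sym (tensor Sym (Sym :: ('k,
    'k mpseries) hopf)) \<and>
      (\<forall>p. D (homogeneous_eval p) = tensor_map Sym Sym homogeneous_eval homogeneous_eval (comult_CG p))"
  proof (rule factor_through[OF Sym_kalgebra SS.T_kalgebra homogeneous_eval_algebra c(1) homogeneous_eval_surj])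
    fix p :: "'k cg" assume "homogeneous_eval p = \<zero>\<^bsub>Sym\<^esub>"
    then show "tensor_map Sym Sym homogeneous_eval homogeneous_eval (comult_CG p) = \<zero>\<^bsub>tensor Sym
      Sym\<^esub>"
      unfolding homogeneous_eval_eq_zero_iff by (rule algebra_map_phantom_ideal[OF SS.T_kalgebra c(1,2)])
  qed
  then obtain D where D: "D \<in> extensional (carrier Sym)" "D \<in> algebra_maps Sym (tensor Sym (Sym :: ('k,
    'k mpseries) hopf))"
    and Dp: "\<And>p. D (homogeneous_eval p) = tensor_map Sym Sym homogeneous_eval homogeneous_eval (comult_CG p)"
    by blast
  have sel: "carrier Sym_algebra = carrier (Sym :: ('k, 'k mpseries) hopf)"
    "algebra_maps Sym_algebra W = algebra_maps (Sym :: ('k, 'k mpseries) hopf) W" for W :: "('k, 'c, 'n) module_scheme"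
    by (simp_all add: Sym_def module.extend_def algebra_maps_def linear_maps_def ring_hom_def)
  have "comult_Sym = D"
    unfolding comult_Sym_def tensor_Sym sel
  proof (rule the_equality)
    show "D \<in> extensional (carrier Sym) \<and> D \<in> algebra_maps Sym (tensor Sym Sym) \<and>
      (\<forall>n. D (complete_homogeneous n) = (\<Oplus>\<^bsub>tensor Sym Sym\<^esub>i\<in>{0..n}.
        pure_tensor Sym Sym (complete_homogeneous i) (complete_homogeneous (n - i))))"
      using D Dp[of "chain _"] by (simp add: homogeneous_eval_chain c(3))
    fix D' assume D': "D' \<in> extensional (carrier Sym) \<and> D' \<in> algebra_maps Sym (tensor Sym Sym) \<and>
      (\<forall>n. D' (complete_homogeneous n) = (\<Oplus>\<^bsub>tensor Sym Sym\<^esub>i\<in>{0..n}.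
        pure_tensor Sym Sym (complete_homogeneous i :: 'k mpseries) (complete_homogeneous (n - i))))"
    then have D'a: "D' \<in> algebra_maps Sym (tensor Sym Sym)" by blast
    have "D' (homogeneous_eval p) = D (homogeneous_eval p)" for p
    proof (rule CG_maps_eqI[OF SS.T_kalgebra algebra_maps_comp[OF homogeneous_eval_algebra D'a]
          algebra_maps_comp[OF homogeneous_eval_algebra D(2)]])
      show "D' (homogeneous_eval phantom) = D (homogeneous_eval phantom)"
        unfolding homogeneous_eval_phantom
        using linear_maps_zero[OF Sym_kalgebra SS.T_kalgebra algebra_mapsD(1)[OF D'a]]
          linear_maps_zero[OF Sym_kalgebra SS.T_kalgebra algebra_mapsD(1)[OF D(2)]] by (simp del: Sym_sel)
      fix n
      have "D' (homogeneous_eval (chain n)) = (\<Oplus>\<^bsub>tensor Sym Sym\<^esub>i\<in>{0..n}.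
        pure_tensor Sym Sym (complete_homogeneous i :: 'k mpseries) (complete_homogeneous (n - i)))"
        using D' by (simp add: homogeneous_eval_chain)
      then show "D' (homogeneous_eval (chain n)) = D (homogeneous_eval (chain n))"
        unfolding Dp c(3) by (simp add: homogeneous_eval_chain)
    qed
    then have "D' y = D y" if "y \<in> carrier Sym" for y
      using that unfolding homogeneous_eval_surj[symmetric] by blast
    then show "D' = D" using D(1) D' by (intro extensionalityI[of _ "carrier Sym"]) auto
  qed
  then show ?thesis using Dp by simp
qed

lemma homogeneous_eval_apply_zero: "homogeneous_eval x 0 = lookup x 0"
  for x :: "'k::field cg"
proof -
  have m0: "series_mult f g 0 = f 0 * g 0" for f g :: "'k mpseries"
  proof -
    have "mon_splits 0 = {(0, 0)}"
      by (auto simp: poly_mapping_eq_iff fun_eq_iff lookup_add)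
    then show ?thesis by (simp add: series_mult_def)
  qed
  note D = algebra_mapsD(2-6)[OF homogeneous_eval_algebra, simplified]
  \<comment> \<open>The constant term is viewed as a multiple of 1 in \<open>CG\<close>, so that it
    is compared with the counit on generators.\<close>
  have a: "(\<lambda>p :: 'k cg. vscale (homogeneous_eval p 0) 1) \<in> algebra_maps CG CG"
    by (intro algebra_mapsI linear_mapsI)
      (simp_all add: D m0 vs.scale_left_distrib vscale_mult_left)
  have "vscale (homogeneous_eval x 0) 1 = CG_unit_counit x"
    by (rule CG_maps_eqI[OF CG_kalgebra a CG_unit_counit_algebra])
      (auto simp: homogeneous_eval_phantom CG_unit_counit_phantom homogeneous_eval_chain CG_unit_counit_chain
        complete_homogeneous_def)
  then have "lookup (vscale (homogeneous_eval x 0) (1 :: 'k cg)) 0 = lookup (CG_unit_counit x) 0"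
    by simp
  then show ?thesis by (simp add: CG_unit_counit_def)
qed

lemma homogeneous_eval_hopf_image: "hopf_image CG (Sym :: ('k::field, 'k mpseries) hopf) homogeneous_eval"
proof (intro hopf_image.intro hopf_image_axioms.intro)
  show "hopf_algebra (CG :: ('k, 'k cg) hopf)" by (rule CG_hopf_algebra)
  show "kalgebra (Sym :: ('k, 'k mpseries) hopf)" by (rule Sym_kalgebra)
  show "homogeneous_eval \<in> algebra_maps CG (Sym :: ('k, 'k mpseries) hopf)" by (rule homogeneous_eval_algebra)
  show "homogeneous_eval ` carrier CG = carrier (Sym :: ('k, 'k mpseries) hopf)" by (simp add: homogeneous_eval_surj)
  fix x :: "'k cg"
  show "comult Sym (homogeneous_eval x) = tensor_map Sym Sym homogeneous_eval homogeneous_eval (comult CG x)"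
    by (simp add: comult_Sym_homogeneous_eval)
  show "counit Sym (homogeneous_eval x) = counit CG x" by (simp add: homogeneous_eval_apply_zero)
  assume "homogeneous_eval x = \<zero>\<^bsub>Sym\<^esub>"
  then show "homogeneous_eval (antipode CG x) = \<zero>\<^bsub>Sym\<^esub>"
    unfolding homogeneous_eval_eq_zero_iff by (rule antipode_phantom_ideal)
qed

text \<open>Phantom-free monomials are the chain products of partitions, where
  \<open>h_to_chains\<close> prescribes the value; monomials containing F go to zero on both sides.
  Linearity leaves no freedom.\<close>

lemma h_to_chains_homogeneous_eval:
  fixes f :: "'k::field mpseries \<Rightarrow> 'k cg set"
  assumes "h_to_chains f"
  shows "f (homogeneous_eval p) = chain_proj p"
proof -
  have f: "f \<in> linear_maps Sym chain_quot"
    and fh: "\<And>ns. is_partition ns \<Longrightarrow> f (complete_homogeneous_part ns) = chain_proj (chains ns)"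
    using assms by (auto simp: h_to_chains_def)
  have \<pi>: "chain_proj \<in> linear_maps CG (chain_quot :: ('k, 'k cg set) hopf)"
    by (rule algebra_mapsD(1)[OF chain_proj_algebra])
  have h: "homogeneous_eval \<in> linear_maps CG (Sym :: ('k, 'k mpseries) hopf)"
    by (rule algebra_mapsD(1)[OF homogeneous_eval_algebra])
  note fh' = linear_maps_comp[OF h f]
  note L = linear_mapsD[OF fh', simplified] linear_mapsD[OF \<pi>, simplified]
  have mon: "f (homogeneous_eval (single u 1)) = chain_proj (single u 1)" for u
  proof (cases "lookup u 0 = 0")
    case True
    obtain ns where ns: "is_partition ns" "single u 1 = (chains ns * phantom ^ lookup u 0 :: 'k cg)"
      using monomial_eq_chains by blast
    then have "single u 1 = (chains ns :: 'k cg)" using True by simp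
    then show ?thesis using fh[OF ns(1)] by (simp add: homogeneous_eval_chains)
  next
    case False
    then have I: "single u 1 \<in> (phantom_ideal :: 'k cg set)" by (simp add: phantom_ideal_iff)
    then have "homogeneous_eval (single u 1) = (\<zero>\<^bsub>Sym\<^esub> :: 'k mpseries)"
      unfolding homogeneous_eval_eq_zero_iff .
    then have "f (homogeneous_eval (single u 1)) = \<zero>\<^bsub>chain_quot\<^esub>"
      using linear_maps_zero[OF Sym_kalgebra chain_quot_kalgebra f] by simp
    then show ?thesis using I unfolding chain_proj_zero_iff[symmetric] by simp
  qed
  show ?thesis
  proof (induction p rule: poly_mapping_induct_on[OF subset_UNIV])
    case 1
    show ?case using linear_maps_zero[OF CG_kalgebra chain_quot_kalgebra fh']
        linear_maps_zero[OF CG_kalgebra chain_quot_kalgebra \<pi>] by simp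
  next
    case (2 u c)
    have "single u c = vscale c (single u 1)" by simp
    then show ?case using mon[of u] by (metis L(3) L(6))
  next
    case (3 p q)
    then show ?case by (simp add: L)
  qed
qed

lemma h_to_chains_exists: "\<exists>f :: 'k::field mpseries \<Rightarrow> 'k cg set. h_to_chains f"
proof -
  have "\<exists>f. f \<in> extensional (carrier Sym) \<and> f \<in> algebra_maps Sym (chain_quot :: ('k, 'k cg
    set) hopf) \<and>
      (\<forall>p. f (homogeneous_eval p) = chain_proj p)"
    by (rule factor_through[OF Sym_kalgebra chain_quot_kalgebra homogeneous_eval_algebra chain_proj_algebra
      homogeneous_eval_surj])
      (simp only: homogeneous_eval_eq_zero_iff chain_proj_zero_iff)
  then obtain f where "f \<in> extensional (carrier Sym)" "f \<in> algebra_maps Sym (chain_quot :: ('k, 'k cg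
    set) hopf)"
    "\<And>p. f (homogeneous_eval p) = chain_proj p" by blast
  then have "h_to_chains f"
    by (simp add: h_to_chains_def algebra_mapsD(1) homogeneous_eval_chains[symmetric])
  then show ?thesis by blast
qed

lemma h_to_chains_unique:
  assumes f: "h_to_chains f" and g: "h_to_chains g"
  shows "f = g"
proof (rule extensionalityI[of _ "carrier Sym"])
  show "f \<in> extensional (carrier Sym)" "g \<in> extensional (carrier Sym)"
    using f g by (auto simp: h_to_chains_def)
  fix y assume "y \<in> carrier (Sym :: ('a, 'a mpseries) hopf)"
  then obtain p where "y = homogeneous_eval p" unfolding homogeneous_eval_surj[symmetric] by blast
  then show "f y = g y" using h_to_chains_homogeneous_eval[OF f] h_to_chains_homogeneous_eval[OF g] by simp
qed

text \<open>Composing \<open>f\<close> with the evaluation at the h_n gives the projection to the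
  quotient. Both maps are surjective Hopf maps out of \<open>CG\<close>, so each structure map can
  be compared on a common preimage.\<close>

lemma h_to_chains_hopf_iso:
  fixes f :: "'k::field mpseries \<Rightarrow> 'k cg set"
  assumes "h_to_chains f"
  shows "hopf_iso Sym chain_quot f"
proof -
  note fp = h_to_chains_homogeneous_eval[OF assms]
  have f: "f \<in> linear_maps Sym chain_quot" using assms by (auto simp: h_to_chains_def)
  have ha: "homogeneous_eval \<in> algebra_maps CG (Sym :: ('k, 'k mpseries) hopf)"
    and \<pi>a: "chain_proj \<in> algebra_maps CG (chain_quot :: ('k, 'k cg set) hopf)"
    by (rule homogeneous_eval_algebra, rule chain_proj_algebra)
  have hS: "hopf_hom CG (Sym :: ('k, 'k mpseries) hopf) homogeneous_eval"
    and hQ: "hopf_hom CG (chain_quot :: ('k, 'k cg set) hopf) chain_proj"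
    by (rule hopf_image.hopf_hom_\<pi>, rule homogeneous_eval_hopf_image,
        rule hopf_image.hopf_hom_\<pi>, rule chain_proj_hopf_image)
  note D = algebra_mapsD(2-6)[OF ha, simplified CG_sel UNIV_I True_implies_equals]
    and DQ = algebra_mapsD(2-6)[OF \<pi>a, simplified CG_sel UNIV_I True_implies_equals]
  have surjE: "\<exists>p. y = homogeneous_eval p" if "y \<in> carrier Sym" for y :: "'k mpseries"
    using that unfolding homogeneous_eval_surj[symmetric] by blast
  have fa: "f \<in> algebra_maps Sym chain_quot"
  proof (rule algebra_mapsI[OF f])
    show "f \<one>\<^bsub>Sym\<^esub> = \<one>\<^bsub>chain_quot\<^esub>" using fp[of 1] by (simp only: D DQ)
    fix x y assume "x \<in> carrier (Sym :: ('k, 'k mpseries) hopf)" "y \<in> carrier (Sym :: ('k, 'k mpseries) hopf)"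
    then obtain p q where pq: "x = homogeneous_eval p" "y = homogeneous_eval q" using surjE by blast
    show "f (x \<otimes>\<^bsub>Sym\<^esub> y) = f x \<otimes>\<^bsub>chain_quot\<^esub> f y"
      unfolding pq using fp[of "p * q"] by (simp only: fp D DQ)
  qed
  interpret CC: kalgebra_pair "CG :: ('k, 'k cg) hopf" "CG :: ('k, 'k cg) hopf"
    by (intro kalgebra_pairI CG_kalgebra)
  note k = CG_kalgebra Sym_kalgebra chain_quot_kalgebra
  note \<pi>l = algebra_mapsD(1)[OF \<pi>a] and hl = algebra_mapsD(1)[OF ha]
  \<comment> \<open>The factorization of the projection through \<open>f\<close>, taken on both
    tensor factors.\<close>
  have comp: "tensor_map chain_quot chain_quot f f (tensor_map Sym Sym homogeneous_eval homogeneous_eval t) =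
      tensor_map chain_quot chain_quot chain_proj chain_proj t"
    if "t \<in> carrier (tensor CG (CG :: ('k, 'k cg) hopf))" for t
  proof (rule CC.T_linear_eqI[OF linear_maps_comp[OF tensor_map_linear[OF k(1) k(1) k(2) k(2) hl hl]
        tensor_map_linear[OF k(2) k(2) k(3) k(3) f f]] tensor_map_linear[OF k(1) k(1) k(3) k(3) \<pi>l \<pi>l] _ that])
    fix x y :: "'k cg"
    show "tensor_map chain_quot chain_quot f f (tensor_map Sym Sym homogeneous_eval homogeneous_eval
      (pure_tensor CG CG x y)) =
      tensor_map chain_quot chain_quot chain_proj chain_proj (pure_tensor CG CG x y)"
      by (simp add: tensor_map_pure[OF k(1) k(1) k(2) k(2) hl hl] tensor_map_pure[OF k(2) k(2) k(3) k(3) f f]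
          tensor_map_pure[OF k(1) k(1) k(3) k(3) \<pi>l \<pi>l] fp D(1) del: Sym_sel)
  qed
  have "hopf_hom Sym chain_quot f"
    unfolding hopf_hom_def
  proof (intro conjI ballI)
    show "hopf_algebra (Sym :: ('k, 'k mpseries) hopf)" "hopf_algebra (chain_quot :: ('k, 'k cg set) hopf)"
      using hS hQ by (auto simp: hopf_hom_def)
    show "f \<in> algebra_maps Sym chain_quot" by (rule fa)
    fix x assume "x \<in> carrier (Sym :: ('k, 'k mpseries) hopf)"
    then obtain p where p: "x = homogeneous_eval p" using surjE by blast
    show "tensor_map chain_quot chain_quot f f (comult Sym x) = comult chain_quot (f x)"
      using comp[of "comult_CG p"] by (simp add: p fp comult_chain_quot comult_Sym_homogeneous_eval comult_CG_simps)
    show "counit chain_quot (f x) = counit Sym x"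
      by (simp add: p fp counit_chain_quot homogeneous_eval_apply_zero)
    have "antipode Sym x = homogeneous_eval (antipode CG p)"
      using hS by (simp add: hopf_hom_def p)
    moreover have "antipode chain_quot (chain_proj p) = chain_proj (antipode CG p)"
      using hQ by (simp add: hopf_hom_def)
    ultimately show "f (antipode Sym x) = antipode chain_quot (f x)"
      by (simp add: p fp)
  qed
  moreover have "bij_betw f (carrier Sym) (carrier (chain_quot :: ('k, 'k cg set) hopf))"
  proof (rule bij_betw_imageI)
    show "inj_on f (carrier Sym)"
    proof (rule inj_onI)
      fix x y assume "x \<in> carrier Sym" "y \<in> carrier Sym" and eq: "f x = f y"
      then obtain p q where pq: "x = homogeneous_eval p" "y = homogeneous_eval q" using surjE by blast
      interpret I: kalgebra_ideal "CG :: ('k, 'k cg) hopf" phantom_ideal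
        by (intro kalgebra_ideal.intro CG_kalgebra phantom_ideal_ideal)
      \<comment> \<open>Equal cosets differ by an element of the ideal, which is the kernel of the
        evaluation.\<close>
      have "p - q \<in> phantom_ideal"
        using eq I.coset_eq_iff[of p q] by (simp add: pq fp a_minus_def CG_minus)
      then have z: "homogeneous_eval (p - q) = \<zero>\<^bsub>Sym\<^esub>" unfolding homogeneous_eval_eq_zero_iff .
      have "homogeneous_eval (q + (p - q)) = homogeneous_eval q \<oplus>\<^bsub>Sym\<^esub> homogeneous_eval (p - q)"
        by (rule D(2))
      then show "x = y" unfolding z pq by simp
    qed
    show "f ` carrier Sym = carrier (chain_quot :: ('k, 'k cg set) hopf)"
      unfolding homogeneous_eval_surj[symmetric] chain_proj_surj[symmetric] image_image fp ..
  qed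
  ultimately show ?thesis by (simp add: hopf_iso_def)
qed

theorem theorem6p1:
  shows "hopf_ideal (CG :: ('k::field, 'k cg) hopf) phantom_ideal \<and>
    (\<exists>!f :: 'k mpseries \<Rightarrow> 'k cg set. h_to_chains f) \<and>
    (\<forall>f :: 'k mpseries \<Rightarrow> 'k cg set. h_to_chains f \<longrightarrow>
       hopf_iso Sym (quot_hopf CG phantom_ideal) f)"
  using phantom_hopf_ideal h_to_chains_exists h_to_chains_unique h_to_chains_hopf_iso by blast

end
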